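(* The mapping $\Xi\colon \mathcal P(\mathbb R_+)\to\mathcal P(\mathbb R_+)$, $\Xi(\mu)=\Phi(\pi^{-1}\boxtimes\pi\boxtimes\mu)$, is a homomorphism from the semigroup $(\mathcal P(\mathbb R_+),\uplus)$ to the semigroup $(\mathcal P(\mathbb R_+),\vee_{\mathrm b})$; that is, $\Xi(\mu\uplus\nu)=\Xi(\mu)\vee_{\mathrm b}\Xi(\nu)$ for all $\mu,\nu\in\mathcal P(\mathbb R_+)$.
   Context: $\mathbb R_+=[0,\infty)$ and $\mathcal P(\mathbb R_+)$ is the set of Borel probability measures on $\mathbb R_+$. For a measure $\nu$ on $\mathbb R_+$ and $\alpha\in\mathbb R$, $\nu^{\alpha}$ denotes the push-forward of $\nu$ by $x\mapsto x^\alpha$ (for $\alpha<0$ this is used only when $\nu(\{0\})=0$). For $\mu\in\mathcal P(\mathbb R_+)$ let $\psi_\mu(t)=\int_{\mathbb R_+}\frac{tu}{1-tu}\,d\mu(u)$, $t<0$. Free multiplicative convolution $\boxtimes$: for $\mu\ne\delta_0$, $\psi_\mu$ is a strictly increasing bijection from $(-\infty,0)$ onto $(-1+\mu(\{0\}),0)$, and the $S$-transform is $S_\mu(t)=\frac{1+t}{t}\psi_\mu^{-1}(t)$, $t\in(-1+\mu(\{0\}),0)$. For $\mu,\nu\ne\delta_0$, $\mu\boxtimes\nu$ is characterized by $S_{\mu\boxtimes\nu}=S_\mu S_\nu$ on $(-1+\max\{\mu(\{0\}),\nu(\{0\})\},0)$; and $\mu\boxtimes\delta_0=\delta_0\boxtimes\mu=\delta_0$.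 $\Phi(\mu)$ denotes the weak limit of $(\mu^{\boxtimes n})^{1/n}$ as $n\to\infty$ (the limit distribution of the free multiplicative law of large numbers, which exists for every $\mu\in\mathcal P(\mathbb R_+)$), where $\mu^{\boxtimes n}$ is the $n$-fold free multiplicative convolution. $\pi$ is the standard Marchenko--Pastur law, $\pi(dx)=\frac{\sqrt{x(4-x)}}{2\pi x}\mathbf 1_{(0,4)}(x)\,dx$ (the $\pi$ in the denominator is the number), and $\pi^{-1}$ is its push-forward by $x\mapsto x^{-1}$. Boolean additive convolution $\uplus$: with $\eta_\mu(t)=\frac{\psi_\mu(t)}{1+\psi_\mu(t)}$, $t<0$, the measure $\mu\uplus\nu\in\mathcal P(\mathbb R_+)$ is characterized by $\eta_{\mu\uplus\nu}=\eta_\mu+\eta_\nu$. Boolean max-convolution $\vee_{\mathrm b}$: $\frac{1}{(\mu\vee_{\mathrm b}\nu)([0,t])}=\frac1{\mu([0,t])}+\frac1{\nu([0,t])}-1$ for $t\ge0$, where $(\mu\vee_{\mathrm b}\nu)([0,t])$ is set to be $0$ when $\mu([0,t])=0$ or $\nu([0,t])=0$. *)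

theory Defs
  imports "HOL-Probability.Probability"
begin

(* Borel probability measures on [0, \<infinity>), represented as Borel measures on the real line
   that are concentrated on [0, \<infinity>). *)
definition prob_nonneg :: "real measure set" where
  "prob_nonneg = {M. prob_space M \<and> sets M = sets borel \<and> (AE x in M. 0 \<le> x)}"

abbreviation dirac :: "real \<Rightarrow> real measure" where
  "dirac a \<equiv> return borel a"

(* Push-forward by x \<mapsto> x^\<alpha>.  Since 0 powr \<alpha> = 0 for every \<alpha>, this is the intended map on
   [0, \<infinity>) for \<alpha> > 0, and on (0, \<infinity>) for every \<alpha>. *)
definition push_powr :: "real measure \<Rightarrow> real \<Rightarrow> real measure" where
  "push_powr M \<alpha> = distr M borel (\<lambda>x. x powr \<alpha>)"

definition psi :: "real measure \<Rightarrow> real \<Rightarrow> real" where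
  "psi M t = (LINT u|M. t * u / (1 - t * u))"

definition eta :: "real measure \<Rightarrow> real \<Rightarrow> real" where
  "eta M t = psi M t / (1 + psi M t)"

(* Meaningful for M in prob_nonneg other than dirac 0 and t in S_domain M. *)
definition S_transform :: "real measure \<Rightarrow> real \<Rightarrow> real" where
  "S_transform M t = (1 + t) / t * the_inv_into {..<0} (psi M) t"

definition S_domain :: "real measure \<Rightarrow> real set" where
  "S_domain M = {-1 + measure M {0} <..< 0}"

(* The inclusion of domains makes S_transform K meaningful wherever the equation
   S_K = S_M * S_N is imposed; S_domain M \<inter> S_domain N is the interval
   (-1 + max (M {0}) (N {0}), 0). *)
definition is_free_mult_conv :: "real measure \<Rightarrow> real measure \<Rightarrow> real measure \<Rightarrow> bool" where
  "is_free_mult_conv M N K \<longleftrightarrow>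
     K \<in> prob_nonneg \<and>
     (if M = dirac 0 \<or> N = dirac 0 then K = dirac 0
      else K \<noteq> dirac 0 \<and>
           S_domain M \<inter> S_domain N \<subseteq> S_domain K \<and>
           (\<forall>t \<in> S_domain M \<inter> S_domain N.
              S_transform K t = S_transform M t * S_transform N t))"

definition free_mult_conv :: "real measure \<Rightarrow> real measure \<Rightarrow> real measure"
    (infixl "\<boxtimes>" 70) where
  "M \<boxtimes> N = (THE K. is_free_mult_conv M N K)"

(* dirac 1 is the unit of free multiplicative convolution. *)
primrec free_mult_power :: "real measure \<Rightarrow> nat \<Rightarrow> real measure" where
  "free_mult_power M 0 = dirac 1"
| "free_mult_power M (Suc n) = free_mult_power M n \<boxtimes> M"

definition free_lln_limit :: "real measure \<Rightarrow> real measure" where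
  "free_lln_limit M =
     (THE L. L \<in> prob_nonneg \<and>
             weak_conv_m (\<lambda>n. push_powr (free_mult_power M n) (1 / real n)) L)"

definition marchenko_pastur :: "real measure" where
  "marchenko_pastur = density lborel
     (\<lambda>x. ennreal (sqrt (x * (4 - x)) / (2 * pi * x) * indicator {0<..<4} x))"

definition boolean_add_conv :: "real measure \<Rightarrow> real measure \<Rightarrow> real measure"
    (infixl "\<uplus>" 65) where
  "M \<uplus> N = (THE K. K \<in> prob_nonneg \<and> (\<forall>t<0. eta K t = eta M t + eta N t))"

definition boolean_max_conv :: "real measure \<Rightarrow> real measure \<Rightarrow> real measure"
    (infixl "\<or>\<^sub>b" 65) where
  "M \<or>\<^sub>b N =
     (THE K. K \<in> prob_nonneg \<and>
        (\<forall>t\<ge>0. if measure M {0..t} = 0 \<or> measure N {0..t} = 0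
                then measure K {0..t} = 0
                else 1 / measure K {0..t} = 1 / measure M {0..t} + 1 / measure N {0..t} - 1))"

definition Xi :: "real measure \<Rightarrow> real measure" where
  "Xi M = free_lln_limit (push_powr marchenko_pastur (-1) \<boxtimes> marchenko_pastur \<boxtimes> M)"

end

(*
  Put h = neg_eta \<mu>, i.e. h r = - eta \<mu> (- r).  The functions h arising from probability
  measures on the half-line are exactly the complete Bernstein functions with h(0+) = 0; Boolean
  convolution adds them.  In terms of S-transforms, \<pi>^(-1) \<boxtimes> \<pi> has h r = sqrt r, and the n-th free
  power \<kappa>_n of \<pi>^(-1) \<boxtimes> \<pi> \<boxtimes> \<mu> is determined by neg_eta \<kappa>_n (r^n * h r) = h r.  Since
  1 / (1 + neg_eta \<kappa> r) is the integral of 1 / (1 + r u), letting n tend to infinity turns this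
  integral into a distribution function: Xi \<mu> has mass 1 / (1 + h (1 / x)) on [0, x] for x > 0, so
  adding the h's is Boolean max-convolution of the images.

  The convolutions exist because complete Bernstein functions form a class that is closed under
  pointwise limits, sums, f \<mapsto> x / f x, composition and geometric means; the inverse of r^n * h r,
  needed for \<kappa>_n, is a limit of iterates built from these operations.
*)
theory Submission
  imports Defs "HOL-Computational_Algebra.Polynomial"
begin

section \<open>Complete Bernstein functions\<close>


text \<open>All convolutions and limits are \<open>THE\<close> terms, so nothing can be said about
  them before existence is settled. Existence classically rests on analytic functions of the upper
  half-plane. Here only positive real arguments occur, and the substantial input is that x / f x
  stays in the class, proved for finite mixtures by interlacing zeros and poles. The origin of r^n *
  h r: at t = \<open>psi M (- r)\<close> the S-transform of \<open>M\<close> equals r / h r, where 1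
  + t = 1 / (1 + h r). For h = sqrt this is the common value h itself; multiplied by the factor r /
  h r of the given measure it leaves r, so the n-th power has S-transform r^n there. The argument R
  with R / h r = r^n is r^n * h r. After u = v^n the integrand 1 / (1 + R u) becomes 1 / (1 + h r *
  (r v)^n), which tends to 1 for r v < 1 and to 0 for r v > 1; this turns an integral into a
  distribution function. S-transform equations are imposed only on an interval ending at 0, which
  corresponds to small r. Hence a measure has to be identified from its transform near 0
  alone.\<close>

definition unit_clip :: "real \<Rightarrow> real" where
  "unit_clip y = max 0 (min 1 y)"

text \<open>The extreme rays \<open>x\<close>, \<open>1\<close> and \<open>x / (x + s)\<close> of the cone of complete Bernstein functions,
  normalised at \<open>x = 1\<close> and indexed by the compact interval \<open>[0, 1]\<close>, so that mixtures are closed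
  under pointwise limits.  Only \<open>x > 0\<close> is relevant.\<close>

definition kern :: "real \<Rightarrow> real \<Rightarrow> real" where
  "kern x y = x / (unit_clip y * x + (1 - unit_clip y))"

text \<open>Since \<open>kern 1 y = 1\<close>, the total mass of the mixing measure is
  \<open>f 1\<close>; factoring it out leaves a probability measure, to which weak compactness
  applies. \<open>P\<close> may live on the whole line because \<open>kern x\<close> sees
  \<open>y\<close> only through \<open>unit_clip\<close>.\<close>

definition cbf :: "(real \<Rightarrow> real) \<Rightarrow> bool" where
  "cbf f \<longleftrightarrow> 0 \<le> f 1 \<and>
     (\<exists>P. real_distribution P \<and> (\<forall>x>0. f x = f 1 * (LINT y|P. kern x y)))"

lemma unit_clip_bounds [simp]: "0 \<le> unit_clip y" "unit_clip y \<le> 1"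
  by (auto simp: unit_clip_def)

lemma unit_clip_id [simp]: "0 \<le> y \<Longrightarrow> y \<le> 1 \<Longrightarrow> unit_clip y = y"
  by (auto simp: unit_clip_def)

lemma continuous_on_unit_clip [continuous_intros]:
  "continuous_on A f \<Longrightarrow> continuous_on A (\<lambda>x. unit_clip (f x))"
  unfolding unit_clip_def by (intro continuous_intros)

lemma unit_clip_measurable [measurable]: "unit_clip \<in> borel_measurable borel"
  by (intro borel_measurable_continuous_onI continuous_intros)

lemma kern_measurable [measurable]: "kern x \<in> borel_measurable borel"
  unfolding kern_def by measurable

lemma convex_combination_pos:
  assumes "0 < (x::real)" "0 < z" "0 \<le> y" "y \<le> 1" shows "0 < y * x + (1 - y) * z"
proof (cases "y = 0")
  case False
  with assms have "0 < y * x" "0 \<le> (1 - y) * z" by auto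
  then show ?thesis by linarith
qed (use assms in auto)

lemma kern_denominator_pos: "0 < x \<Longrightarrow> 0 < unit_clip y * x + (1 - unit_clip y)"
  using convex_combination_pos[of x 1 "unit_clip y"] by simp

lemma isCont_kern: "0 < x \<Longrightarrow> isCont (kern x) y"
proof -
  assume x: "0 < x"
  have "continuous_on UNIV (kern x)"
    unfolding kern_def
    by (intro continuous_intros ballI) (use kern_denominator_pos[OF x] in \<open>auto simp: less_le\<close>)
  then show ?thesis by (simp add: continuous_on_eq_continuous_at)
qed

lemma kern_pos: "0 < x \<Longrightarrow> 0 < kern x y"
  unfolding kern_def using kern_denominator_pos by simp

lemma kern_le: "0 < x \<Longrightarrow> kern x y \<le> max 1 x"
proof -
  assume x: "0 < x"
  let ?c = "unit_clip y"
  have d: "0 < ?c * x + (1 - ?c)" using kern_denominator_pos[OF x] .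
  have "x \<le> max 1 x * (?c * x + (1 - ?c))"
  proof (cases "x \<le> 1")
    case True
    have "0 \<le> (1 - ?c) * (1 - x)" using True by simp
    then show ?thesis using True by (simp add: algebra_simps max_def)
  next
    case False
    have "x * 1 \<le> x * (?c * x + (1 - ?c))"
    proof (rule mult_left_mono)
      have "0 \<le> ?c * (x - 1)" using False by simp
      then show "1 \<le> ?c * x + (1 - ?c)" by (simp add: algebra_simps)
    qed (use x in simp)
    then show ?thesis using False by simp
  qed
  then show ?thesis unfolding kern_def using d by (simp add: divide_le_eq)
qed

lemma norm_kern_le: "0 < x \<Longrightarrow> norm (kern x y) \<le> max 1 x"
  using kern_pos[of x y] kern_le[of x y] by simp

lemma kern_one [simp]: "kern 1 y = 1"
  by (simp add: kern_def)

lemma kern_unit_clip [simp]: "kern x (unit_clip y) = kern x y"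
  by (simp add: kern_def)

lemma kern_mono: "0 < a \<Longrightarrow> a \<le> b \<Longrightarrow> kern a y \<le> kern b y"
proof -
  assume ab: "0 < a" "a \<le> b"
  let ?c = "unit_clip y"
  have d: "0 < ?c * a + (1 - ?c)" "0 < ?c * b + (1 - ?c)"
    using kern_denominator_pos[of a y] kern_denominator_pos[of b y] ab by auto
  have "0 \<le> (1 - ?c) * (b - a)" using ab by simp
  then show ?thesis unfolding kern_def using d
    by (simp add: divide_simps) (simp add: algebra_simps)
qed

lemma kern_ratio_antimono: "0 < a \<Longrightarrow> a \<le> b \<Longrightarrow> kern b y \<le> b / a * kern a y"
proof -
  assume ab: "0 < a" "a \<le> b"
  let ?c = "unit_clip y"
  have d: "0 < ?c * a + (1 - ?c)" "0 < ?c * b + (1 - ?c)"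
    using kern_denominator_pos[of a y] kern_denominator_pos[of b y] ab by auto
  have "?c * a \<le> ?c * b" using ab by (simp add: mult_left_mono)
  then have "b / (?c * b + (1 - ?c)) \<le> b / (?c * a + (1 - ?c))"
    using d ab by (intro divide_left_mono) auto
  also have "\<dots> = b / a * kern a y" using ab by (simp add: kern_def)
  finally show ?thesis by (simp add: kern_def)
qed

lemma (in prob_space) integrable_kern:
  "Y \<in> borel_measurable M \<Longrightarrow> 0 < x \<Longrightarrow> integrable M (\<lambda>w. kern x (Y w))"
  by (rule integrable_const_bound[where B="max 1 x"])
     (use norm_kern_le in \<open>auto intro!: measurable_compose[OF _ kern_measurable]\<close>)

lemma cbf_cong: "(\<And>x. 0 < x \<Longrightarrow> f x = g x) \<Longrightarrow> cbf f \<longleftrightarrow> cbf g"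
  unfolding cbf_def by simp

lemma cbf_congI: "cbf g \<Longrightarrow> (\<And>x. 0 < x \<Longrightarrow> f x = g x) \<Longrightarrow> cbf f"
  using cbf_cong by blast

lemma cbfE:
  assumes "cbf f"
  obtains P where "real_distribution P" "\<And>x. 0 < x \<Longrightarrow> f x = f 1 * (LINT y|P. kern x y)" "0 \<le> f 1"
  using assms unfolding cbf_def by blast

text \<open>The weight is absorbed into a density with respect to \<open>N\<close>, normalised by
  its integral \<open>m\<close>, which is \<open>f 1\<close>; the push-forward along
  \<open>Y\<close> is then the mixing measure. If \<open>m = 0\<close>, then \<open>f\<close>
  vanishes and any distribution serves.\<close>

lemma cbf_weighted_integral:
  assumes N: "prob_space N" and Y: "Y \<in> borel_measurable N" and w: "w \<in> borel_measurable N"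
    and w_nn: "\<And>t. 0 \<le> w t" and w_bd: "\<And>t. w t \<le> B"
    and f: "\<And>x. 0 < x \<Longrightarrow> f x = (LINT t|N. w t * kern x (Y t))"
  shows "cbf f"
proof -
  interpret prob_space N by fact
  define m where "m = (LINT t|N. w t)"
  have [measurable]: "Y \<in> borel_measurable N" "w \<in> borel_measurable N" by fact+
  have wi: "integrable N w"
    by (rule integrable_const_bound[where B=B]) (use w_nn w_bd in auto)
  have f1: "f 1 = m" by (simp add: f m_def)
  have m0: "0 \<le> m" unfolding m_def by (simp add: w_nn)
  show ?thesis
  proof (cases "m = 0")
    case True
    then have "AE t in N. w t = 0"
      unfolding m_def using integral_nonneg_eq_0_iff_AE[OF wi] w_nn by auto
    then have "f x = 0" if "0 < x" for x
      unfolding f[OF that] by (intro integral_eq_zero_AE) auto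
    then show ?thesis unfolding cbf_def
      using f1 True by (intro conjI exI[of _ "return borel 0"])
        (auto intro!: prob_space_return simp: real_distribution_def real_distribution_axioms_def)
  next
    case False
    with m0 have m: "0 < m" by simp
    define D where "D = density N (\<lambda>t. ennreal (w t / m))"
    define P where "P = distr D borel Y"
    have "prob_space D"
    proof (rule prob_spaceI)
      have "emeasure D (space D) = (\<integral>\<^sup>+ t. ennreal (w t / m) \<partial>N)"
        unfolding D_def by (subst emeasure_density) (auto intro!: nn_integral_cong)
      also have "\<dots> = ennreal (LINT t|N. w t / m)"
        using m w_nn by (intro nn_integral_eq_integral) (auto intro: wi)
      also have "\<dots> = 1" using m by (simp add: m_def[symmetric])
      finally show "emeasure D (space D) = 1" .
    qed
    then interpret D: prob_space D .
    have YD: "Y \<in> borel_measurable D" by (simp add: D_def)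
    have P: "real_distribution P" unfolding P_def using YD by (rule D.real_distribution_distr)
    have "(LINT y|P. kern x y) = f x / m" if x: "0 < x" for x
    proof -
      have "(LINT y|P. kern x y) = (LINT t|D. kern x (Y t))"
        unfolding P_def by (rule integral_distr) (auto simp: YD)
      also have "\<dots> = (LINT t|N. (w t / m) * kern x (Y t))"
        unfolding D_def using w_nn m
        by (subst integral_real_density) (auto intro!: measurable_compose[OF Y kern_measurable])
      also have "\<dots> = (LINT t|N. w t * kern x (Y t)) / m" by simp
      finally show ?thesis using f[OF x] by simp
    qed
    then show ?thesis unfolding cbf_def using P f1 m by (intro conjI exI[of _ P]) auto
  qed
qed

text \<open>Compactness: the mixing measures can be moved into [0, 1], a subsequence converges
  weakly, and \<open>kern x\<close> is bounded and continuous for each fixed x > 0, so the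
  representation passes to the limit.\<close>

lemma cbf_lim:
  assumes C: "\<And>n. cbf (F n)" and lim: "\<And>x. 0 < x \<Longrightarrow> (\<lambda>n. F n x) \<longlonglongrightarrow> f x"
  shows "cbf f"
proof -
  have "\<exists>P. real_distribution P \<and> (\<forall>x>0. F n x = F n 1 * (LINT y|P. kern x y))" for n
    using C unfolding cbf_def by blast
  then obtain P where P: "\<And>n. real_distribution (P n)"
    and FP: "\<And>n x. 0 < x \<Longrightarrow> F n x = F n 1 * (LINT y|P n. kern x y)" by metis
  \<comment> \<open>Pushing \<open>P n\<close> forward by \<open>unit_clip\<close> keeps all
    integrals of \<open>kern x\<close> and makes the family tight.\<close>
  define Q where "Q n = distr (P n) borel unit_clip" for n
  have Q: "real_distribution (Q n)" for n
  proof -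
    interpret real_distribution "P n" by (rule P)
    show ?thesis unfolding Q_def by (rule real_distribution_distr) simp
  qed
  have FQ: "F n x = F n 1 * (LINT y|Q n. kern x y)" if "0 < x" for n x
  proof -
    interpret real_distribution "P n" by (rule P)
    have "(LINT y|Q n. kern x y) = (LINT y|P n. kern x y)"
      unfolding Q_def by (subst integral_distr) auto
    then show ?thesis using FP[OF that] by simp
  qed
  have "tight Q"
    unfolding tight_def
  proof (intro conjI allI impI Q)
    fix e :: real assume e: "0 < e"
    have "measure (Q n) {-1<..1} = 1" for n
    proof -
      interpret real_distribution "P n" by (rule P)
      have "-1 < unit_clip y" for y using unit_clip_bounds(1)[of y] by linarith
      then have "unit_clip -` {-1<..1} = UNIV" by auto
      then show ?thesis unfolding Q_def by (subst measure_distr) (auto simp: prob_space[simplified])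
    qed
    then show "\<exists>a b. a < b \<and> (\<forall>n. 1 - e < measure (Q n) {a<..b})"
      using e by (intro exI[of _ "-1"] exI[of _ 1]) auto
  qed
  from tight_imp_convergent_subsubsequence[OF this strict_mono_id]
  obtain s R where s: "strict_mono s" and R: "real_distribution R" and w: "weak_conv_m (Q \<circ> s) R"
    by (auto simp: o_def id_def)
  have lims: "(\<lambda>n. LINT y|(Q \<circ> s) n. kern x y) \<longlonglongrightarrow> (LINT y|R. kern x y)" if x: "0 < x" for x
    by (rule weak_conv_imp_integral_bdd_continuous_conv[OF _ R w])
       (use Q isCont_kern[OF x] norm_kern_le[OF x] in auto)
  have "0 \<le> f 1"
    by (rule LIMSEQ_le_const[OF lim]) (use C in \<open>auto simp: cbf_def\<close>)
  moreover have "f x = f 1 * (LINT y|R. kern x y)" if x: "0 < x" for x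
  proof (rule LIMSEQ_unique)
    show "(\<lambda>n. F (s n) x) \<longlonglongrightarrow> f x"
      using LIMSEQ_subseq_LIMSEQ[OF lim[OF x] s] by (simp add: o_def)
    have "(\<lambda>n. F (s n) 1 * (LINT y|(Q \<circ> s) n. kern x y)) \<longlonglongrightarrow> f 1 * (LINT y|R. kern x y)"
      using LIMSEQ_subseq_LIMSEQ[OF lim[of 1] s] by (intro tendsto_mult lims x) (simp add: o_def)
    then show "(\<lambda>n. F (s n) x) \<longlonglongrightarrow> f 1 * (LINT y|R. kern x y)"
      using FQ[OF x] by simp
  qed
  ultimately show ?thesis unfolding cbf_def using R by blast
qed

lemma cbf_nonneg:
  assumes "cbf f" "0 < x" shows "0 \<le> f x"
proof -
  from assms obtain P where P: "real_distribution P" and f: "f x = f 1 * (LINT y|P. kern x y)" "0 \<le> f 1"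
    by (auto simp: cbf_def)
  interpret real_distribution P by fact
  have "0 \<le> (LINT y|P. kern x y)" using kern_pos[OF assms(2)] by (simp add: less_imp_le)
  then show ?thesis using f by simp
qed

lemma cbf_mono:
  assumes "cbf f" "0 < a" "a \<le> b" shows "f a \<le> f b"
proof -
  obtain P where P: "real_distribution P"
    and f: "\<And>x. 0 < x \<Longrightarrow> f x = f 1 * (LINT y|P. kern x y)" "0 \<le> f 1"
    by (rule cbfE[OF assms(1)]) (rule that)
  interpret real_distribution P by fact
  have "(LINT y|P. kern a y) \<le> (LINT y|P. kern b y)"
    using assms by (intro integral_mono integrable_kern kern_mono) auto
  then have "f 1 * (LINT y|P. kern a y) \<le> f 1 * (LINT y|P. kern b y)"
    using f(2) by (rule mult_left_mono)
  moreover have "f a = f 1 * (LINT y|P. kern a y)" "f b = f 1 * (LINT y|P. kern b y)"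
    using assms by (auto intro!: f(1))
  ultimately show ?thesis by metis
qed

text \<open>Together with \<open>cbf_mono\<close> this gives f a \<le> f b \<le> (b / a) * f a, the
  only regularity of the class used later: it yields continuity and the Lipschitz bound for
  \<open>ln f\<close> as a function of \<open>ln x\<close>.\<close>

lemma cbf_ratio_antimono:
  assumes "cbf f" "0 < a" "a \<le> b" shows "f b \<le> b / a * f a"
proof -
  obtain P where P: "real_distribution P"
    and f: "\<And>x. 0 < x \<Longrightarrow> f x = f 1 * (LINT y|P. kern x y)" "0 \<le> f 1"
    by (rule cbfE[OF assms(1)]) (rule that)
  interpret real_distribution P by fact
  have "(LINT y|P. kern b y) \<le> (LINT y|P. b / a * kern a y)"
    using assms by (intro integral_mono integrable_mult_right integrable_kern kern_ratio_antimono) auto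
  also have "\<dots> = b / a * (LINT y|P. kern a y)" by simp
  finally have "f 1 * (LINT y|P. kern b y) \<le> f 1 * (b / a * (LINT y|P. kern a y))"
    using f(2) by (rule mult_left_mono)
  moreover have "f a = f 1 * (LINT y|P. kern a y)" "f b = f 1 * (LINT y|P. kern b y)"
    using assms by (auto intro!: f(1))
  ultimately show ?thesis by (metis mult.left_commute)
qed

lemma cbf_isCont:
  assumes f: "cbf f" and x: "0 < x" shows "isCont f x"
proof -
  let ?l = "\<lambda>z. min (f x) (z / x * f x)" and ?u = "\<lambda>z. max (f x) (z / x * f x)"
  have ev: "eventually (\<lambda>z. 0 < z) (at x)"
    by (rule order_tendstoD(1)[OF tendsto_ident_at x])
  have "?l z \<le> f z \<and> f z \<le> ?u z" if z: "0 < z" for z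
  proof (cases "x \<le> z")
    case True then show ?thesis
      using cbf_mono[OF f x True] cbf_ratio_antimono[OF f x True] by (auto simp: min_def max_def)
  next
    case False
    then have zx: "z \<le> x" by simp
    have "f x \<le> x / z * f z" by (rule cbf_ratio_antimono[OF f z zx])
    then have "z / x * f x \<le> f z" using x z by (simp add: field_simps)
    then show ?thesis
      using cbf_mono[OF f z zx] by (auto simp: min_def max_def)
  qed
  note bounds = this
  have l: "(?l \<longlongrightarrow> min (f x) (x / x * f x)) (at x)" and u: "(?u \<longlongrightarrow> max (f x) (x / x * f x)) (at x)"
    by (intro tendsto_intros; use x in simp)+
  show ?thesis unfolding isCont_def
    by (rule tendsto_sandwich[of ?l f "at x" ?u])
       (use bounds ev l u x in \<open>auto elim!: eventually_mono\<close>)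
qed

section \<open>Finite mixtures and approximation by them\<close>

lemma cbf_kern_multiple:
  "0 \<le> w \<Longrightarrow> cbf (\<lambda>x. w * kern x y)"
  by (rule cbf_weighted_integral[of "return borel 0" "\<lambda>_. y" "\<lambda>_. w" w])
     (auto simp: prob_space_return integral_return measure_return)

lemma cbf_nodes:
  fixes n :: nat
  assumes w: "\<And>j. 0 \<le> w j" shows "cbf (\<lambda>x. \<Sum>j\<le>n. w j * kern x (y j))"
proof -
  let ?N = "measure_pmf (pmf_of_set {..n})"
  \<comment> \<open>The factor \<open>Suc n\<close> cancels the uniform probability of each of the n
    + 1 points.\<close>
  define v where "v j = real (Suc n) * (if j \<le> n then w j else 0)" for j
  have "(\<Sum>j\<le>n. w j * kern x (y j)) = (LINT j|?N. v j * kern x (y j))" for x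
  proof -
    have "(LINT j|?N. v j * kern x (y j)) = (\<Sum>j\<le>n. v j * kern x (y j)) / real (Suc n)"
      by (subst integral_pmf_of_set) auto
    also have "\<dots> = (\<Sum>j\<le>n. w j * kern x (y j))"
      unfolding sum_divide_distrib by (intro sum.cong refl) (simp add: v_def del: of_nat_Suc)
    finally show ?thesis ..
  qed
  moreover have "v j \<le> real (Suc n) * (\<Sum>j\<le>n. w j)" for j
  proof -
    have "(if j \<le> n then w j else 0) \<le> (\<Sum>j\<le>n. w j)"
      using w by (auto intro!: member_le_sum sum_nonneg)
    then show ?thesis unfolding v_def by (rule mult_left_mono) simp
  qed
  moreover have "0 \<le> v j" for j using w by (simp add: v_def)
  ultimately show ?thesis
    by (intro cbf_weighted_integral[of ?N y v "real (Suc n) * (\<Sum>j\<le>n. w j)"])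
       (auto simp: measure_pmf.prob_space_axioms)
qed

text \<open>The grid avoids 0, so each \<open>kern x (node n j)\<close> is a positive multiple of x
  / (x + b) with finite b = (1 - y) / y, where y is the node. Nodes decrease in \<open>j\<close>,
  hence these b increase from 0.\<close>

definition node :: "nat \<Rightarrow> nat \<Rightarrow> real" where
  "node n j = 1 - real j / real (Suc n)"

lemma node_bounds: "j \<le> n \<Longrightarrow> 0 < node n j" "node n j \<le> 1"
  by (auto simp: node_def divide_simps)

text \<open>Riemann sums: the mixing variable is rounded to a node and dominated convergence
  applies. Positivity of every weight is what later makes zeros and poles interlace
  strictly.\<close>

lemma cbf_approx:
  assumes f: "cbf f"
  obtains w where "\<And>n j. 0 < w n j"
    "\<And>x. 0 < x \<Longrightarrow> (\<lambda>n. \<Sum>j\<le>n. w n j * kern x (node n j)) \<longlonglongrightarrow> f x"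
proof -
  obtain P where P: "real_distribution P"
    and fP: "\<And>x. 0 < x \<Longrightarrow> f x = f 1 * (LINT y|P. kern x y)" and f1: "0 \<le> f 1"
    by (rule cbfE[OF f]) (rule that)
  interpret real_distribution P by fact
  \<comment> \<open>The cap \<open>min n\<close> acts where \<open>unit_clip y = 0\<close>: there
    the floor is n + 1, one past the last node. The rounding error stays at most 1 / (n +
    1).\<close>
  define idx where "idx n y = min n (nat \<lfloor>(1 - unit_clip y) * Suc n\<rfloor>)" for n y
  define g where "g n y = node n (idx n y)" for n y
  have [measurable]: "idx n \<in> measurable borel (count_space UNIV)" for n
    unfolding idx_def by measurable
  have idx_sets: "idx n -` {j} \<in> sets borel" for n j
    using measurable_sets[of "idx n" borel "count_space UNIV" "{j}"] by simp
  have g_close: "\<bar>g n y - unit_clip y\<bar> \<le> 1 / real (Suc n)" for n y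
  proof -
    define t where "t = (1 - unit_clip y) * Suc n"
    have t: "0 \<le> t" "t \<le> Suc n" unfolding t_def
      using mult_right_mono[of "1 - unit_clip y" 1 "real (Suc n)"] by auto
    have "\<bar>real (idx n y) - t\<bar> \<le> 1"
      unfolding idx_def t_def[symmetric] using t by (auto simp: min_def) linarith+
    then have "\<bar>(real (idx n y) - t) / real (Suc n)\<bar> \<le> 1 / real (Suc n)"
      unfolding abs_divide abs_of_nat by (rule divide_right_mono) simp
    moreover have "(real (idx n y) - t) / real (Suc n) = unit_clip y - g n y"
      by (simp add: t_def g_def node_def field_simps)
    ultimately show ?thesis by linarith
  qed
  have g_lim: "(\<lambda>n. g n y) \<longlonglongrightarrow> unit_clip y" for y
  proof -
    have "(\<lambda>n. g n y - unit_clip y) \<longlonglongrightarrow> 0"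
      by (rule Lim_null_comparison[OF always_eventually LIMSEQ_inverse_real_of_nat])
         (use g_close in \<open>auto simp: inverse_eq_divide\<close>)
    then show ?thesis by (simp add: LIM_zero_iff)
  qed
  \<comment> \<open>The summand \<open>1 / (n + 1)\<^sup>2\<close> only serves to make all weights strictly positive.\<close>
  define w where "w n j = f 1 * measure P (idx n -` {j}) + (1 / real (Suc n)) ^ 2" for n j
  have "0 < w n j" for n j unfolding w_def using f1 by (intro add_nonneg_pos mult_nonneg_nonneg) auto
  moreover have "(\<lambda>n. \<Sum>j\<le>n. w n j * kern x (node n j)) \<longlonglongrightarrow> f x" if x: "0 < x" for x
  proof -
    have eq: "(LINT y|P. kern x (g n y)) = (\<Sum>j\<le>n. measure P (idx n -` {j}) * kern x (node n j))" for n
    proof -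
      have "(LINT y|P. kern x (g n y))
          = (LINT y|P. (\<Sum>j\<le>n. indicator (idx n -` {j}) y * kern x (node n j)))"
      proof (intro Bochner_Integration.integral_cong refl)
        fix y
        have "(\<Sum>j\<le>n. indicator (idx n -` {j}) y * kern x (node n j))
            = (\<Sum>j\<le>n. if j = idx n y then kern x (node n j) else 0)"
          by (intro sum.cong) (auto simp: indicator_def)
        also have "\<dots> = kern x (g n y)" by (simp add: g_def idx_def)
        finally show "kern x (g n y) = (\<Sum>j\<le>n. indicator (idx n -` {j}) y * kern x (node n j))" ..
      qed
      also have "\<dots> = (\<Sum>j\<le>n. measure P (idx n -` {j}) * kern x (node n j))"
        by (subst Bochner_Integration.integral_sum)
           (auto intro!: integrable_mult_left integrable_real_indicator sum.cong
              simp: emeasure_eq_measure idx_sets)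
      finally show ?thesis .
    qed
    have 1: "(\<lambda>n. LINT y|P. kern x (g n y)) \<longlonglongrightarrow> (LINT y|P. kern x (unit_clip y))"
    proof (rule integral_dominated_convergence[where w="\<lambda>_. max 1 x"])
      show "AE y in P. (\<lambda>n. kern x (g n y)) \<longlonglongrightarrow> kern x (unit_clip y)"
        using isCont_tendsto_compose[OF isCont_kern[OF x] g_lim] by auto
    qed (use norm_kern_le[OF x] in \<open>auto simp: g_def intro!: measurable_compose[OF _ kern_measurable]\<close>)
    have 2: "(\<lambda>n. \<Sum>j\<le>n. (1 / real (Suc n)) ^ 2 * kern x (node n j)) \<longlonglongrightarrow> 0"
    proof (rule Lim_null_comparison[OF always_eventually])
      show "\<forall>n. norm (\<Sum>j\<le>n. (1 / real (Suc n)) ^ 2 * kern x (node n j)) \<le> max 1 x / real (Suc n)"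
      proof
        fix n
        have "norm (\<Sum>j\<le>n. (1 / real (Suc n)) ^ 2 * kern x (node n j))
            \<le> (\<Sum>j\<le>n. (1 / real (Suc n)) ^ 2 * max 1 x)"
          using norm_kern_le[OF x] unfolding norm_mult
          by (intro sum_norm_le) (auto simp: abs_mult intro!: mult_left_mono divide_right_mono)
        also have "\<dots> = max 1 x / real (Suc n)"
          by (simp add: power2_eq_square)
        finally show "norm (\<Sum>j\<le>n. (1 / real (Suc n)) ^ 2 * kern x (node n j)) \<le> max 1 x / real (Suc n)" .
      qed
      show "(\<lambda>n. max 1 x / real (Suc n)) \<longlonglongrightarrow> 0"
        by (rule LIMSEQ_Suc[OF lim_const_over_n])
    qed
    have "(\<lambda>n. f 1 * (LINT y|P. kern x (g n y)) + (\<Sum>j\<le>n. (1 / real (Suc n)) ^ 2 * kern x (node n j)))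
        \<longlonglongrightarrow> f 1 * (LINT y|P. kern x (unit_clip y)) + 0"
      by (intro tendsto_add tendsto_mult tendsto_const 1 2)
    moreover have "f 1 * (LINT y|P. kern x (g n y)) + (\<Sum>j\<le>n. (1 / real (Suc n)) ^ 2 * kern x (node n j))
        = (\<Sum>j\<le>n. w n j * kern x (node n j))" for n
      unfolding eq w_def sum_distrib_left sum.distrib[symmetric]
      by (intro sum.cong refl) (simp add: algebra_simps)
    ultimately show ?thesis using fP[OF x] by simp
  qed
  ultimately show ?thesis using that by blast
qed

text \<open>Approximants of \<open>f\<close> and \<open>g\<close> use the same nodes, so only their
  weights have to be added.\<close>

lemma cbf_add:
  assumes "cbf f" "cbf g" shows "cbf (\<lambda>x. f x + g x)"
proof -
  obtain w where w: "\<And>n j. 0 < w n j"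
    "\<And>x. 0 < x \<Longrightarrow> (\<lambda>n. \<Sum>j\<le>n. w n j * kern x (node n j)) \<longlonglongrightarrow> f x"
    using cbf_approx[OF assms(1)] by metis
  obtain v where v: "\<And>n j. 0 < v n j"
    "\<And>x. 0 < x \<Longrightarrow> (\<lambda>n. \<Sum>j\<le>n. v n j * kern x (node n j)) \<longlonglongrightarrow> g x"
    using cbf_approx[OF assms(2)] by metis
  show ?thesis
  proof (rule cbf_lim)
    show "cbf (\<lambda>x. \<Sum>j\<le>n. (w n j + v n j) * kern x (node n j))" for n
      using w(1)[of n] v(1)[of n] by (intro cbf_nodes add_nonneg_nonneg) (auto intro: less_imp_le)
    show "(\<lambda>n. \<Sum>j\<le>n. (w n j + v n j) * kern x (node n j)) \<longlonglongrightarrow> f x + g x" if "0 < x" for x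
      using tendsto_add[OF w(2)[OF that] v(2)[OF that]]
      by (simp add: distrib_right sum.distrib)
  qed
qed

lemma cbf_scale:
  assumes f: "cbf f" and c: "0 \<le> c" shows "cbf (\<lambda>x. c * f x)"
proof (rule cbfE[OF f])
  fix P assume P: "real_distribution P" and fP: "\<And>x. 0 < x \<Longrightarrow> f x = f 1 * (LINT y|P. kern x y)"
    and f1: "0 \<le> f 1"
  have "c * f x = c * f 1 * (LINT y|P. kern x y)" if "0 < x" for x
    by (subst fP[OF that]) simp
  then have "\<forall>x>0. c * f x = c * f 1 * (LINT y|P. kern x y)" by simp
  moreover have "0 \<le> c * f 1" using f1 c by simp
  ultimately show ?thesis unfolding cbf_def using P by (intro conjI exI[of _ P])
qed

lemma cbf_ident: "cbf (\<lambda>x. x)"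
  using cbf_kern_multiple[of 1 0] by (simp add: kern_def)

lemma cbf_const: "0 \<le> c \<Longrightarrow> cbf (\<lambda>x. c)"
proof -
  assume c: "0 \<le> c"
  have "cbf (\<lambda>x. c) \<longleftrightarrow> cbf (\<lambda>x. c * kern x 1)"
    by (rule cbf_cong) (simp add: kern_def)
  then show ?thesis using cbf_kern_multiple[OF c, of 1] by simp
qed

lemma cbf_rational: "0 < s \<Longrightarrow> cbf (\<lambda>x. x / (x + s))"
proof -
  assume s: "0 < s"
  have "x / (x + s) = 1 / (1 + s) * kern x (1 / (1 + s))" if "0 < x" for x
  proof -
    have "1 / (1 + s) * x + (1 - 1 / (1 + s)) = (x + s) / (1 + s)"
    proof -
      have "1 - 1 / (1 + s) = s / (1 + s)" using s by (simp add: eq_divide_eq left_diff_distrib)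
      then show ?thesis by (simp add: add_divide_distrib)
    qed
    then show ?thesis using s that by (simp add: kern_def)
  qed
  then have "cbf (\<lambda>x. x / (x + s)) \<longleftrightarrow> cbf (\<lambda>x. 1 / (1 + s) * kern x (1 / (1 + s)))"
    by (rule cbf_cong)
  then show ?thesis using cbf_kern_multiple[of "1 / (1 + s)" "1 / (1 + s)"] s by simp
qed

lemma cbf_sum:
  assumes "finite I" "\<And>i. i \<in> I \<Longrightarrow> cbf (f i)" shows "cbf (\<lambda>x. \<Sum>i\<in>I. f i x)"
  using assms
proof (induction I rule: finite_induct)
  case (insert i I)
  then have "cbf (\<lambda>x. f i x + (\<Sum>i\<in>I. f i x))" by (intro cbf_add) auto
  then show ?case using insert by simp
qed (simp add: cbf_const)

section \<open>The involution sending f to x / f\<close>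


lemma prod_sign_count:
  fixes t :: "'a \<Rightarrow> real"
  assumes "finite A" "\<And>k. k \<in> A \<Longrightarrow> t k \<noteq> 0"
  shows "0 < (-1) ^ card {k\<in>A. t k < 0} * prod t A"
  using assms
proof (induction A rule: finite_induct)
  case (insert a A)
  have IH: "0 < (-1) ^ card {k\<in>A. t k < 0} * prod t A"
    by (rule insert.IH) (use insert.prems in auto)
  show ?case
  proof (cases "t a < 0")
    case True
    then have "{k\<in>insert a A. t k < 0} = insert a {k\<in>A. t k < 0}" by auto
    moreover have "0 < - t a * ((-1) ^ card {k\<in>A. t k < 0} * prod t A)"
      by (rule mult_pos_pos[OF _ IH]) (use True in simp)
    ultimately show ?thesis using insert.hyps by (simp add: mult_ac)
  next
    case False
    then have "{k\<in>insert a A. t k < 0} = {k\<in>A. t k < 0}" by auto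
    moreover have "0 < t a * ((-1) ^ card {k\<in>A. t k < 0} * prod t A)"
      by (rule mult_pos_pos[OF _ IH]) (use insert.prems[of a] False in simp)
    ultimately show ?thesis using insert.hyps by (simp add: mult_ac)
  qed
qed simp

text \<open>This turns coefficient and root data into polynomial identities, first for the
  factorisation of the numerator and then for the partial fraction expansion of the
  reciprocal.\<close>

lemma poly_eqI_degree_roots:
  fixes p :: "real poly"
  assumes "\<And>i. n \<le> i \<Longrightarrow> coeff p i = 0" "inj_on s {..<n}" "\<And>j. j < n \<Longrightarrow> poly p (s j) = 0"
  shows "p = 0"
proof (rule ccontr)
  assume p: "p \<noteq> 0"
  have "degree p < n"
    using assms(1)[of "degree p"] p by (meson leading_coeff_0_iff not_le)
  moreover have "n = card (s ` {..<n})" using assms(2) by (simp add: card_image)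
  moreover have "card (s ` {..<n}) \<le> card {x. poly p x = 0}"
    using assms(3) p by (intro card_mono poly_roots_finite) auto
  ultimately show False using card_poly_roots_bound[OF p] by linarith
qed

lemma degree_prod_linear: "degree (\<Prod>k\<in>A. [:b k, 1::real:]) = card A"
  by (cases "finite A") (simp_all add: degree_prod_sum_eq)

lemma lead_coeff_prod_linear: "coeff (\<Prod>k\<in>A. [:b k, 1::real:]) (card A) = 1"
  using lead_coeff_prod[of "\<lambda>k. [:b k, 1::real:]" A] by (simp add: degree_prod_linear)

text \<open>The zeros of \<open>\<Sum>j\<le>n. c j / (x + b j)\<close> interlace its poles, which fixes the signs of the
  residues of the reciprocal.\<close>

lemma interlacing_reciprocal:
  fixes b c :: "nat \<Rightarrow> real"
  assumes b: "strict_mono b" "0 \<le> b 0" and c: "\<And>j. 0 < c j"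
  obtains \<alpha> \<beta> e s where "0 \<le> \<alpha>" "0 \<le> \<beta>" "\<And>j. j < n \<Longrightarrow> 0 < (s j :: real)" "\<And>j. j < n \<Longrightarrow> 0 \<le> (e j :: real)"
    "\<And>x. 0 < x \<Longrightarrow> 1 / (\<Sum>j\<le>n. c j / (x + b j)) = \<alpha> * x + \<beta> + (\<Sum>j<n. e j * (x / (x + s j)))"
proof -
  \<comment> \<open>Over the common denominator \<open>D\<close> the sum is \<open>N\<close> /
    \<open>D\<close>; \<open>L j\<close> is \<open>D\<close> with its factor \<open>j\<close>
    removed.\<close>
  define D where "D = (\<Prod>k\<le>n. [:b k, 1:])"
  define L where "L j = (\<Prod>k\<in>{..n}-{j}. [:b k, 1:])" for j
  define N where "N = (\<Sum>j\<le>n. smult (c j) (L j))"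
  have b_pos: "0 \<le> b j" for j using b monoD[OF strict_mono_mono[OF b(1)], of 0 j] by simp
  have b_less: "b i < b j \<longleftrightarrow> i < j" for i j using b(1) by (simp add: strict_mono_less)
  have polyL: "poly (L j) x = (\<Prod>k\<in>{..n}-{j}. x + b k)" for j x
    by (simp add: L_def poly_prod add.commute)
  have polyD: "poly D x = (\<Prod>k\<le>n. x + b k)" for x
    by (simp add: D_def poly_prod add.commute)
  have polyN_node: "poly N (- b j) = c j * poly (L j) (- b j)" if "j \<le> n" for j
  proof -
    have "poly (L i) (- b j) = 0" if "i \<noteq> j" for i
      unfolding polyL using that \<open>j \<le> n\<close> by (intro prod_zero) auto
    then have "poly N (- b j) = (\<Sum>i\<le>n. if i = j then c j * poly (L j) (- b j) else 0)"
      unfolding N_def poly_sum poly_smult by (intro sum.cong) auto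
    then show ?thesis using that by simp
  qed
  \<comment> \<open>At the pole \<open>- b j\<close> only the term with \<open>L j\<close> survives,
    and exactly the j factors with smaller index are negative. So \<open>N\<close> alternates in
    sign along the poles and has a zero in every gap.\<close>
  have sign_node: "0 < (-1) ^ j * poly N (- b j)" if j: "j \<le> n" for j
  proof -
    have "{k \<in> {..n}-{j}. - b j + b k < 0} = {..<j}" using b_less j by auto
    moreover have "0 < (-1) ^ card {k \<in> {..n}-{j}. - b j + b k < 0} * (\<Prod>k\<in>{..n}-{j}. - b j + b k)"
      using b(1) by (intro prod_sign_count) (auto dest: strict_mono_eq)
    ultimately have "0 < (-1) ^ j * poly (L j) (- b j)" by (simp add: polyL)
    then have "0 < c j * ((-1) ^ j * poly (L j) (- b j))" using c[of j] by simp
    then show ?thesis using polyN_node[OF j] by (simp add: mult_ac)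
  qed
  have "\<exists>s. b j < s \<and> s < b (Suc j) \<and> poly N (- s) = 0" if j: "j < n" for j
  proof -
    have bl: "b j < b (Suc j)" using b_less by simp
    have "0 < ((-1) ^ j * poly N (- b j)) * ((-1) ^ Suc j * poly N (- b (Suc j)))"
      by (rule mult_pos_pos[OF sign_node sign_node]) (use j in auto)
    also have "\<dots> = - (((-1) ^ j * (-1) ^ j) * (poly N (- b j) * poly N (- b (Suc j))))" by simp
    also have "(-1::real) ^ j * (-1) ^ j = 1" by (simp add: power_add[symmetric])
    finally have "poly N (- b (Suc j)) * poly N (- b j) < 0" by (simp add: mult.commute)
    then obtain x where "- b (Suc j) < x" "x < - b j" "poly N x = 0"
      using poly_IVT[of "- b (Suc j)" "- b j" N] bl by auto
    then show ?thesis by (intro exI[of _ "- x"]) auto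
  qed
  then obtain s where s: "\<And>j. j < n \<Longrightarrow> b j < s j" "\<And>j. j < n \<Longrightarrow> s j < b (Suc j)"
    "\<And>j. j < n \<Longrightarrow> poly N (- s j) = 0" by metis
  have s_pos: "0 < s j" if "j < n" for j using s(1)[OF that] b_pos[of j] by linarith
  have s_less: "s i < s j" if "i < j" "j < n" for i j
  proof -
    have "b (Suc i) \<le> b j" using that monoD[OF strict_mono_mono[OF b(1)], of "Suc i" j] by simp
    then show ?thesis using s(2)[of i] s(1)[of j] that by linarith
  qed
  have s_neq: "s i \<noteq> s j" if "i \<noteq> j" "i < n" "j < n" for i j
    using s_less[of i j] s_less[of j i] that by (metis nat_neq_iff less_irrefl)
  have s_inj: "inj_on (\<lambda>j. - s j) {..<n}" using s_neq by (auto simp: inj_on_def)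
  define C where "C = (\<Sum>j\<le>n. c j)"
  have C: "0 < C" unfolding C_def by (intro sum_pos) (use c in auto)
  define V where "V = (\<Prod>l<n. [:s l, 1:])"
  define W where "W j = (\<Prod>l\<in>{..<n}-{j}. [:s l, 1:])" for j
  have polyV: "poly V x = (\<Prod>k<n. x + s k)" for x by (simp add: V_def poly_prod add.commute)
  have polyW: "poly (W j) x = (\<Prod>k\<in>{..<n}-{j}. x + s k)" for x j by (simp add: W_def poly_prod add.commute)
  have degL: "degree (L j) = n" if "j \<le> n" for j unfolding L_def degree_prod_linear using that by simp
  have coeffL: "coeff (L j) n = 1" if "j \<le> n" for j
    unfolding L_def using lead_coeff_prod_linear[of b "{..n}-{j}"] that by simp
  have coeffN_top: "coeff N n = C"
    unfolding N_def C_def coeff_sum by (intro sum.cong) (auto simp: coeffL)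
  have coeffN: "coeff N i = 0" if "n < i" for i
    unfolding N_def coeff_sum using that by (intro sum.neutral ballI) (auto intro!: coeff_eq_0 simp: degL)
  have degV: "degree V = n" unfolding V_def degree_prod_linear by simp
  have coeffV_top: "coeff V n = 1" using lead_coeff_prod_linear[of s "{..<n}"] by (simp add: V_def)
  have coeffV: "coeff V i = 0" if "n < i" for i using that by (intro coeff_eq_0) (simp add: degV)
  \<comment> \<open>The n zeros just found exhaust the degree of \<open>N\<close>, whose leading
    coefficient is \<open>C\<close>.\<close>
  have NV: "N = smult C V"
  proof -
    have "N - smult C V = 0"
    proof (rule poly_eqI_degree_roots[of n _ "\<lambda>j. - s j", OF _ s_inj])
      show "coeff (N - smult C V) i = 0" if "n \<le> i" for i
        using that coeffN_top coeffV_top coeffN[of i] coeffV[of i] by (cases "i = n") auto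
      show "poly (N - smult C V) (- s j) = 0" if "j < n" for j
      proof -
        have "(\<Prod>k<n. - s j + s k) = 0" using that by (intro prod_zero) auto
        then show ?thesis using s(3)[OF that] by (simp add: polyV)
      qed
    qed
    then show ?thesis by simp
  qed
  \<comment> \<open>Division of \<open>D\<close> by \<open>N\<close>: \<open>a0\<close> and
    \<open>b0\<close> match the coefficients of order n + 1 and n, and \<open>r j\<close> is the
    residue of \<open>D\<close> / \<open>N\<close> at \<open>- s j\<close>, where the derivative of
    \<open>N\<close> is \<open>C\<close> times \<open>W j\<close>.\<close>
  define a0 where "a0 = 1 / C"
  define b0 where "b0 = (coeff D n - coeff (pCons 0 (smult a0 N)) n) / C"
  define r where "r j = poly D (- s j) / poly (smult C (W j)) (- s j)" for j
  have W_sign: "0 < (-1) ^ j * poly (W j) (- s j)" if j: "j < n" for j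
  proof -
    have "{k \<in> {..<n}-{j}. - s j + s k < 0} = {..<j}"
    proof -
      have "- s j + s k < 0 \<longleftrightarrow> k < j" if "k < n" "k \<noteq> j" for k
        using s_less[of j k] s_less[of k j] that j by (cases "k < j") auto
      then show ?thesis using j by auto
    qed
    moreover have "0 < (-1) ^ card {k \<in> {..<n}-{j}. - s j + s k < 0} * (\<Prod>k\<in>{..<n}-{j}. - s j + s k)"
    proof (intro prod_sign_count)
      show "- s j + s k \<noteq> 0" if "k \<in> {..<n}-{j}" for k using s_neq[of k j] that j by auto
    qed simp
    ultimately show ?thesis by (simp add: polyW)
  qed
  have D_sign: "0 < (-1) ^ Suc j * poly D (- s j)" if j: "j < n" for j
  proof -
    have below: "b k < s j \<longleftrightarrow> k \<le> j" for k
      using s(1,2)[OF j] monoD[OF strict_mono_mono[OF b(1)], of k j] monoD[OF strict_mono_mono[OF b(1)], of "Suc j" k]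
      by (cases "k \<le> j") auto
    have neq: "b k \<noteq> s j" for k
      using s(1,2)[OF j] monoD[OF strict_mono_mono[OF b(1)], of k j] monoD[OF strict_mono_mono[OF b(1)], of "Suc j" k]
      by (cases "k \<le> j") auto
    have "{k \<in> {..n}. - s j + b k < 0} = {..j}" using below j by auto
    moreover have "0 < (-1) ^ card {k \<in> {..n}. - s j + b k < 0} * (\<Prod>k\<in>{..n}. - s j + b k)"
      using neq by (intro prod_sign_count) (auto simp: algebra_simps)
    ultimately show ?thesis by (simp add: polyD)
  qed
  \<comment> \<open>At \<open>- s j\<close> the product \<open>D\<close> has j + 1 negative factors
    and \<open>W j\<close> has j, so the quotient is negative.\<close>
  have r_neg: "r j < 0" if j: "j < n" for j
  proof -
    have "((-1) ^ j * poly D (- s j)) / ((-1) ^ j * (C * poly (W j) (- s j))) = r j"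
      by (simp add: r_def)
    moreover have "(-1) ^ j * poly D (- s j) < 0" using D_sign[OF j] by simp
    moreover have "0 < (-1) ^ j * (C * poly (W j) (- s j))"
      using mult_pos_pos[OF C W_sign[OF j]] by (simp add: mult_ac)
    ultimately show ?thesis by (metis divide_neg_pos)
  qed
  define E where "E = D - smult a0 (pCons 0 N) - smult b0 N - (\<Sum>j<n. smult (r j * C) (W j))"
  have degW: "coeff (W j) i = 0" if "j < n" "n \<le> i" for i j
    unfolding W_def by (rule coeff_eq_0) (use that in \<open>simp add: degree_prod_linear\<close>)
  have "E = 0"
  proof (rule poly_eqI_degree_roots[of n _ "\<lambda>j. - s j", OF _ s_inj])
    fix i assume i: "n \<le> i"
    have sum0: "coeff (\<Sum>j<n. smult (r j * C) (W j)) i = 0"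
      unfolding coeff_sum using i degW by (intro sum.neutral) auto
    have degD: "degree D = Suc n" unfolding D_def degree_prod_linear by simp
    have coeffD: "coeff D (Suc n) = 1"
      unfolding D_def using lead_coeff_prod_linear[of b "{..n}"] by simp
    consider "i = n" | "i = Suc n" | "Suc n < i" using i by linarith
    then show "coeff E i = 0"
    proof cases
      case 1 then show ?thesis using sum0 C by (simp add: E_def b0_def coeffN_top)
    next
      case 2 then show ?thesis using sum0 C coeffD coeffN_top coeffN by (simp add: E_def a0_def)
    next
      case 3
      moreover have "coeff D i = 0" using 3 degD by (intro coeff_eq_0) simp
      moreover obtain i' where "i = Suc i'" "n < i'" using 3 by (cases i) auto
      ultimately show ?thesis using sum0 coeffN by (simp add: E_def)
    qed
  next
    fix j assume j: "j < n"
    have zero: "poly (W l) (- s j) = 0" if "l < n" "l \<noteq> j" for l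
      unfolding polyW using that j by (intro prod_zero) auto
    have "(\<Sum>l<n. r l * C * poly (W l) (- s j)) = (\<Sum>l<n. if l = j then r j * C * poly (W j) (- s j) else 0)"
      by (intro sum.cong) (auto simp: zero)
    also have "\<dots> = r j * C * poly (W j) (- s j)" using j by simp
    also have "\<dots> = poly D (- s j)" using C W_sign[OF j] by (auto simp: r_def)
    finally show "poly E (- s j) = 0" using s(3)[OF j] by (simp add: E_def poly_sum)
  qed
  have main: "1 / (\<Sum>j\<le>n. c j / (x + b j)) = a0 * x + b0 + (\<Sum>j<n. r j / (x + s j))" if x: "0 < x" for x
  proof -
    have bx: "x + b j \<noteq> 0" for j using b_pos[of j] x by linarith
    have sx: "x + s j \<noteq> 0" if "j < n" for j using s_pos[OF that] x by linarith
    have Dx: "poly D x \<noteq> 0" unfolding polyD using bx by simp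
    have Vx: "poly V x \<noteq> 0" unfolding polyV using sx by simp
    have LD: "poly (L j) x = poly D x / (x + b j)" if "j \<le> n" for j
      unfolding polyL polyD using bx that by (subst prod.remove[of "{..n}" j]) auto
    have WV: "poly (W j) x = poly V x / (x + s j)" if "j < n" for j
      unfolding polyW polyV using sx that by (subst prod.remove[of "{..<n}" j]) auto
    have "poly N x = poly D x * (\<Sum>j\<le>n. c j / (x + b j))"
      unfolding N_def poly_sum sum_distrib_left by (intro sum.cong) (auto simp: LD)
    moreover have Nx: "poly N x = C * poly V x" using NV by simp
    ultimately have "(\<Sum>j\<le>n. c j / (x + b j)) = C * poly V x / poly D x"
      using Dx by (simp add: nonzero_eq_divide_eq mult.commute)
    then have "1 / (\<Sum>j\<le>n. c j / (x + b j)) = poly D x / (C * poly V x)" by simp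
    also have "poly D x = a0 * x * (C * poly V x) + b0 * (C * poly V x) + (\<Sum>j<n. r j * C * poly (W j) x)"
    proof -
      have "poly E x = 0" using \<open>E = 0\<close> by simp
      then show ?thesis unfolding E_def by (simp add: poly_sum Nx[symmetric] algebra_simps)
    qed
    also have "(\<Sum>j<n. r j * C * poly (W j) x) = (C * poly V x) * (\<Sum>j<n. r j / (x + s j))"
      unfolding sum_distrib_left by (intro sum.cong) (auto simp: WV)
    finally show ?thesis using C Vx by (simp add: add_divide_distrib)
  qed
  \<comment> \<open>From r / (x + s) = r / s - (r / s) * x / (x + s), negative residues become
    nonnegative weights of x / (x + s). The constants collect in \<open>b1\<close>, which is the
    limit at 0 of a positive function.\<close>
  define b1 where "b1 = b0 + (\<Sum>j<n. r j / s j)"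
  have main': "1 / (\<Sum>j\<le>n. c j / (x + b j)) = a0 * x + b1 + (\<Sum>j<n. (- r j / s j) * (x / (x + s j)))"
    if x: "0 < x" for x
  proof -
    have "r j / (x + s j) = r j / s j + (- r j / s j) * (x / (x + s j))" if "j < n" for j
    proof -
      have "s j \<noteq> 0" "x + s j \<noteq> 0" using s_pos[OF that] x by auto
      then show ?thesis by (simp add: divide_simps) (simp add: algebra_simps)
    qed
    then have "(\<Sum>j<n. r j / (x + s j)) = (\<Sum>j<n. r j / s j) + (\<Sum>j<n. (- r j / s j) * (x / (x + s j)))"
      unfolding sum.distrib[symmetric] by (intro sum.cong) auto
    then show ?thesis using main[OF x] by (simp add: b1_def)
  qed
  have "0 \<le> b1"
  proof -
    have "((\<lambda>x. a0 * x + b1 + (\<Sum>j<n. (- r j / s j) * (x / (x + s j))))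
        \<longlongrightarrow> a0 * 0 + b1 + (\<Sum>j<n. (- r j / s j) * (0 / (0 + s j)))) (at_right 0)"
      by (intro tendsto_intros) (auto dest: s_pos)
    moreover have "eventually (\<lambda>x. 0 \<le> a0 * x + b1 + (\<Sum>j<n. (- r j / s j) * (x / (x + s j)))) (at_right 0)"
    proof (rule eventually_mono[OF eventually_at_right_less])
      fix x :: real assume x: "0 < x"
      have "0 \<le> 1 / (\<Sum>j\<le>n. c j / (x + b j))"
        using x b_pos c by (intro divide_nonneg_nonneg sum_nonneg) (auto simp: less_imp_le)
      then show "0 \<le> a0 * x + b1 + (\<Sum>j<n. (- r j / s j) * (x / (x + s j)))" using main'[OF x] by simp
    qed
    ultimately show ?thesis by (intro tendsto_lowerbound[of _ b1 "at_right 0"]) auto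
  qed
  moreover have "0 \<le> a0" using C by (simp add: a0_def)
  moreover have "0 \<le> - r j / s j" if "j < n" for j
    using r_neg[OF that] s_pos[OF that] by (simp add: divide_nonpos_pos)
  ultimately show ?thesis by (intro that[of a0 b1 s "\<lambda>j. - r j / s j"] main' s_pos)
qed

text \<open>With b = (1 - y) / y one has \<open>kern x y\<close> = x * (1 / y) / (x + b), so the
  quotient is the reciprocal of a sum of simple fractions, to which
  \<open>interlacing_reciprocal\<close> applies.\<close>

lemma cbf_involution_nodes:
  fixes n :: nat
  assumes w: "\<And>j. 0 < w j"
  shows "cbf (\<lambda>x. x / (\<Sum>j\<le>n. w j * kern x (node n j)))"
proof -
  define b where "b j = (1 - node n j) / node n j" for j
  \<comment> \<open>The continuation past \<open>n\<close> provides a sequence that is strictly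
    increasing on all naturals, as \<open>interlacing_reciprocal\<close> requires.\<close>
  define b' where "b' j = (if j \<le> n then b j else b n + real (j - n))" for j
  have nd: "node n j = (Suc n - real j) / Suc n" for j by (simp add: node_def field_simps)
  have b_eq: "b j = real j / (Suc n - real j)" if "j \<le> n" for j
  proof -
    have "1 - node n j = real j / real (Suc n)" by (simp add: node_def)
    then show ?thesis unfolding b_def nd by (simp del: of_nat_Suc)
  qed
  have bSuc: "b j < b (Suc j)" if "Suc j \<le> n" for j
    using that by (subst (1 2) b_eq) (auto intro!: frac_less simp: of_nat_diff)
  have F1: "strict_mono b'"
    unfolding strict_mono_Suc_iff
  proof
    fix m consider "m < n" | "m = n" | "n < m" by linarith
    then show "b' m < b' (Suc m)"
      by cases (use bSuc[of m] in \<open>auto simp: b'_def\<close>)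
  qed
  have F2: "0 \<le> b' 0" by (simp add: b'_def b_eq)
  have F3: "0 < w j / (if j \<le> n then node n j else 1)" for j using w node_bounds by auto
  obtain \<alpha> \<beta> e s where *: "0 \<le> \<alpha>" "0 \<le> \<beta>" "\<And>j. j < n \<Longrightarrow> 0 < (s j :: real)" "\<And>j. j < n \<Longrightarrow> 0 \<le> (e j :: real)"
    "\<And>x. 0 < x \<Longrightarrow> 1 / (\<Sum>j\<le>n. (w j / (if j \<le> n then node n j else 1)) / (x + b' j))
        = \<alpha> * x + \<beta> + (\<Sum>j<n. e j * (x / (x + s j)))"
    by (rule interlacing_reciprocal[OF F1 F2 F3, of n]) (rule that)
  have "x / (\<Sum>j\<le>n. w j * kern x (node n j)) = \<alpha> * x + \<beta> + (\<Sum>j<n. e j * (x / (x + s j)))"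
    if x: "0 < x" for x
  proof -
    have "w j * kern x (node n j) = x * ((w j / (if j \<le> n then node n j else 1)) / (x + b' j))"
      if j: "j \<le> n" for j
    proof -
      have nb: "0 < node n j" "node n j \<le> 1" using node_bounds j by auto
      have "node n j * x + (1 - node n j) = node n j * (x + b j)" using nb by (simp add: b_def field_simps)
      moreover have "0 < x + b j" using x nb by (simp add: b_def add_pos_nonneg)
      ultimately show ?thesis using nb j x by (simp add: kern_def b'_def)
    qed
    then have "(\<Sum>j\<le>n. w j * kern x (node n j)) = x * (\<Sum>j\<le>n. (w j / (if j \<le> n then node n j else 1)) / (x + b' j))"
      unfolding sum_distrib_left by (intro sum.cong) auto
    then show ?thesis using *(5)[OF x] x by simp
  qed
  moreover have "cbf (\<lambda>x. \<alpha> * x + \<beta> + (\<Sum>j<n. e j * (x / (x + s j))))"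
    using * by (intro cbf_add cbf_sum cbf_scale cbf_ident cbf_const cbf_rational) auto
  ultimately show ?thesis by (simp add: cbf_congI)
qed

lemma cbf_involution:
  assumes f: "cbf f" and pos: "\<And>x. 0 < x \<Longrightarrow> 0 < f x" shows "cbf (\<lambda>x. x / f x)"
proof -
  obtain w where w: "\<And>n j. 0 < w n j"
    "\<And>x. 0 < x \<Longrightarrow> (\<lambda>n. \<Sum>j\<le>n. w n j * kern x (node n j)) \<longlonglongrightarrow> f x"
    using cbf_approx[OF f] by metis
  show ?thesis
  proof (rule cbf_lim)
    show "cbf (\<lambda>x. x / (\<Sum>j\<le>n. w n j * kern x (node n j)))" for n
      by (rule cbf_involution_nodes) (rule w)
    show "(\<lambda>n. x / (\<Sum>j\<le>n. w n j * kern x (node n j))) \<longlonglongrightarrow> x / f x" if "0 < x" for x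
      using w(2)[OF that] pos[OF that] by (intro tendsto_intros) auto
  qed
qed

section \<open>Composition, geometric means and inverse functions\<close>


text \<open>Addition conjugated by the involution: the parallel sum is x / (x / f + x / g).\<close>

lemma cbf_parallel:
  assumes f: "cbf f" "\<And>x. 0 < x \<Longrightarrow> 0 < f x" and g: "cbf g" "\<And>x. 0 < x \<Longrightarrow> 0 < g x"
  shows "cbf (\<lambda>x. f x * g x / (f x + g x))"
proof -
  have "cbf (\<lambda>x. x / (x / f x + x / g x))"
    using f g by (intro cbf_involution cbf_add) (auto intro!: add_pos_pos)
  moreover have "f x * g x / (f x + g x) = x / (x / f x + x / g x)" if "0 < x" for x
  proof -
    have "x / f x + x / g x = x * ((f x + g x) / (f x * g x))"
      using f(2)[OF that] g(2)[OF that] by (simp add: field_simps)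
    then show ?thesis using that by simp
  qed
  ultimately show ?thesis by (rule cbf_congI)
qed

text \<open>For a single kernel the composition is x / (c * x + (1 - c) * (x / g x)), built from two
  involutions and a sum. Finite mixtures and limits give general \<open>f\<close>.\<close>

lemma cbf_compose:
  assumes f: "cbf f" and g: "cbf g" "\<And>x. 0 < x \<Longrightarrow> 0 < g x"
  shows "cbf (\<lambda>x. f (g x))"
proof -
  have kern: "cbf (\<lambda>x. kern (g x) y)" for y
  proof -
    let ?c = "unit_clip y"
    have pos: "0 < ?c * x + (1 - ?c) * (x / g x)" if "0 < x" for x
      using g(2)[OF that] that by (intro convex_combination_pos) auto
    have "cbf (\<lambda>x. x / (?c * x + (1 - ?c) * (x / g x)))"
      using pos by (intro cbf_involution cbf_add cbf_scale cbf_ident g) auto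
    moreover have "kern (g x) y = x / (?c * x + (1 - ?c) * (x / g x))" if "0 < x" for x
    proof -
      have "?c * x + (1 - ?c) * (x / g x) = x / g x * (?c * g x + (1 - ?c))"
        using g(2)[OF that] by (simp add: field_simps)
      then show ?thesis using that g(2)[OF that] by (simp add: kern_def)
    qed
    ultimately show ?thesis by (rule cbf_congI)
  qed
  obtain w where w: "\<And>n j. 0 < w n j"
    "\<And>x. 0 < x \<Longrightarrow> (\<lambda>n. \<Sum>j\<le>n. w n j * kern x (node n j)) \<longlonglongrightarrow> f x"
    by (rule cbf_approx[OF f]) (rule that)
  show ?thesis
  proof (rule cbf_lim)
    show "cbf (\<lambda>x. \<Sum>j\<le>n. w n j * kern (g x) (node n j))" for n
      using w(1) by (intro cbf_sum cbf_scale kern) (auto intro: less_imp_le)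
    show "(\<lambda>n. \<Sum>j\<le>n. w n j * kern (g x) (node n j)) \<longlonglongrightarrow> f (g x)" if "0 < x" for x
      using w(2) g(2)[OF that] .
  qed
qed

section \<open>Geometric means through the arithmetic-harmonic iteration\<close>

text \<open>A step replaces the pair by its arithmetic and harmonic means. It preserves the product
  \<open>u * v\<close>, so the limit is \<open>sqrt (u * v)\<close>, and both means are available
  within \<open>cbf\<close>.\<close>

primrec am_hm :: "nat \<Rightarrow> real \<Rightarrow> real \<Rightarrow> real" where
  "am_hm 0 u v = u"
| "am_hm (Suc n) u v = am_hm n ((u + v) / 2) (2 * (u * v / (u + v)))"

text \<open>Error formula of the Babylonian square root: the new error is the old one squared over
  2u. It shows that the arithmetic mean lies above the square root and that, from then on, the error
  at least halves.\<close>

lemma am_sqrt_diff: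
  assumes "0 < u" "0 < (v::real)"
  shows "(u + v) / 2 - sqrt (u * v) = (u - sqrt (u * v))\<^sup>2 / (2 * u)"
proof -
  have "(sqrt (u * v))\<^sup>2 = u * v" using assms by simp
  then show ?thesis using assms by (simp add: power2_diff field_simps) (simp add: power2_eq_square)
qed

lemma am_hm_bounds:
  assumes "0 < u" "0 < v" "sqrt (u * v) \<le> u"
  shows "\<bar>am_hm n u v - sqrt (u * v)\<bar> \<le> (u - sqrt (u * v)) / 2 ^ n"
  using assms
proof (induction n arbitrary: u v)
  case (Suc n)
  let ?s = "sqrt (u * v)" and ?u = "(u + v) / 2" and ?v = "2 * (u * v / (u + v))"
  have uv: "?u * ?v = u * v" using Suc.prems by (simp add: field_simps)
  have d: "?u - ?s = (u - ?s)\<^sup>2 / (2 * u)" using am_sqrt_diff Suc.prems by simp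
  have "0 \<le> (u - ?s)\<^sup>2 / (2 * u)" using Suc.prems by simp
  then have le: "?s \<le> ?u" using d by linarith
  have "(u - ?s)\<^sup>2 \<le> (u - ?s) * u" unfolding power2_eq_square
    using Suc.prems by (intro mult_left_mono) auto
  then have "(u - ?s)\<^sup>2 / (2 * u) \<le> (u - ?s) / 2"
    using Suc.prems by (simp add: field_simps)
  then have half: "?u - ?s \<le> (u - ?s) / 2" using d by simp
  have "\<bar>am_hm n ?u ?v - sqrt (?u * ?v)\<bar> \<le> (?u - sqrt (?u * ?v)) / 2 ^ n"
    using Suc.prems le unfolding uv by (intro Suc.IH[of ?u ?v, unfolded uv]) auto
  also have "\<dots> \<le> (u - ?s) / 2 / 2 ^ n"
    unfolding uv using half by (rule divide_right_mono) simp
  finally show ?case unfolding uv by simp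
qed simp

lemma am_hm_tendsto:
  assumes "0 < u" "0 < v" shows "(\<lambda>n. am_hm n u v) \<longlonglongrightarrow> sqrt (u * v)"
proof -
  let ?s = "sqrt (u * v)" and ?u = "(u + v) / 2" and ?v = "2 * (u * v / (u + v))"
  have uv: "?u * ?v = u * v" using assms by (simp add: field_simps)
  have "0 \<le> (u - ?s)\<^sup>2 / (2 * u)" using assms by simp
  then have le: "?s \<le> ?u" using am_sqrt_diff[OF assms] by linarith
  \<comment> \<open>The first step is split off because \<open>am_hm_bounds\<close> needs the square
    root to lie below the first argument, which holds only after one averaging.\<close>
  have "(\<lambda>n. am_hm (Suc n) u v - ?s) \<longlonglongrightarrow> 0"
  proof (rule Lim_null_comparison[OF always_eventually])
    show "\<forall>n. norm (am_hm (Suc n) u v - ?s) \<le> (?u - ?s) * (1 / 2) ^ n"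
      using am_hm_bounds[of ?u ?v, unfolded uv] assms le by (simp add: power_divide)
    show "(\<lambda>n. (?u - ?s) * (1 / 2) ^ n) \<longlonglongrightarrow> 0"
      by (intro tendsto_mult_right_zero LIMSEQ_realpow_zero) auto
  qed
  then have "(\<lambda>n. am_hm (Suc n) u v) \<longlonglongrightarrow> ?s" by (simp only: LIM_zero_iff)
  then show ?thesis by (rule LIMSEQ_imp_Suc)
qed

lemma cbf_sqrt_mult:
  assumes f: "cbf f" "\<And>x. 0 < x \<Longrightarrow> 0 < f x" and g: "cbf g" "\<And>x. 0 < x \<Longrightarrow> 0 < g x"
  shows "cbf (\<lambda>x. sqrt (f x * g x))"
proof (rule cbf_lim)
  show "cbf (\<lambda>x. am_hm n (f x) (g x))" for n
    using f g
  proof (induction n arbitrary: f g)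
    case (Suc n)
    let ?a = "\<lambda>x. 1 / 2 * (f x + g x)" and ?b = "\<lambda>x. 2 * (f x * g x / (f x + g x))"
    have a: "cbf ?a" by (intro cbf_scale cbf_add Suc.prems) simp
    have b: "cbf ?b" using cbf_scale[OF cbf_parallel[OF Suc.prems], of 2] by simp
    have a_pos: "0 < ?a x" and b_pos: "0 < ?b x" if "0 < x" for x
      using Suc.prems(2,4)[OF that] by (auto intro: add_pos_pos)
    have "cbf (\<lambda>x. am_hm n (?a x) (?b x))" by (rule Suc.IH[OF a a_pos b b_pos])
    then show ?case by simp
  qed simp
  show "(\<lambda>n. am_hm n (f x) (g x)) \<longlonglongrightarrow> sqrt (f x * g x)" if "0 < x" for x
    using am_hm_tendsto f(2)[OF that] g(2)[OF that] .
qed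

text \<open>Bisection: at level k + 1 an even numerator reduces to level k, and an odd one 2l + 1 is
  the geometric mean of the cases l and l + 1 of level k.\<close>

lemma cbf_dyadic_geometric_mean:
  assumes f: "cbf f" "\<And>x. 0 < x \<Longrightarrow> 0 < f x" and g: "cbf g" "\<And>x. 0 < x \<Longrightarrow> 0 < g x"
    and "m \<le> 2 ^ k"
  shows "cbf (\<lambda>x. f x powr (real m / 2 ^ k) * g x powr (1 - real m / 2 ^ k))"
  using \<open>m \<le> 2 ^ k\<close>
proof (induction k arbitrary: m)
  case 0
  then consider "m = 0" | "m = 1" by fastforce
  then show ?case
  proof cases
    case 1
    then have "f x powr (real m / 2 ^ 0) * g x powr (1 - real m / 2 ^ 0) = g x" if "0 < x" for x
      using f(2)[OF that] g(2)[OF that] by simp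
    then show ?thesis by (rule cbf_congI[OF g(1)])
  next
    case 2
    then have "f x powr (real m / 2 ^ 0) * g x powr (1 - real m / 2 ^ 0) = f x" if "0 < x" for x
      using f(2)[OF that] g(2)[OF that] by simp
    then show ?thesis by (rule cbf_congI[OF f(1)])
  qed
next
  case (Suc k)
  show ?case
  proof (cases "even m")
    case True
    then obtain l where l: "m = 2 * l" by blast
    then show ?thesis using Suc.IH[of l] Suc.prems by simp
  next
    case False
    then obtain l where l: "m = 2 * l + 1" by (blast elim: oddE)
    have le: "Suc l \<le> 2 ^ k" using Suc.prems l by simp
    let ?F = "\<lambda>j x. f x powr (real j / 2 ^ k) * g x powr (1 - real j / 2 ^ k)"
    have F_pos: "0 < ?F j x" if "0 < x" for j x
      using f(2)[OF that] g(2)[OF that] by simp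
    have "cbf (?F l)" "cbf (?F (Suc l))" using Suc.IH[of l] Suc.IH[OF le] le by simp_all
    then have "cbf (\<lambda>x. sqrt (?F l x * ?F (Suc l) x))"
      by (intro cbf_sqrt_mult F_pos)
    moreover have "f x powr (real m / 2 ^ Suc k) * g x powr (1 - real m / 2 ^ Suc k) = sqrt (?F l x * ?F (Suc l) x)"
      if "0 < x" for x
    proof -
      have fp: "0 < f x" and gp: "0 < g x" using f(2)[OF that] g(2)[OF that] .
      have "?F l x * ?F (Suc l) x = f x powr (real m / 2 ^ k) * g x powr (2 - real m / 2 ^ k)"
      proof -
        have "real l / 2 ^ k + real (Suc l) / 2 ^ k = real m / 2 ^ k"
          by (simp add: l add_divide_distrib[symmetric])
        moreover have "?F l x * ?F (Suc l) x = f x powr (real l / 2 ^ k + real (Suc l) / 2 ^ k)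
             * g x powr (2 - (real l / 2 ^ k + real (Suc l) / 2 ^ k))"
        proof -
          have "2 - (a + b) = (1 - a) + (1 - b)" for a b :: real by simp
          then show ?thesis by (simp only: powr_add mult_ac)
        qed
        ultimately show ?thesis by simp
      qed
      also have "\<dots> = (f x powr (real m / 2 ^ Suc k) * g x powr (1 - real m / 2 ^ Suc k))\<^sup>2"
      proof -
        define a where "a = real m / 2 ^ Suc k"
        have "real m / 2 ^ k = a + a" "2 - (a + a) = (1 - a) + (1 - a)" by (simp_all add: a_def)
        then show ?thesis unfolding a_def[symmetric] by (simp only: powr_add power2_eq_square mult_ac)
      qed
      finally show ?thesis using fp gp by (simp add: real_sqrt_unique)
    qed
    ultimately show ?thesis by (rule cbf_congI)
  qed
qed

lemma cbf_geometric_mean: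
  assumes f: "cbf f" "\<And>x. 0 < x \<Longrightarrow> 0 < f x" and g: "cbf g" "\<And>x. 0 < x \<Longrightarrow> 0 < g x"
    and \<alpha>: "0 \<le> \<alpha>" "\<alpha> \<le> 1"
  shows "cbf (\<lambda>x. f x powr \<alpha> * g x powr (1 - \<alpha>))"
proof -
  define m where "m k = nat \<lfloor>\<alpha> * 2 ^ k\<rfloor>" for k
  have m_le: "m k \<le> 2 ^ k" for k
  proof -
    have "\<alpha> * 2 ^ k \<le> 2 ^ k" using \<alpha> by simp
    then have "\<lfloor>\<alpha> * 2 ^ k\<rfloor> \<le> 2 ^ k" by (metis floor_mono floor_of_int of_int_numeral of_int_power)
    then show ?thesis by (simp add: m_def nat_le_iff)
  qed
  have lim: "(\<lambda>k. real (m k) / 2 ^ k) \<longlonglongrightarrow> \<alpha>"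
  proof -
    have bound: "norm (real (m k) / 2 ^ k - \<alpha>) \<le> (1 / 2) ^ k" for k
    proof -
      have "\<bar>real (m k) - \<alpha> * 2 ^ k\<bar> \<le> 1"
        using \<alpha> by (simp add: m_def) linarith
      then have "\<bar>real (m k) - \<alpha> * 2 ^ k\<bar> / 2 ^ k \<le> 1 / 2 ^ k" by (rule divide_right_mono) simp
      moreover have "real (m k) / 2 ^ k - \<alpha> = (real (m k) - \<alpha> * 2 ^ k) / 2 ^ k"
        by (simp add: diff_divide_distrib)
      ultimately show ?thesis by (simp add: power_divide abs_divide)
    qed
    have "(\<lambda>k. real (m k) / 2 ^ k - \<alpha>) \<longlonglongrightarrow> 0"
      by (rule Lim_null_comparison[OF always_eventually LIMSEQ_realpow_zero[of "1/2"]]) (use bound in auto)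
    then show ?thesis by (simp only: LIM_zero_iff)
  qed
  show ?thesis
  proof (rule cbf_lim)
    show "cbf (\<lambda>x. f x powr (real (m k) / 2 ^ k) * g x powr (1 - real (m k) / 2 ^ k))" for k
      by (intro cbf_dyadic_geometric_mean f g m_le)
    show "(\<lambda>k. f x powr (real (m k) / 2 ^ k) * g x powr (1 - real (m k) / 2 ^ k))
        \<longlonglongrightarrow> f x powr \<alpha> * g x powr (1 - \<alpha>)" if "0 < x" for x
      using f(2)[OF that] g(2)[OF that] by (intro tendsto_intros lim) auto
  qed
qed

section \<open>Inverting r^n * h r\<close>

lemma cbf_ln_lipschitz:
  assumes f: "cbf f" "\<And>x. 0 < x \<Longrightarrow> 0 < f x" and ab: "0 < a" "0 < b"
  shows "\<bar>ln (f a) - ln (f b)\<bar> \<le> \<bar>ln a - ln b\<bar>"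
proof -
  have *: "\<bar>ln (f a) - ln (f b)\<bar> \<le> \<bar>ln a - ln b\<bar>" if "0 < a" "a \<le> b" for a b
  proof -
    have fa: "0 < f a" and fb: "0 < f b" using f(2) that by auto
    have "f a \<le> f b" "f b \<le> b / a * f a"
      using cbf_mono[OF f(1)] cbf_ratio_antimono[OF f(1)] that by auto
    then have "ln (f a) \<le> ln (f b)" "ln (f b) \<le> ln (b / a * f a)"
      using fa fb that by (auto intro!: ln_mono)
    moreover have "ln (b / a * f a) = ln b - ln a + ln (f a)"
      using fa that by (simp add: ln_mult ln_div)
    moreover have "ln a \<le> ln b" using that by simp
    ultimately show ?thesis by linarith
  qed
  show ?thesis
  proof (cases "a \<le> b")
    case True then show ?thesis using * ab by blast
  next
    case False then show ?thesis using *[of b a] ab by (simp add: abs_minus_commute)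
  qed
qed

lemma power_mult_cbf_strict_mono:
  assumes h: "cbf h" "\<And>x. 0 < x \<Longrightarrow> 0 < h x" and n: "0 < n" and ab: "0 < a" "a < b"
  shows "a ^ n * h a < b ^ n * h b"
proof -
  have "a ^ n * h a < b ^ n * h a"
    using ab n h(2) by (intro mult_strict_right_mono power_strict_mono) auto
  also have "\<dots> \<le> b ^ n * h b"
    using ab by (intro mult_left_mono cbf_mono[OF h(1)]) auto
  finally show ?thesis .
qed

lemma power_mult_cbf_surj:
  assumes h: "cbf h" "\<And>x. 0 < x \<Longrightarrow> 0 < h x" and n: "0 < n" and x: "0 < x"
  obtains r where "0 < r" "r ^ n * h r = x"
proof -
  \<comment> \<open>Chosen so that lo * h 1 \<le> x \<le> hi * h 1. Since \<open>lo\<close> \<le> 1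
    \<le> \<open>hi\<close> and \<open>h\<close> is monotone, the values at \<open>lo\<close> and
    \<open>hi\<close> bracket x.\<close>
  define lo hi where "lo = min 1 (x / h 1)" and "hi = max 1 (x / h 1)"
  have h1: "0 < h 1" using h(2) by simp
  have lo: "0 < lo" "lo \<le> 1" "lo * h 1 \<le> x" and hi: "1 \<le> hi" "x \<le> hi * h 1"
    using x h1 by (auto simp: lo_def hi_def min_def max_def field_simps)
  have "lo ^ n * h lo \<le> lo * h 1"
    using lo n h(2) power_decreasing[of 1 n lo] cbf_mono[OF h(1) lo(1,2)]
    by (intro mult_mono) (auto simp: less_imp_le)
  moreover have "hi * h 1 \<le> hi ^ n * h hi"
    using hi n h1 power_increasing[of 1 n hi] cbf_mono[OF h(1), of 1 hi]
    by (intro mult_mono) (auto simp: less_imp_le)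
  ultimately have "\<exists>r\<ge>lo. r \<le> hi \<and> r ^ n * h r = x"
    using lo hi by (intro IVT) (auto intro!: continuous_intros cbf_isCont[OF h(1)])
  then show ?thesis using that lo(1) less_le_trans by blast
qed

text \<open>The inverse function solves \<open>p ^ (n + 1) = x * (p / h p)\<close>, and the corresponding iteration
  contracts \<open>ln p\<close> by the factor \<open>1 / (n + 1)\<close> while staying within \<open>cbf\<close>.\<close>

lemma cbf_power_mult_inverse:
  assumes h: "cbf h" "\<And>x. 0 < x \<Longrightarrow> 0 < h x" and n: "0 < n"
    and P: "\<And>x. 0 < x \<Longrightarrow> 0 < P x" "\<And>x. 0 < x \<Longrightarrow> P x ^ n * h (P x) = x"
  shows "cbf P"
proof -
  define q where "q x = x / h x" for x
  have q: "cbf q" "\<And>x. 0 < x \<Longrightarrow> 0 < q x"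
    using cbf_involution[OF h] h(2) by (auto simp: q_def[abs_def])
  define p where "p = rec_nat (\<lambda>x. x) (\<lambda>_ p x. (x * q (p x)) powr (1 / (n + 1)))"
  have p_0: "p 0 = (\<lambda>x. x)" and p_Suc: "p (Suc k) = (\<lambda>x. (x * q (p k x)) powr (1 / (n + 1)))" for k
    by (simp_all add: p_def)
  have p: "cbf (p k) \<and> (\<forall>x>0. 0 < p k x)" for k
  proof (induction k)
    case 0 then show ?case by (simp add: p_0 cbf_ident)
  next
    case (Suc k)
    have qp: "cbf (\<lambda>x. q (p k x))" "\<And>x. 0 < x \<Longrightarrow> 0 < q (p k x)"
      using Suc q by (auto intro: cbf_compose)
    \<comment> \<open>Both factors of x * q (p k x) are in the class, but their product need not be.
      The power 1 / (n + 1) is reached as the exponent 2 / (n + 1) of the geometric mean, weighted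
      against the constant 1; n \<ge> 1 makes that exponent at most 1.\<close>
    have "cbf (\<lambda>x. sqrt (x * q (p k x)) powr (2 / (n + 1)) * 1 powr (1 - 2 / (n + 1)))"
      using qp n by (intro cbf_geometric_mean cbf_sqrt_mult cbf_ident cbf_const) auto
    moreover have "p (Suc k) x = sqrt (x * q (p k x)) powr (2 / (n + 1)) * 1 powr (1 - 2 / (n + 1))"
      if "0 < x" for x
      using qp(2)[OF that] that by (simp add: p_Suc powr_half_sqrt[symmetric] powr_powr)
    ultimately have "cbf (p (Suc k))" by (rule cbf_congI)
    moreover have "0 < p (Suc k) x" if "0 < x" for x
      using qp(2)[OF that] that by (simp add: p_Suc)
    ultimately show ?case by blast
  qed
  show ?thesis
  proof (rule cbf_lim[of p])
    fix x :: real assume x: "0 < x"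
    have pk: "0 < p k x" for k using p x by blast
    have Px: "0 < P x" by (rule P(1)[OF x])
    have fix_eq: "ln (P x) = ln (x * q (P x)) / (n + 1)"
    proof -
      have "x * q (P x) = P x ^ (n + 1)"
        using P(2)[OF x] h(2)[OF Px] by (simp add: q_def field_simps)
      moreover have "ln (P x ^ (n + 1)) = real (n + 1) * ln (P x)" by (rule ln_realpow)
      ultimately show ?thesis by (simp del: power_Suc of_nat_Suc)
    qed
    have step: "\<bar>ln (p (Suc k) x) - ln (P x)\<bar> \<le> \<bar>ln (p k x) - ln (P x)\<bar> / 2" for k
    proof -
      have "ln (p (Suc k) x) = ln (x * q (p k x)) / (n + 1)"
        using pk[of k] x q(2) by (simp add: p_Suc ln_powr)
      then have "ln (p (Suc k) x) - ln (P x) = (ln (q (p k x)) - ln (q (P x))) / (n + 1)"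
        using fix_eq x q(2)[OF pk] q(2)[OF Px] by (simp add: ln_mult_pos diff_divide_distrib add_divide_distrib)
      then have "\<bar>ln (p (Suc k) x) - ln (P x)\<bar> = \<bar>ln (q (p k x)) - ln (q (P x))\<bar> / (n + 1)"
        by (simp add: abs_divide)
      also have "\<dots> \<le> \<bar>ln (p k x) - ln (P x)\<bar> / 2"
        using cbf_ln_lipschitz[OF q pk Px] n by (intro frac_le) auto
      finally show ?thesis .
    qed
    have bound: "\<bar>ln (p k x) - ln (P x)\<bar> \<le> \<bar>ln (p 0 x) - ln (P x)\<bar> * (1 / 2) ^ k" for k
    proof (induction k)
      case (Suc k) then show ?case using step[of k] by simp
    qed simp
    have "(\<lambda>k. ln (p k x) - ln (P x)) \<longlonglongrightarrow> 0"
    proof (rule Lim_null_comparison[OF always_eventually])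
      show "\<forall>k. norm (ln (p k x) - ln (P x)) \<le> \<bar>ln (p 0 x) - ln (P x)\<bar> * (1 / 2) ^ k"
        using bound by simp
      show "(\<lambda>k. \<bar>ln (p 0 x) - ln (P x)\<bar> * (1 / 2) ^ k) \<longlonglongrightarrow> 0"
        by (intro tendsto_mult_right_zero LIMSEQ_realpow_zero) auto
    qed
    then have "(\<lambda>k. exp (ln (p k x))) \<longlonglongrightarrow> exp (ln (P x))"
      by (intro tendsto_exp) (simp only: LIM_zero_iff)
    then show "(\<lambda>k. p k x) \<longlonglongrightarrow> P x" using pk Px by simp
  qed (use p in blast)
qed

text \<open>\<open>H\<close> is \<open>h\<close> composed with the inverse \<open>P\<close> of r^n *
  h r. It will be the \<open>neg_eta\<close> of the n-th free power, hence the limit 0 at 0 is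
  carried along; it follows from monotonicity of \<open>P\<close> and \<open>h\<close>.\<close>

lemma cbf_power_subordinate:
  assumes h: "cbf h" "\<And>x. 0 < x \<Longrightarrow> 0 < h x" "(h \<longlongrightarrow> 0) (at_right 0)" and n: "0 < n"
  obtains H where "cbf H" "\<And>x. 0 < x \<Longrightarrow> 0 < H x" "(H \<longlongrightarrow> 0) (at_right 0)"
    "\<And>r. 0 < r \<Longrightarrow> H (r ^ n * h r) = h r"
proof -
  have "\<exists>r>0. r ^ n * h r = x" if "0 < x" for x
    using power_mult_cbf_surj[OF h(1,2) n that] by metis
  then obtain P where P: "\<And>x. 0 < x \<Longrightarrow> 0 < P x" "\<And>x. 0 < x \<Longrightarrow> P x ^ n * h (P x) = x" by metis
  have cP: "cbf P" using cbf_power_mult_inverse[OF h(1,2) n P] .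
  have P_eq: "P (r ^ n * h r) = r" if r: "0 < r" for r
  proof -
    let ?x = "r ^ n * h r"
    have x: "0 < ?x" using r h(2) by simp
    then have "P ?x ^ n * h (P ?x) = r ^ n * h r" "0 < P ?x" using P by auto
    then show ?thesis
      using power_mult_cbf_strict_mono[OF h(1,2) n r, of "P ?x"] power_mult_cbf_strict_mono[OF h(1,2) n, of "P ?x" r]
      by (cases "P ?x" r rule: linorder_cases) auto
  qed
  have "((\<lambda>x. h (P x)) \<longlongrightarrow> 0) (at_right 0)"
  proof (rule order_tendstoI)
    fix e :: real assume "e < 0"
    then show "eventually (\<lambda>x. e < h (P x)) (at_right 0)"
      using h(2) P(1) by (intro eventually_mono[OF eventually_at_right_less]) (auto intro: less_trans)
  next
    fix e :: real assume "0 < e"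
    then have "eventually (\<lambda>r. h r < e) (at_right 0)" using order_tendstoD(2)[OF h(3)] by blast
    then obtain d where d: "0 < d" "\<And>r. 0 < r \<Longrightarrow> r < d \<Longrightarrow> h r < e"
      unfolding eventually_at_right_field by auto
    let ?r = "d / 2"
    have r: "0 < ?r" "h ?r < e" using d by auto
    have "h (P x) < e" if x: "0 < x" "x < ?r ^ n * h ?r" for x
    proof -
      have "P x \<le> ?r"
        using cbf_mono[OF cP x(1), of "?r ^ n * h ?r"] x P_eq[OF r(1)] by simp
      then show ?thesis using cbf_mono[OF h(1) P(1)[OF x(1)]] r(2) by fastforce
    qed
    then show "eventually (\<lambda>x. h (P x) < e) (at_right 0)"
      unfolding eventually_at_right_field using r(1) h(2) by (intro exI[of _ "?r ^ n * h ?r"]) auto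
  qed
  moreover have "cbf (\<lambda>x. h (P x))" using h(1) cP P(1) by (rule cbf_compose)
  moreover have "0 < h (P x)" if "0 < x" for x using h(2) P(1) that by blast
  ultimately show ?thesis using that[of "\<lambda>x. h (P x)"] P_eq by simp
qed

section \<open>Probability measures as complete Bernstein functions\<close>


definition stieltjes :: "real measure \<Rightarrow> real \<Rightarrow> real" where
  "stieltjes M r = (LINT u|M. 1 / (1 + r * u))"

text \<open>Defined through \<open>stieltjes\<close> so that \<open>stieltjes_eq_neg_eta\<close>
  holds for all arguments; the link with \<open>eta\<close> is
  \<open>eta_eq_neg_eta\<close>.\<close>

definition neg_eta :: "real measure \<Rightarrow> real \<Rightarrow> real" where
  "neg_eta M r = 1 / stieltjes M r - 1"

lemma prob_nonnegD:
  assumes "M \<in> prob_nonneg"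
  shows "prob_space M" "sets M = sets borel" "space M = UNIV" "AE u in M. 0 \<le> u" "real_distribution M"
proof -
  show 1: "prob_space M" "sets M = sets borel" "AE u in M. 0 \<le> u"
    using assms by (auto simp: prob_nonneg_def)
  show "space M = UNIV" using sets_eq_imp_space_eq[OF 1(2)] by simp
  show "real_distribution M" using 1 by (simp add: real_distribution_def real_distribution_axioms_def)
qed

lemma prob_nonneg_integral_cong:
  assumes M: "M \<in> prob_nonneg" and f: "f \<in> borel_measurable borel" "g \<in> borel_measurable borel"
    and eq: "\<And>u. 0 \<le> u \<Longrightarrow> f u = (g u :: real)"
  shows "(LINT u|M. f u) = (LINT u|M. g u)"
proof (rule integral_cong_AE)
  show "AE u in M. f u = g u" using prob_nonnegD(4)[OF M] by eventually_elim (rule eq)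
qed (use f prob_nonnegD(2)[OF M] in \<open>auto cong: measurable_cong_sets\<close>)

lemma stieltjes_integrand:
  assumes "0 \<le> r" "0 \<le> (u::real)"
  shows "0 < 1 / (1 + r * u)" "1 / (1 + r * u) \<le> 1"
proof -
  have "1 \<le> 1 + r * u" using assms by simp
  then show "0 < 1 / (1 + r * u)" "1 / (1 + r * u) \<le> 1" by auto
qed

lemma integrable_stieltjes:
  assumes M: "M \<in> prob_nonneg" and r: "0 \<le> r"
  shows "integrable M (\<lambda>u. 1 / (1 + r * u))"
proof -
  interpret prob_space M using prob_nonnegD[OF M] by simp
  show ?thesis
  proof (rule integrable_const_bound[where B=1])
    show "AE u in M. norm (1 / (1 + r * u)) \<le> 1"
      using prob_nonnegD(4)[OF M]
    proof eventually_elim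
      case (elim u) then show ?case using stieltjes_integrand[OF r, of u] by simp
    qed
  qed (use prob_nonnegD(2)[OF M] in \<open>simp cong: measurable_cong_sets\<close>)
qed

lemma stieltjes_pos: "M \<in> prob_nonneg \<Longrightarrow> 0 \<le> r \<Longrightarrow> 0 < stieltjes M r"
  unfolding stieltjes_def
proof (rule prob_space.expectation_greater)
  assume M: "M \<in> prob_nonneg" and r: "0 \<le> r"
  show "prob_space M" "integrable M (\<lambda>u. 1 / (1 + r * u))"
    using prob_nonnegD[OF M] integrable_stieltjes[OF M r] by auto
  show "AE u in M. 0 < 1 / (1 + r * u)"
    using prob_nonnegD(4)[OF M] by eventually_elim (use stieltjes_integrand[OF r] in blast)
qed

lemma stieltjes_le_one: "M \<in> prob_nonneg \<Longrightarrow> 0 \<le> r \<Longrightarrow> stieltjes M r \<le> 1"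
  unfolding stieltjes_def
proof (rule prob_space.integral_le_const)
  assume M: "M \<in> prob_nonneg" and r: "0 \<le> r"
  show "prob_space M" "integrable M (\<lambda>u. 1 / (1 + r * u))"
    using prob_nonnegD[OF M] integrable_stieltjes[OF M r] by auto
  show "AE u in M. 1 / (1 + r * u) \<le> 1"
    using prob_nonnegD(4)[OF M] by eventually_elim (use stieltjes_integrand[OF r] in blast)
qed

lemma neg_eta_nonneg: "M \<in> prob_nonneg \<Longrightarrow> 0 \<le> r \<Longrightarrow> 0 \<le> neg_eta M r"
  using stieltjes_pos[of M r] stieltjes_le_one[of M r] by (simp add: neg_eta_def)

lemma stieltjes_eq_neg_eta: "stieltjes M r = 1 / (1 + neg_eta M r)"
  by (simp add: neg_eta_def)

lemma psi_eq_stieltjes: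
  assumes M: "M \<in> prob_nonneg" and r: "0 \<le> r" shows "psi M (- r) = stieltjes M r - 1"
proof -
  interpret prob_space M using prob_nonnegD[OF M] by simp
  have "psi M (- r) = (LINT u|M. 1 / (1 + r * u) - 1)"
    unfolding psi_def
  proof (rule prob_nonneg_integral_cong[OF M])
    fix u :: real assume u: "0 \<le> u"
    have "1 + r * u \<noteq> 0" using r u by (metis add_pos_nonneg less_irrefl mult_nonneg_nonneg zero_less_one)
    then show "- r * u / (1 - - r * u) = 1 / (1 + r * u) - 1" by (simp add: field_simps)
  qed measurable
  also have "\<dots> = stieltjes M r - 1"
    unfolding stieltjes_def using integrable_stieltjes[OF M r]
    by (subst Bochner_Integration.integral_diff) (auto simp: prob_space)
  finally show ?thesis .
qed

lemma eta_eq_neg_eta: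
  assumes M: "M \<in> prob_nonneg" and r: "0 \<le> r" shows "eta M (- r) = - neg_eta M r"
  using stieltjes_pos[OF M r] unfolding eta_def psi_eq_stieltjes[OF M r] neg_eta_def
  by (simp add: field_simps)

text \<open>For u \<ge> 0, r / (1 + r u) is 1 / (1 + u) times \<open>kern r (u / (1 + u))\<close>.
  The maximum with 0 bounds the weight at every point, and not merely almost everywhere.\<close>

lemma cbf_stieltjes:
  assumes M: "M \<in> prob_nonneg" shows "cbf (\<lambda>r. r * stieltjes M r)"
proof (rule cbf_weighted_integral)
  let ?p = "max (0::real)"
  show "prob_space M" using prob_nonnegD[OF M] by simp
  show "(\<lambda>u. ?p u / (1 + ?p u)) \<in> borel_measurable M" "(\<lambda>u. 1 / (1 + ?p u)) \<in> borel_measurable M"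
    using prob_nonnegD(2)[OF M] by (simp_all cong: measurable_cong_sets)
  show "0 \<le> 1 / (1 + ?p u)" "1 / (1 + ?p u) \<le> 1" for u by auto
  fix r :: real assume r: "0 < r"
  have "r * stieltjes M r = (LINT u|M. r * (1 / (1 + r * u)))"
    unfolding stieltjes_def by (rule integral_mult_right_zero[symmetric])
  also have "\<dots> = (LINT u|M. 1 / (1 + ?p u) * kern r (?p u / (1 + ?p u)))"
  proof (rule prob_nonneg_integral_cong[OF M])
    fix u :: real assume u: "0 \<le> u"
    have "u / (1 + u) * r + (1 - u / (1 + u)) = (1 + r * u) / (1 + u)"
      using u by (simp add: divide_simps; simp add: algebra_simps)
    moreover have "unit_clip (u / (1 + u)) = u / (1 + u)" using u by (intro unit_clip_id) auto
    ultimately show "r * (1 / (1 + r * u)) = 1 / (1 + ?p u) * kern r (?p u / (1 + ?p u))"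
      using u by (simp add: kern_def max_def)
  qed measurable
  finally show "r * stieltjes M r = (LINT u|M. 1 / (1 + ?p u) * kern r (?p u / (1 + ?p u)))" .
qed

lemma stieltjes_tendsto_zero:
  assumes M: "M \<in> prob_nonneg" shows "(stieltjes M \<longlongrightarrow> 1) (at_right 0)"
proof -
  interpret prob_space M using prob_nonnegD[OF M] by simp
  \<comment> \<open>Dominated convergence is used along t to infinity with r = 1 / t;
    \<open>max 0 t\<close> makes the bound by 1 valid for every t.\<close>
  have "((\<lambda>t. LINT u|M. 1 / (1 + inverse (max 0 t) * u)) \<longlongrightarrow> (LINT u|M. 1)) at_top"
  proof (rule integral_dominated_convergence_at_top[where w="\<lambda>_. 1"])
    have "((\<lambda>t::real. 1 / (1 + inverse (max 0 t) * u)) \<longlongrightarrow> 1) at_top" for u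
    proof -
      have "((\<lambda>t::real. 1 / (1 + inverse t * u)) \<longlongrightarrow> 1 / (1 + 0 * u)) at_top"
        by (intro tendsto_intros tendsto_inverse_0_at_top filterlim_ident) auto
      moreover have "eventually (\<lambda>t::real. 1 / (1 + inverse t * u) = 1 / (1 + inverse (max 0 t) * u)) at_top"
        using eventually_ge_at_top[of 0] by eventually_elim (simp add: max_def)
      ultimately show ?thesis by (simp add: filterlim_cong[OF refl refl])
    qed
    then show "AE u in M. ((\<lambda>t::real. 1 / (1 + inverse (max 0 t) * u)) \<longlongrightarrow> 1) at_top" by simp
    show "\<forall>\<^sub>F t in at_top. AE u in M. norm (1 / (1 + inverse (max 0 t) * u)) \<le> 1"
    proof (rule always_eventually, rule allI)
      fix t :: real
      have t: "0 \<le> inverse (max 0 t)" by simp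
      show "AE u in M. norm (1 / (1 + inverse (max 0 t) * u)) \<le> 1"
        using prob_nonnegD(4)[OF M]
      proof eventually_elim
        case (elim u) then show ?case using stieltjes_integrand[OF t, of u] by simp
      qed
    qed
  qed (use prob_nonnegD(2)[OF M] in \<open>simp_all cong: measurable_cong_sets\<close>)
  then have "((\<lambda>t. stieltjes M (inverse (max 0 t))) \<longlongrightarrow> 1) at_top"
    by (simp add: stieltjes_def prob_space)
  moreover have "eventually (\<lambda>t. stieltjes M (inverse (max 0 t)) = stieltjes M (inverse t)) at_top"
    using eventually_ge_at_top[of 0] by eventually_elim (simp add: max_def)
  ultimately have "((\<lambda>t. stieltjes M (inverse t)) \<longlongrightarrow> 1) at_top"
    by (rule Lim_transform_eventually)
  then show ?thesis unfolding filterlim_at_right_to_top .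
qed

text \<open>The integrand 1 / (1 + t u) decreases to the indicator of 0, so the limit at infinity
  sees the atom there. This governs both the domain of the S-transform and the value of distribution
  functions at 0.\<close>

lemma stieltjes_tendsto_top:
  assumes M: "M \<in> prob_nonneg" shows "(stieltjes M \<longlongrightarrow> measure M {0}) at_top"
proof -
  interpret prob_space M using prob_nonnegD[OF M] by simp
  have "((\<lambda>t. LINT u|M. 1 / (1 + max 0 t * u)) \<longlongrightarrow> (LINT u|M. indicator {0} u)) at_top"
  proof (rule integral_dominated_convergence_at_top[where w="\<lambda>_. 1"])
    have lim: "((\<lambda>t::real. 1 / (1 + max 0 t * u)) \<longlongrightarrow> indicator {0} u) at_top" if u: "0 \<le> u" for u :: real
    proof (cases "u = 0")
      case False
      have "filterlim (\<lambda>t::real. u * t) at_top at_top"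
        using u False by (intro filterlim_tendsto_pos_mult_at_top[OF tendsto_const _ filterlim_ident]) auto
      then have "filterlim (\<lambda>t::real. 1 + u * t) at_top at_top"
        by (rule filterlim_tendsto_add_at_top[OF tendsto_const])
      then have "((\<lambda>t::real. 1 / (1 + u * t)) \<longlongrightarrow> 0) at_top"
        by (rule tendsto_divide_0[OF tendsto_const filterlim_at_top_imp_at_infinity])
      moreover have "eventually (\<lambda>t::real. 1 / (1 + u * t) = 1 / (1 + max 0 t * u)) at_top"
        using eventually_ge_at_top[of 0] by eventually_elim (simp add: max_def mult.commute)
      ultimately have "((\<lambda>t::real. 1 / (1 + max 0 t * u)) \<longlongrightarrow> 0) at_top"
        by (rule Lim_transform_eventually)
      then show ?thesis using False by simp
    qed simp
    show "AE u in M. ((\<lambda>t::real. 1 / (1 + max 0 t * u)) \<longlongrightarrow> indicator {0} u) at_top"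
      using prob_nonnegD(4)[OF M] by eventually_elim (rule lim)
    show "\<forall>\<^sub>F t in at_top. AE u in M. norm (1 / (1 + max 0 t * u)) \<le> 1"
    proof (rule always_eventually, rule allI)
      fix t :: real
      have t: "0 \<le> max 0 t" by simp
      show "AE u in M. norm (1 / (1 + max 0 t * u)) \<le> 1"
        using prob_nonnegD(4)[OF M]
      proof eventually_elim
        case (elim u) then show ?case using stieltjes_integrand[OF t, of u] by simp
      qed
    qed
  qed (use prob_nonnegD(2)[OF M] in \<open>simp_all cong: measurable_cong_sets\<close>)
  then have "((\<lambda>t. stieltjes M (max 0 t)) \<longlongrightarrow> measure M {0}) at_top"
    by (simp add: stieltjes_def prob_nonnegD(2,3)[OF M])
  moreover have "eventually (\<lambda>t. stieltjes M (max 0 t) = stieltjes M t) at_top"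
    using eventually_ge_at_top[of 0] by eventually_elim (simp add: max_def)
  ultimately show ?thesis
    by (rule Lim_transform_eventually)
qed

text \<open>The kernel is the constant 1 exactly where \<open>unit_clip y = 1\<close>, and all other
  kernels vanish at 0. So the limit \<open>a\<close> is the mass of the constant ray, and
  subtracting it restricts the mixture to the rest, \<open>A\<close>.\<close>

lemma cbf_diff_limit:
  assumes f: "cbf f" and lim: "(f \<longlongrightarrow> a) (at_right 0)" shows "cbf (\<lambda>x. f x - a)"
proof (rule cbfE[OF f])
  fix P assume P: "real_distribution P" and fP: "\<And>x. 0 < x \<Longrightarrow> f x = f 1 * (LINT y|P. kern x y)"
    and f1: "0 \<le> f 1"
  interpret real_distribution P by fact
  define A where "A = {y::real. unit_clip y < 1}"
  have A [measurable]: "A \<in> sets borel" unfolding A_def by measurable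
  define g where "g x = (LINT y|P. f 1 * indicator A y * kern x y)" for x
  have cg: "cbf g"
    by (rule cbf_weighted_integral[of P "\<lambda>y. y" "\<lambda>y. f 1 * indicator A y" "f 1"])
       (use f1 in \<open>auto simp: g_def prob_space_axioms indicator_def\<close>)
  have ig: "integrable P (\<lambda>y. f 1 * indicator A y * kern x y)" if "0 < x" for x
    using integrable_real_mult_indicator[of A P "\<lambda>y. f 1 * kern x y"] integrable_kern[of "\<lambda>y. y" x] that
    by (simp add: mult_ac)
  have fg: "f x = g x + f 1 * measure P (- A)" if x: "0 < x" for x
  proof -
    have "f 1 * kern x y = f 1 * indicator A y * kern x y + f 1 * indicator (- A) y" for y
    proof (cases "y \<in> A")
      case False
      then have "unit_clip y = 1" unfolding A_def using unit_clip_bounds(2)[of y] by simp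
      then show ?thesis using x False by (simp add: kern_def)
    qed simp
    then have "f 1 * (LINT y|P. kern x y) = (LINT y|P. f 1 * indicator A y * kern x y + f 1 * indicator (- A) y)"
      by (simp flip: integral_mult_right_zero)
    also have "\<dots> = g x + f 1 * measure P (- A)"
      unfolding g_def using ig[OF x] A by (subst Bochner_Integration.integral_add) (auto simp: emeasure_eq_measure)
    finally show ?thesis using fP[OF x] by simp
  qed
  have "((\<lambda>t. LINT y|P. f 1 * indicator A y * kern (inverse (max 1 t)) y) \<longlongrightarrow> (LINT y|P. 0)) at_top"
  proof (rule integral_dominated_convergence_at_top[where w="\<lambda>_. f 1"])
    have "((\<lambda>t. f 1 * indicator A y * kern (inverse (max 1 t)) y) \<longlongrightarrow> 0) at_top" for y
    proof (cases "y \<in> A")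
      case True
      then have c: "1 - unit_clip y \<noteq> 0" by (auto simp: A_def)
      have "((\<lambda>t. kern (inverse t) y) \<longlongrightarrow> 0 / (unit_clip y * 0 + (1 - unit_clip y))) at_top"
        unfolding kern_def
        by (intro tendsto_intros tendsto_inverse_0_at_top filterlim_ident) (use c in auto)
      moreover have "eventually (\<lambda>t. kern (inverse t) y = kern (inverse (max 1 t)) y) at_top"
        using eventually_ge_at_top[of 1] by eventually_elim (simp add: max_def)
      ultimately have "((\<lambda>t. kern (inverse (max 1 t)) y) \<longlongrightarrow> 0 / (unit_clip y * 0 + (1 - unit_clip y))) at_top"
        by (rule Lim_transform_eventually)
      then have "((\<lambda>t. kern (inverse (max 1 t)) y) \<longlongrightarrow> 0) at_top" by simp
      then show ?thesis by (rule tendsto_mult_right_zero)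
    qed simp
    then show "AE y in P. ((\<lambda>t. f 1 * indicator A y * kern (inverse (max 1 t)) y) \<longlongrightarrow> 0) at_top" by simp
    show "\<forall>\<^sub>F t in at_top. AE y in P. norm (f 1 * indicator A y * kern (inverse (max 1 t)) y) \<le> f 1"
    proof (rule always_eventually, rule allI, rule AE_I2)
      fix t y :: real
      have "0 < inverse (max 1 t)" "inverse (max 1 t) \<le> 1" by (auto simp: inverse_le_1_iff)
      then have "norm (kern (inverse (max 1 t)) y) \<le> 1"
        using norm_kern_le[of "inverse (max 1 t)" y] by simp
      then have "f 1 * (indicator A y * norm (kern (inverse (max 1 t)) y)) \<le> f 1 * 1"
        using f1 by (intro mult_left_mono) (auto simp: indicator_def)
      then show "norm (f 1 * indicator A y * kern (inverse (max 1 t)) y) \<le> f 1"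
        using f1 by (simp add: abs_mult)
    qed
  qed (simp_all add: measurable_compose[OF _ kern_measurable])
  then have "((\<lambda>t. g (inverse (max 1 t))) \<longlongrightarrow> 0) at_top" by (simp add: g_def)
  moreover have "eventually (\<lambda>t. g (inverse (max 1 t)) = g (inverse t)) at_top"
    using eventually_ge_at_top[of 1] by eventually_elim (simp add: max_def)
  ultimately have "((\<lambda>t. g (inverse t)) \<longlongrightarrow> 0) at_top"
    by (rule Lim_transform_eventually)
  then have "(g \<longlongrightarrow> 0) (at_right 0)" unfolding filterlim_at_right_to_top .
  then have "((\<lambda>x. g x + f 1 * measure P (- A)) \<longlongrightarrow> 0 + f 1 * measure P (- A)) (at_right 0)"
    by (intro tendsto_intros)
  moreover have "eventually (\<lambda>x. g x + f 1 * measure P (- A) = f x) (at_right 0)"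
    by (rule eventually_mono[OF eventually_at_right_less]) (rule fg[symmetric])
  ultimately have "(f \<longlongrightarrow> 0 + f 1 * measure P (- A)) (at_right 0)"
    by (rule Lim_transform_eventually)
  then have "a = 0 + f 1 * measure P (- A)" by (rule tendsto_unique[OF trivial_limit_at_right_real lim])
  then have "f x - a = g x" if "0 < x" for x using fg[OF that] by simp
  then show ?thesis by (rule cbf_congI[OF cg])
qed

lemma cbf_neg_eta:
  assumes M: "M \<in> prob_nonneg"
  shows "cbf (neg_eta M)" "(neg_eta M \<longlongrightarrow> 0) (at_right 0)"
proof -
  have "cbf (\<lambda>r. r / (r * stieltjes M r))"
    using stieltjes_pos[OF M] by (intro cbf_involution cbf_stieltjes M) auto
  then have inv: "cbf (\<lambda>r. 1 / stieltjes M r)" by (rule cbf_congI) simp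
  have lim: "((\<lambda>r. 1 / stieltjes M r) \<longlongrightarrow> 1 / 1) (at_right 0)"
    by (intro tendsto_intros stieltjes_tendsto_zero M) simp
  show "cbf (neg_eta M)"
    using cbf_diff_limit[OF inv, of 1] lim by (simp add: neg_eta_def[abs_def])
  show "(neg_eta M \<longlongrightarrow> 0) (at_right 0)"
    using tendsto_diff[OF lim tendsto_const[of 1]] by (simp add: neg_eta_def[abs_def])
qed


section \<open>Recovering measures from their transforms\<close>

text \<open>With c = \<open>unit_clip y\<close>, \<open>kern r y / r\<close> equals 1 / (1 - c)
  times 1 / (1 + r u) for u = c / (1 - c). So \<open>K\<close> is the push-forward by
  \<open>u\<close> of the mixing measure with density \<open>w\<close>. The limit hypothesis
  excludes mass at c = 1 and makes the total mass 1.\<close>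

lemma prob_nonneg_of_cbf_ratio:
  assumes f: "cbf f" and f1: "0 < f 1" and lim: "((\<lambda>x. f x / x) \<longlongrightarrow> 1) (at_right 0)"
  obtains K where "K \<in> prob_nonneg" "\<And>r. 0 < r \<Longrightarrow> stieltjes K r = f r / r"
proof (rule cbfE[OF f])
  fix P assume P: "real_distribution P" and fP: "\<And>x. 0 < x \<Longrightarrow> f x = f 1 * (LINT y|P. kern x y)"
  interpret real_distribution P by fact
  define k where "k r y = f 1 * (1 / (unit_clip y * r + (1 - unit_clip y)))" for r y
  have k_pos: "0 < k r y" if "0 < r" for r y
    unfolding k_def using f1 kern_denominator_pos[OF that, of y] by simp
  have k_meas [measurable]: "k r \<in> borel_measurable borel" for r
    unfolding k_def by measurable
  have k_kern: "k r y = f 1 * kern r y / r" if "0 < r" for r y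
    using that by (simp add: k_def kern_def)
  have k_int: "integrable P (k r)" and k_val: "(LINT y|P. k r y) = f r / r" if "0 < r" for r
  proof -
    have "integrable P (\<lambda>y. f 1 * kern r y / r)"
      using integrable_kern[of "\<lambda>y. y" r] that by (intro integrable_divide integrable_mult_right) simp_all
    moreover have "k r = (\<lambda>y. f 1 * kern r y / r)" using k_kern[OF that] by (rule ext)
    ultimately show "integrable P (k r)" by simp
    show "(LINT y|P. k r y) = f r / r" using k_kern[OF that] fP[OF that] by simp
  qed
  have k_anti: "k r y \<le> k s y" if "0 < s" "s \<le> r" for r s y
  proof -
    have "unit_clip y * s \<le> unit_clip y * r" using that by (intro mult_left_mono) auto
    then show ?thesis unfolding k_def using f1 that kern_denominator_pos[of s y]
      by (intro mult_left_mono divide_left_mono mult_pos_pos kern_denominator_pos) auto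
  qed
  define A where "A = {y::real. 1 \<le> unit_clip y}"
  have A [measurable]: "A \<in> sets borel" unfolding A_def by measurable
  have ratio_le: "f r / r \<le> 1" if r: "0 < r" for r
  proof (rule tendsto_lowerbound[OF lim])
    have "f r / r \<le> f s / s" if "0 < s" "s < r" for s
      using cbf_ratio_antimono[OF f that(1), of r] that by (simp add: field_simps)
    then show "eventually (\<lambda>s. f r / r \<le> f s / s) (at_right 0)"
      unfolding eventually_at_right_field using r by (intro exI[of _ r]) auto
  qed simp
  \<comment> \<open>On \<open>A\<close> the integrand \<open>k r\<close> equals f 1 / r, while its
    integral f r / r is at most 1; as r tends to 0 no mass can be left.\<close>
  have "AE y in P. y \<notin> A"
  proof -
    have bound: "f 1 * measure P A \<le> r" if r: "0 < r" for r
    proof -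
      have "f 1 * measure P A / r = (LINT y|P. f 1 / r * indicator A y)"
        by (simp add: emeasure_eq_measure)
      also have "\<dots> \<le> (LINT y|P. k r y)"
      proof (intro integral_mono k_int r integrable_mult_right integrable_real_indicator)
        fix y show "f 1 / r * indicator A y \<le> k r y"
        proof (cases "y \<in> A")
          case True
          then have "unit_clip y = 1" unfolding A_def using unit_clip_bounds(2)[of y] by simp
          then show ?thesis using True by (simp add: k_def)
        next
          case False then show ?thesis using k_pos[OF r, of y] by simp
        qed
      qed (auto simp: emeasure_eq_measure)
      also have "\<dots> \<le> 1" using k_val[OF r] ratio_le[OF r] by simp
      finally show ?thesis using r by (simp add: divide_le_eq)
    qed
    have "f 1 * measure P A \<le> 0" by (rule field_le_epsilon) (use bound in simp)
    then have "measure P A = 0" using f1 measure_nonneg[of P A] by (simp add: mult_le_0_iff)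
    then have "emeasure P A = 0" by (simp add: emeasure_eq_measure)
    then show ?thesis by (intro AE_not_in) (auto simp: null_sets_def)
  qed
  then have clip_less: "AE y in P. unit_clip y < 1" by eventually_elim (simp add: A_def)
  define w where "w y = f 1 / (1 - unit_clip y)" for y
  have w_meas [measurable]: "w \<in> borel_measurable borel" unfolding w_def by measurable
  have w_nn: "0 \<le> w y" for y unfolding w_def using f1 by simp
  let ?r = "\<lambda>n. 1 / real (Suc n)"
  have r_pos: "0 < ?r n" for n by simp
  have r_lim: "?r \<longlonglongrightarrow> 0" using LIMSEQ_inverse_real_of_nat by (simp add: inverse_eq_divide)
  have w_int: "integrable P w" and w_val: "(LINT y|P. w y) = 1"
  proof -
    \<comment> \<open>As r decreases to 0, \<open>k r\<close> increases to \<open>w\<close>;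
      monotone convergence gives integrability of the possibly unbounded \<open>w\<close> together
      with its integral.\<close>
    have mono: "AE y in P. mono (\<lambda>n. k (?r n) y)"
      by (intro AE_I2 monoI k_anti r_pos) (simp add: frac_le)
    have lim': "AE y in P. (\<lambda>n. k (?r n) y) \<longlonglongrightarrow> w y"
      using clip_less
    proof eventually_elim
      case (elim y)
      have "(\<lambda>n. k (?r n) y) \<longlonglongrightarrow> f 1 * (1 / (unit_clip y * 0 + (1 - unit_clip y)))"
        unfolding k_def by (intro tendsto_intros r_lim) (use elim in auto)
      then show ?case by (simp add: w_def)
    qed
    have ilim: "(\<lambda>n. LINT y|P. k (?r n) y) \<longlonglongrightarrow> 1"
    proof -
      have "filterlim ?r (at_right 0) sequentially"
        using r_lim by (intro tendsto_imp_filterlim_at_right) (auto simp del: of_nat_Suc)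
      then have "(\<lambda>n. f (?r n) / ?r n) \<longlonglongrightarrow> 1" by (rule filterlim_compose[OF lim])
      then show ?thesis using k_val[OF r_pos] by (simp only:)
    qed
    show "integrable P w" "(LINT y|P. w y) = 1"
      by (rule integrable_monotone_convergence[OF k_int[OF r_pos] mono lim' ilim]
               integral_monotone_convergence[OF k_int[OF r_pos] mono lim' ilim]; measurable)+
  qed
  define D where "D = density P (\<lambda>y. ennreal (w y))"
  define u where "u y = unit_clip y / (1 - unit_clip y)" for y
  have u_meas [measurable]: "u \<in> borel_measurable borel" unfolding u_def by measurable
  have "prob_space D"
  proof (rule prob_spaceI)
    have "emeasure D (space D) = (\<integral>\<^sup>+ y. ennreal (w y) \<partial>P)"
      unfolding D_def by (subst emeasure_density) (auto intro!: nn_integral_cong)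
    also have "\<dots> = ennreal (LINT y|P. w y)"
      using w_nn w_int by (intro nn_integral_eq_integral) auto
    finally show "emeasure D (space D) = 1" using w_val by simp
  qed
  then interpret D: prob_space D .
  define K where "K = distr D borel u"
  have uD: "u \<in> borel_measurable D" by (simp add: D_def)
  have "K \<in> prob_nonneg"
    unfolding prob_nonneg_def K_def
  proof (intro CollectI conjI)
    show "prob_space (distr D borel u)" using uD by (rule D.prob_space_distr)
    have "0 \<le> u y" for y unfolding u_def by simp
    then show "AE x in distr D borel u. 0 \<le> x" using uD by (subst AE_distr_iff) auto
  qed simp
  moreover have "stieltjes K r = f r / r" if r: "0 < r" for r
  proof -
    have "stieltjes K r = (LINT y|D. 1 / (1 + r * u y))"
      unfolding stieltjes_def K_def by (rule integral_distr) (auto simp: uD)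
    also have "\<dots> = (LINT y|P. w y * (1 / (1 + r * u y)))"
      unfolding D_def using w_nn by (subst integral_real_density) auto
    also have "\<dots> = (LINT y|P. k r y)"
    proof (rule integral_cong_AE)
      show "AE y in P. w y * (1 / (1 + r * u y)) = k r y"
        using clip_less
      proof eventually_elim
        case (elim y)
        have "(1 - unit_clip y) * (1 + r * u y) = unit_clip y * r + (1 - unit_clip y)"
          using elim by (simp add: u_def distrib_left)
        then show ?case by (simp add: w_def k_def)
      qed
    qed auto
    finally show ?thesis using k_val[OF r] by simp
  qed
  ultimately show ?thesis by (rule that)
qed

lemma prob_nonneg_of_neg_eta:
  assumes H: "cbf H" "(H \<longlongrightarrow> 0) (at_right 0)"
  obtains K where "K \<in> prob_nonneg" "\<And>r. 0 < r \<Longrightarrow> neg_eta K r = H r"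
proof -
  have pos: "0 < 1 + H x" if "0 < x" for x using cbf_nonneg[OF H(1) that] by simp
  have f: "cbf (\<lambda>x. x / (1 + H x))"
    using pos by (intro cbf_involution cbf_add cbf_const H) auto
  have "((\<lambda>x. 1 / (1 + H x)) \<longlongrightarrow> 1 / (1 + 0)) (at_right 0)"
    by (intro tendsto_intros H) simp
  moreover have "eventually (\<lambda>x. 1 / (1 + H x) = x / (1 + H x) / x) (at_right 0)"
    by (rule eventually_mono[OF eventually_at_right_less]) simp
  ultimately have "((\<lambda>x. x / (1 + H x) / x) \<longlongrightarrow> 1 / (1 + 0)) (at_right 0)"
    by (rule Lim_transform_eventually)
  then have lim: "((\<lambda>x. x / (1 + H x) / x) \<longlongrightarrow> 1) (at_right 0)" by simp
  have "0 < 1 / (1 + H 1)" using pos[of 1] by simp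
  obtain K where K: "K \<in> prob_nonneg" "\<And>r. 0 < r \<Longrightarrow> stieltjes K r = r / (1 + H r) / r"
    by (rule prob_nonneg_of_cbf_ratio[OF f \<open>0 < 1 / (1 + H 1)\<close> lim]) (rule that)
  have "neg_eta K r = H r" if "0 < r" for r using K(2)[OF that] that by (simp add: neg_eta_def)
  then show ?thesis using K(1) by (intro that[of K])
qed

lemma AE_zero_imp_dirac:
  assumes M: "M \<in> prob_nonneg" and z: "AE u in M. u = 0" shows "M = dirac 0"
proof -
  interpret prob_space M using prob_nonnegD[OF M] by simp
  have sM: "sets M = sets borel" using prob_nonnegD[OF M] by simp
  show ?thesis
  proof (rule measure_eqI)
    fix A assume "A \<in> sets M"
    then have A: "A \<in> sets borel" using sM by simp
    have "emeasure M A = (\<integral>\<^sup>+ u. indicator A u \<partial>M)" using A sM by simp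
    also have "\<dots> = (\<integral>\<^sup>+ u. indicator A (0::real) \<partial>M)"
      using z by (intro nn_integral_cong_AE) auto
    also have "\<dots> = indicator A 0" by (simp add: emeasure_space_1)
    finally show "emeasure M A = emeasure (dirac 0) A" using A by simp
  qed (simp add: sM)
qed

text \<open>Equality of the two integrals would force the nonnegative difference of integrands to
  vanish almost everywhere, hence u = 0 almost everywhere.\<close>

lemma stieltjes_strict_antimono:
  assumes M: "M \<in> prob_nonneg" "M \<noteq> dirac 0" and rs: "0 \<le> r" "r < s"
  shows "stieltjes M s < stieltjes M r"
proof (rule ccontr)
  assume not_less: "\<not> stieltjes M s < stieltjes M r"
  interpret prob_space M using prob_nonnegD[OF M(1)] by simp
  let ?d = "\<lambda>u. 1 / (1 + r * u) - 1 / (1 + s * u)"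
  have int: "integrable M ?d" using integrable_stieltjes[OF M(1)] rs by (intro Bochner_Integration.integrable_diff) auto
  have nn: "0 \<le> ?d u" if "0 \<le> u" for u
  proof -
    have "r * u \<le> s * u" "0 \<le> r * u" using rs that by (auto intro: mult_right_mono)
    then have "1 / (1 + s * u) \<le> 1 / (1 + r * u)" by (intro divide_left_mono mult_pos_pos) auto
    then show ?thesis by simp
  qed
  have AE_nn: "AE u in M. 0 \<le> ?d u" using prob_nonnegD(4)[OF M(1)] by eventually_elim (rule nn)
  have "(LINT u|M. ?d u) = stieltjes M r - stieltjes M s"
    unfolding stieltjes_def using integrable_stieltjes[OF M(1)] rs by (intro Bochner_Integration.integral_diff) auto
  moreover have "0 \<le> (LINT u|M. ?d u)" using AE_nn by (rule integral_nonneg_AE)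
  ultimately have "(LINT u|M. ?d u) = 0" using not_less by simp
  then have "AE u in M. ?d u = 0" using integral_nonneg_eq_0_iff_AE[OF int AE_nn] by simp
  then have "AE u in M. u = 0"
    using prob_nonnegD(4)[OF M(1)]
  proof eventually_elim
    case (elim u)
    have "0 \<le> r * u" "0 \<le> s * u" using rs elim by auto
    then have "1 + r * u = 1 + s * u" using elim(1) by (auto simp: divide_simps split: if_splits)
    then show ?case using rs by simp
  qed
  then show False using AE_zero_imp_dirac M by blast
qed

lemma neg_eta_strict_mono:
  assumes M: "M \<in> prob_nonneg" "M \<noteq> dirac 0" and rs: "0 \<le> r" "r < s"
  shows "neg_eta M r < neg_eta M s"
  using stieltjes_strict_antimono[OF M rs] stieltjes_pos[OF M(1), of s] rs
  by (simp add: neg_eta_def frac_less2)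

lemma stieltjes_zero: "M \<in> prob_nonneg \<Longrightarrow> stieltjes M 0 = 1"
  using prob_space.prob_space[OF prob_nonnegD(1)] by (simp add: stieltjes_def)

lemma neg_eta_pos:
  assumes M: "M \<in> prob_nonneg" "M \<noteq> dirac 0" and r: "0 < r" shows "0 < neg_eta M r"
  using neg_eta_strict_mono[OF M, of 0 r] r stieltjes_zero[OF M(1)] by (simp add: neg_eta_def)

lemma dirac_prob_nonneg: "0 \<le> a \<Longrightarrow> dirac a \<in> prob_nonneg"
  by (auto simp: prob_nonneg_def prob_space_return AE_return)

lemma stieltjes_dirac: "stieltjes (dirac a) r = 1 / (1 + r * a)"
  unfolding stieltjes_def by (subst integral_return) auto

section \<open>Uniqueness\<close>


text \<open>The constant term is the limit at 0; after dividing by x the same argument applies to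
  the shifted coefficients, whence the induction over arbitrary \<open>a\<close>.\<close>

lemma powser_eq_0D:
  fixes a :: "nat \<Rightarrow> real"
  assumes s: "0 < s" and sums: "\<And>x. x \<noteq> 0 \<Longrightarrow> norm x < s \<Longrightarrow> (\<lambda>n. a n * x ^ n) sums 0"
  shows "a n = 0"
  using sums
proof (induction n arbitrary: a)
  case 0
  have "((\<lambda>x::real. 0) \<longlongrightarrow> a 0) (at 0)"
    by (rule powser_limit_0_strong[OF s]) (use 0 in auto)
  then show ?case using tendsto_unique[OF _ _ tendsto_const[of 0]] trivial_limit_at by blast
next
  case (Suc n)
  have "((\<lambda>x::real. 0) \<longlongrightarrow> a 0) (at 0)"
    by (rule powser_limit_0_strong[OF s]) (use Suc.prems in auto)
  then have a0: "a 0 = 0" using tendsto_unique[OF _ _ tendsto_const[of 0]] trivial_limit_at by blast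
  show ?case
  proof (rule Suc.IH[of "\<lambda>n. a (Suc n)"])
    fix x :: real assume x: "x \<noteq> 0" "norm x < s"
    have "(\<lambda>n. a (Suc n) * x ^ Suc n) sums (0 - a 0 * x ^ 0)"
      using Suc.prems[OF x] by (subst sums_Suc_iff) simp
    then have "(\<lambda>n. (a (Suc n) * x ^ Suc n) / x) sums (0 / x)" using a0 by (intro sums_divide) simp
    then show "(\<lambda>n. a (Suc n) * x ^ n) sums 0" using x by simp
  qed
qed

text \<open>On a bounded support the exponential series may be integrated term by term, so the
  characteristic function is a series in the moments.\<close>

lemma moments_determine_distribution:
  assumes M: "real_distribution M" and N: "real_distribution N"
    and supp: "AE x in M. \<bar>x\<bar> \<le> 1" "AE x in N. \<bar>x\<bar> \<le> 1"
    and eq: "\<And>k. (LINT x|M. x ^ k) = (LINT x|N. x ^ k)"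
  shows "M = N"
proof (rule Levy_uniqueness[OF M N])
  have char: "(\<lambda>k. (\<i> * of_real t) ^ k /\<^sub>R fact k * of_real (LINT x|M. x ^ k)) sums char M t"
    if M: "real_distribution M" and supp: "AE x in M. \<bar>x\<bar> \<le> 1" for M t
  proof -
    interpret real_distribution M by fact
    define f where "f k x = (\<i> * of_real (t * x)) ^ k /\<^sub>R fact k" for k and x :: real
    have nf: "norm (f k x) = \<bar>t\<bar> ^ k * \<bar>x\<bar> ^ k / fact k" for k x
      by (simp add: f_def norm_mult norm_power abs_mult power_mult_distrib divide_inverse mult.commute)
    have bound: "AE x in M. norm (f k x) \<le> \<bar>t\<bar> ^ k / fact k" for k
      using supp
    proof eventually_elim
      case (elim x)
      have "\<bar>t\<bar> ^ k * \<bar>x\<bar> ^ k \<le> \<bar>t\<bar> ^ k * 1"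
        using elim by (intro mult_left_mono power_le_one) auto
      then show ?case unfolding nf by (intro divide_right_mono) auto
    qed
    have f_meas: "f k \<in> borel_measurable M" for k unfolding f_def by simp
    have int: "integrable M (f k)" for k
      by (rule integrable_const_bound[OF bound f_meas])
    have exp_summable: "summable (\<lambda>k. \<bar>t\<bar> ^ k / fact k)"
      using summable_exp[of "\<bar>t\<bar>"] by (simp add: divide_inverse mult.commute)
    have "(\<lambda>k. integral\<^sup>L M (f k)) sums (LINT x|M. (\<Sum>k. f k x))"
    proof (rule sums_integral[OF int])
      have "AE x in M. \<forall>k. norm (f k x) \<le> \<bar>t\<bar> ^ k / fact k" using bound by (simp add: AE_all_countable)
      then show "AE x in M. summable (\<lambda>k. norm (f k x))"
        by eventually_elim (rule summable_comparison_test'[OF exp_summable, of 0], simp)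
      show "summable (\<lambda>k. LINT x|M. norm (f k x))"
      proof (rule summable_comparison_test'[OF exp_summable, of 0])
        fix k
        have "(LINT x|M. norm (f k x)) \<le> \<bar>t\<bar> ^ k / fact k"
          using int bound by (intro integral_le_const integrable_norm)
        then show "norm (LINT x|M. norm (f k x)) \<le> \<bar>t\<bar> ^ k / fact k" by simp
      qed
    qed
    moreover have "(\<Sum>k. f k x) = iexp (t * x)" for x
      unfolding f_def exp_def by simp
    moreover have "integral\<^sup>L M (f k) = (\<i> * of_real t) ^ k /\<^sub>R fact k * of_real (LINT x|M. x ^ k)" for k
    proof -
      have "f k = (\<lambda>x. (\<i> * of_real t) ^ k /\<^sub>R fact k * of_real (x ^ k))"
        by (rule ext) (simp add: f_def power_mult_distrib)
      then show ?thesis by (simp add: integral_complex_of_real del: of_real_power)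
    qed
    ultimately show ?thesis by (simp add: char_def)
  qed
  show "char M = char N"
  proof
    fix t
    show "char M t = char N t"
      using char[OF M supp(1), of t] char[OF N supp(2), of t] eq sums_unique2 by simp
  qed
qed

text \<open>In the bounded variable \<open>Z = r0 u / (1 + r0 u)\<close> the transform near \<open>r0\<close> is a power series whose
  coefficients are differences of consecutive moments.\<close>

lemma stieltjes_expansion:
  assumes M: "M \<in> prob_nonneg" and r0: "0 < r0" and x: "\<bar>x\<bar> < 1"
  defines "Z \<equiv> \<lambda>u. 1 - 1 / (1 + r0 * max 0 u)"
  shows "(\<lambda>k. (LINT u|M. (1 - Z u) * Z u ^ k) * x ^ k) sums stieltjes M (r0 * (1 - x))"
proof -
  interpret prob_space M using prob_nonnegD[OF M] by simp
  have Z: "0 \<le> Z u" "Z u \<le> 1" for u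
    using stieltjes_integrand[of r0 "max 0 u"] r0 by (auto simp: Z_def)
  have [measurable]: "Z \<in> borel_measurable borel" unfolding Z_def by measurable
  have [measurable]: "Z \<in> borel_measurable M" using prob_nonnegD(2)[OF M] by (simp cong: measurable_cong_sets)
  define f where "f k u = (1 - Z u) * Z u ^ k * x ^ k" for k u
  have bound: "norm (f k u) \<le> \<bar>x\<bar> ^ k" for k u
  proof -
    have "(1 - Z u) * Z u ^ k \<le> 1 * 1" using Z[of u] by (intro mult_mono power_le_one) auto
    then have "((1 - Z u) * Z u ^ k) * \<bar>x\<bar> ^ k \<le> 1 * \<bar>x\<bar> ^ k" by (intro mult_right_mono) auto
    then show ?thesis using Z[of u] by (simp add: f_def abs_mult power_abs)
  qed
  have f_meas: "f k \<in> borel_measurable M" for k unfolding f_def by measurable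
  have int: "integrable M (f k)" for k
    by (rule integrable_const_bound[OF _ f_meas]) (use bound in auto)
  have geo: "summable (\<lambda>k. \<bar>x\<bar> ^ k)" using x by (intro summable_geometric) simp
  have "(\<lambda>k. integral\<^sup>L M (f k)) sums (LINT u|M. (\<Sum>k. f k u))"
  proof (rule sums_integral[OF int])
    show "AE u in M. summable (\<lambda>k. norm (f k u))"
      by (intro AE_I2 summable_comparison_test'[OF geo, of 0]) (use bound in simp)
    show "summable (\<lambda>k. LINT u|M. norm (f k u))"
    proof (rule summable_comparison_test'[OF geo, of 0])
      fix k
      have "(LINT u|M. norm (f k u)) \<le> \<bar>x\<bar> ^ k"
        using int bound by (intro integral_le_const integrable_norm AE_I2)
      then show "norm (LINT u|M. norm (f k u)) \<le> \<bar>x\<bar> ^ k" by simp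
    qed
  qed
  moreover have "(LINT u|M. (\<Sum>k. f k u)) = stieltjes M (r0 * (1 - x))"
    unfolding stieltjes_def
  proof (rule prob_nonneg_integral_cong[OF M])
    show "(\<lambda>u. \<Sum>k. f k u) \<in> borel_measurable borel" unfolding f_def by measurable
    fix u :: real assume u: "0 \<le> u"
    have zx: "\<bar>Z u * x\<bar> < 1" 
      using Z[of u] x mult_le_one[of "Z u" "\<bar>x\<bar>"] mult_right_mono[of "Z u" 1 "\<bar>x\<bar>"] by (simp add: abs_mult)
    have "(\<Sum>k. f k u) = (\<Sum>k. (1 - Z u) * (Z u * x) ^ k)"
      by (simp add: f_def power_mult_distrib mult.assoc)
    also have "\<dots> = (1 - Z u) * (1 / (1 - Z u * x))"
      using zx by (subst suminf_mult) (auto simp: suminf_geometric summable_geometric)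
    also have "\<dots> = 1 / (1 + r0 * (1 - x) * u)"
    proof -
      have p: "0 < 1 + r0 * u" using r0 u by (intro add_pos_nonneg) auto
      have z: "1 - Z u = 1 / (1 + r0 * u)" "Z u = r0 * u / (1 + r0 * u)"
        using u p by (simp_all add: Z_def max_def field_simps)
      have "1 - Z u * x = (1 + r0 * (1 - x) * u) / (1 + r0 * u)"
        unfolding z(2) using p by (simp add: field_simps)
      then show ?thesis unfolding z(1) using p by simp
    qed
    finally show "(\<Sum>k. f k u) = 1 / (1 + r0 * (1 - x) * u)" .
  qed measurable
  moreover have "integral\<^sup>L M (f k) = (LINT u|M. (1 - Z u) * Z u ^ k) * x ^ k" for k
    unfolding f_def by simp
  ultimately show ?thesis by simp
qed

text \<open>Agreement near 0 is all that S-transforms provide. Expanding around an interior point of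
  the interval determines the moments of the bounded variable \<open>Z\<close>, hence its law, and
  \<open>Z\<close> is an injective function of u \<ge> 0.\<close>

lemma stieltjes_unique:
  assumes M: "M \<in> prob_nonneg" and N: "N \<in> prob_nonneg" and \<delta>: "0 < \<delta>"
    and eq: "\<And>r. 0 < r \<Longrightarrow> r < \<delta> \<Longrightarrow> stieltjes M r = stieltjes N r"
  shows "M = N"
proof -
  \<comment> \<open>Half of \<delta>, so that r0 * (1 - x) stays in (0, \<delta>) for all
    \<bar>x\<bar> < 1.\<close>
  define r0 where "r0 = \<delta> / 2"
  have r0: "0 < r0" using \<delta> by (simp add: r0_def)
  define Z where "Z u = 1 - 1 / (1 + r0 * max 0 u)" for u
  have Z: "0 \<le> Z u" "Z u \<le> 1" for u
    using stieltjes_integrand[of r0 "max 0 u"] r0 by (auto simp: Z_def)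
  have Zm: "Z \<in> borel_measurable borel" unfolding Z_def by measurable
  define a where "a M k = (LINT u|M. (1 - Z u) * Z u ^ k)" for M k
  have a_eq: "a M k = a N k" for k
  proof -
    have "a M k - a N k = 0"
    proof (rule powser_eq_0D[where a="\<lambda>k. a M k - a N k" and s=1])
      fix x :: real assume x: "x \<noteq> 0" "norm x < 1"
      have "0 < r0 * (1 - x)" "r0 * (1 - x) < \<delta>" using x \<delta> by (auto simp: r0_def)
      then have "stieltjes M (r0 * (1 - x)) = stieltjes N (r0 * (1 - x))" by (rule eq)
      moreover have "(\<lambda>k. a M k * x ^ k) sums stieltjes M (r0 * (1 - x))"
        "(\<lambda>k. a N k * x ^ k) sums stieltjes N (r0 * (1 - x))"
        using stieltjes_expansion[OF M r0, of x] stieltjes_expansion[OF N r0, of x] x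
        by (simp_all add: a_def Z_def)
      ultimately have "(\<lambda>k. a M k * x ^ k - a N k * x ^ k) sums
          (stieltjes N (r0 * (1 - x)) - stieltjes N (r0 * (1 - x)))"
        by (intro sums_diff) simp_all
      then show "(\<lambda>k. (a M k - a N k) * x ^ k) sums 0" by (simp add: left_diff_distrib)
    qed simp
    then show ?thesis by simp
  qed
  have Z_int: "integrable K (\<lambda>u. Z u ^ k)" if K: "K \<in> prob_nonneg" for K k
  proof -
    interpret prob_space K using prob_nonnegD[OF K] by simp
    have "Z \<in> borel_measurable K" using Zm prob_nonnegD(2)[OF K] by (simp cong: measurable_cong_sets)
    then show ?thesis
      by (intro integrable_const_bound[where B=1]) (use Z in \<open>auto simp: power_abs intro: power_le_one\<close>)
  qed
  have moment_step: "(LINT u|K. Z u ^ Suc k) = (LINT u|K. Z u ^ k) - a K k" if K: "K \<in> prob_nonneg" for K k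
  proof -
    have "a K k = (LINT u|K. Z u ^ k - Z u ^ Suc k)" unfolding a_def by (simp add: left_diff_distrib)
    also have "\<dots> = (LINT u|K. Z u ^ k) - (LINT u|K. Z u ^ Suc k)"
      by (rule Bochner_Integration.integral_diff[OF Z_int[OF K] Z_int[OF K]])
    finally show ?thesis by simp
  qed
  have moments: "(LINT u|M. Z u ^ k) = (LINT u|N. Z u ^ k)" for k
  proof (induction k)
    case 0
    show ?case using prob_nonnegD(1)[OF M] prob_nonnegD(1)[OF N] by (simp add: prob_space.prob_space)
  next
    case (Suc k) then show ?case unfolding moment_step[OF M] moment_step[OF N] a_eq by simp
  qed
  have ZK: "Z \<in> borel_measurable K" if K: "K \<in> prob_nonneg" for K
    using Zm prob_nonnegD(2)[OF K] by (simp cong: measurable_cong_sets)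
  have distr_eq: "distr M borel Z = distr N borel Z"
  proof (rule moments_determine_distribution)
    show "real_distribution (distr M borel Z)" "real_distribution (distr N borel Z)"
      using prob_nonnegD(1)[OF M] prob_nonnegD(1)[OF N] ZK[OF M] ZK[OF N]
      by (auto intro: prob_space.real_distribution_distr)
    show "AE x in distr M borel Z. \<bar>x\<bar> \<le> 1" "AE x in distr N borel Z. \<bar>x\<bar> \<le> 1"
      using Z ZK[OF M] ZK[OF N] by (subst AE_distr_iff; auto simp: abs_le_iff)+
    show "(LINT x|distr M borel Z. x ^ k) = (LINT x|distr N borel Z. x ^ k)" for k
      using moments ZK[OF M] ZK[OF N] by (simp add: integral_distr)
  qed
  \<comment> \<open>\<open>W\<close> inverts \<open>Z\<close> on the half-line, because Z / (1 - Z)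
    = r0 * u.\<close>
  define W where "W z = z / ((1 - z) * r0)" for z
  have Wm: "W \<in> borel_measurable borel" unfolding W_def by measurable
  have recover: "distr (distr K borel Z) borel W = K" if K: "K \<in> prob_nonneg" for K
  proof -
    have "distr (distr K borel Z) borel W = distr K borel (W \<circ> Z)"
      by (rule distr_distr[OF Wm ZK[OF K]])
    also have "\<dots> = distr K borel (\<lambda>u. u)"
    proof (rule distr_cong_AE)
      show "AE u in K. (W \<circ> Z) u = u"
        using prob_nonnegD(4)[OF K]
      proof eventually_elim
        case (elim u)
        have p: "0 < 1 + r0 * u" using r0 elim by (intro add_pos_nonneg) auto
        then have "Z u = r0 * u / (1 + r0 * u)" "1 - Z u = 1 / (1 + r0 * u)"
          using elim by (simp_all add: Z_def max_def field_simps)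
        then show ?case using p r0 by (simp add: W_def)
      qed
      show "W \<circ> Z \<in> borel_measurable K" using measurable_comp[OF ZK[OF K] Wm] .
      show "(\<lambda>u. u) \<in> borel_measurable K" using prob_nonnegD(2)[OF K] by (simp cong: measurable_cong_sets)
    qed auto
    also have "\<dots> = distr K K (\<lambda>u. u)"
      by (rule distr_cong) (use prob_nonnegD(2)[OF K] in auto)
    also have "\<dots> = K" by (rule distr_id)
    finally show ?thesis .
  qed
  show ?thesis by (rule trans[OF sym[OF recover[OF M, unfolded distr_eq]] recover[OF N]])
qed

lemma neg_eta_unique:
  assumes M: "M \<in> prob_nonneg" and N: "N \<in> prob_nonneg" and \<delta>: "0 < \<delta>"
    and eq: "\<And>r. 0 < r \<Longrightarrow> r < \<delta> \<Longrightarrow> neg_eta M r = neg_eta N r"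
  shows "M = N"
  by (rule stieltjes_unique[OF M N \<delta>]) (simp add: stieltjes_eq_neg_eta eq)

section \<open>Free multiplicative convolution and its powers\<close>


lemma isCont_stieltjes:
  assumes M: "M \<in> prob_nonneg" and r: "0 < r" shows "isCont (stieltjes M) r"
proof -
  have "isCont (\<lambda>x. x * stieltjes M x / x) r"
    by (rule isCont_divide[OF cbf_isCont[OF cbf_stieltjes[OF M] r] continuous_ident]) (use r in simp)
  moreover have "eventually (\<lambda>x. x * stieltjes M x / x = stieltjes M x) (nhds r)"
    by (rule eventually_mono[OF eventually_nhds_in_open[of "{0<..}" r]]) (use r in auto)
  ultimately show ?thesis by (simp only: isCont_cong)
qed

lemma stieltjes_range:
  assumes M: "M \<in> prob_nonneg" "M \<noteq> dirac 0"
  shows "stieltjes M ` {0<..} = {measure M {0}<..<1}"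
proof (intro equalityI subsetI)
  fix t assume "t \<in> stieltjes M ` {0<..}"
  then obtain r where r: "0 < r" "t = stieltjes M r" by auto
  have "stieltjes M r < 1"
    using stieltjes_strict_antimono[OF M, of 0 r] r stieltjes_zero[OF M(1)] by simp
  \<comment> \<open>The limit at infinity gives only a weak bound; strict decrease from r to r + 1
    makes it strict at r.\<close>
  moreover have "measure M {0} \<le> stieltjes M (r + 1)"
  proof (rule tendsto_upperbound[OF stieltjes_tendsto_top[OF M(1)]])
    show "eventually (\<lambda>s. stieltjes M s \<le> stieltjes M (r + 1)) at_top"
      using eventually_gt_at_top[of "r + 1"]
      by eventually_elim (use stieltjes_strict_antimono[OF M, of "r + 1"] r in \<open>auto intro: less_imp_le\<close>)
  qed simp
  moreover have "stieltjes M (r + 1) < stieltjes M r"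
    using stieltjes_strict_antimono[OF M, of r "r + 1"] r by simp
  ultimately show "t \<in> {measure M {0}<..<1}" using r by simp
next
  fix t assume t: "t \<in> {measure M {0}<..<1}"
  have "eventually (\<lambda>r. t < stieltjes M r) (at_right 0)"
    using order_tendstoD(1)[OF stieltjes_tendsto_zero[OF M(1)], of t] t by simp
  then obtain d where d: "0 < d" "\<And>r. 0 < r \<Longrightarrow> r < d \<Longrightarrow> t < stieltjes M r"
    unfolding eventually_at_right_field by auto
  define a where "a = d / 2"
  have a: "0 < a" "t < stieltjes M a" using d by (auto simp: a_def)
  have "eventually (\<lambda>r. stieltjes M r < t) at_top"
    using order_tendstoD(2)[OF stieltjes_tendsto_top[OF M(1)], of t] t by simp
  then have "eventually (\<lambda>r. stieltjes M r < t \<and> a \<le> r) at_top"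
    using eventually_ge_at_top[of a] by (rule eventually_conj)
  then obtain b where b: "stieltjes M b < t" "a \<le> b" using eventually_happens by force
  have "\<exists>r\<ge>a. r \<le> b \<and> stieltjes M r = t"
    using a b by (intro IVT2) (auto intro: isCont_stieltjes[OF M(1)])
  then show "t \<in> stieltjes M ` {0<..}" using a(1) by (metis greaterThan_iff imageI less_le_trans)
qed

lemma S_domain_eq:
  assumes M: "M \<in> prob_nonneg" "M \<noteq> dirac 0"
  shows "t \<in> S_domain M \<longleftrightarrow> (\<exists>r>0. t = psi M (- r))"
proof -
  have "t \<in> S_domain M \<longleftrightarrow> 1 + t \<in> {measure M {0}<..<1}" by (auto simp: S_domain_def)
  also have "\<dots> \<longleftrightarrow> (\<exists>r>0. 1 + t = stieltjes M r)"
    unfolding stieltjes_range[OF M, symmetric] by auto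
  also have "\<dots> \<longleftrightarrow> (\<exists>r>0. t = psi M (- r))"
    using psi_eq_stieltjes[OF M(1)] by (intro ex_cong1 conj_cong) auto
  finally show ?thesis .
qed

lemma psi_in_S_domain:
  "M \<in> prob_nonneg \<Longrightarrow> M \<noteq> dirac 0 \<Longrightarrow> 0 < r \<Longrightarrow> psi M (- r) \<in> S_domain M"
  using S_domain_eq by blast

lemma S_domain_mono: "t \<in> S_domain M \<Longrightarrow> t \<le> s \<Longrightarrow> s < 0 \<Longrightarrow> s \<in> S_domain M"
  by (auto simp: S_domain_def)

lemma psi_inj:
  assumes M: "M \<in> prob_nonneg" "M \<noteq> dirac 0" shows "inj_on (psi M) {..<0}"
proof (rule linorder_inj_onI')
  fix s t :: real assume st: "s \<in> {..<0}" "t \<in> {..<0}" "s < t"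
  have "psi M s = stieltjes M (- s) - 1" "psi M t = stieltjes M (- t) - 1"
    using psi_eq_stieltjes[OF M(1), of "- s"] psi_eq_stieltjes[OF M(1), of "- t"] st by auto
  then show "psi M s \<noteq> psi M t"
    using stieltjes_strict_antimono[OF M, of "- t" "- s"] st by simp
qed

text \<open>Parametrising t by r removes the inverse function: with h = \<open>neg_eta M r\<close>
  the S-transform is r / h, and t and h determine each other by 1 + t = 1 / (1 + h).\<close>

lemma S_transform_psi:
  assumes M: "M \<in> prob_nonneg" "M \<noteq> dirac 0" and r: "0 < r"
  shows "S_transform M (psi M (- r)) = r / neg_eta M r"
proof -
  have inv: "the_inv_into {..<0} (psi M) (psi M (- r)) = - r"
    using the_inv_into_f_f[OF psi_inj[OF M], of "- r"] r by simp
  have G: "0 < stieltjes M r" "stieltjes M r < 1"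
    using stieltjes_pos[OF M(1)] stieltjes_range[OF M] r by auto
  have psi: "psi M (- r) = stieltjes M r - 1" using psi_eq_stieltjes[OF M(1)] r by simp
  show ?thesis
    unfolding S_transform_def inv unfolding psi neg_eta_def using G by (simp add: field_simps)
qed

lemma neg_eta_eq_psi:
  "M \<in> prob_nonneg \<Longrightarrow> 0 < r \<Longrightarrow> neg_eta M r = 1 / (1 + psi M (- r)) - 1"
  using psi_eq_stieltjes[of M r] by (simp add: neg_eta_def)

text \<open>If t = \<open>psi K (- r)\<close> = \<open>psi L (- s)\<close>, both sides share
  \<open>neg_eta\<close>, so equal S-transforms give r = s.\<close>

lemma free_mult_conv_unique:
  assumes M: "M \<in> prob_nonneg" and N: "N \<in> prob_nonneg"
    and K: "is_free_mult_conv M N K" and L: "is_free_mult_conv M N L"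
  shows "K = L"
proof (cases "M = dirac 0 \<or> N = dirac 0")
  case True
  then show ?thesis using K L by (auto simp: is_free_mult_conv_def)
next
  case False
  then have M0: "M \<noteq> dirac 0" and N0: "N \<noteq> dirac 0" by auto
  let ?D = "S_domain M \<inter> S_domain N"
  from K False have K': "K \<in> prob_nonneg" "K \<noteq> dirac 0" "?D \<subseteq> S_domain K"
    "\<And>t. t \<in> ?D \<Longrightarrow> S_transform K t = S_transform M t * S_transform N t"
    by (auto simp: is_free_mult_conv_def)
  from L False have L': "L \<in> prob_nonneg" "L \<noteq> dirac 0" "?D \<subseteq> S_domain L"
    "\<And>t. t \<in> ?D \<Longrightarrow> S_transform L t = S_transform M t * S_transform N t"
    by (auto simp: is_free_mult_conv_def)
  have eq: "stieltjes K r = stieltjes L r" if r: "0 < r" "psi K (- r) \<in> ?D" for r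
  proof -
    let ?t = "psi K (- r)"
    obtain s where s: "0 < s" "?t = psi L (- s)" using L'(3) r(2) S_domain_eq[OF L'(1,2)] by blast
    have "r / neg_eta K r = s / neg_eta L s"
      using K'(4)[OF r(2)] L'(4)[OF r(2)] S_transform_psi[OF K'(1,2) r(1)] S_transform_psi[OF L'(1,2) s(1)] s(2)
      by simp
    moreover have "neg_eta K r = neg_eta L s"
      using neg_eta_eq_psi[OF K'(1) r(1)] neg_eta_eq_psi[OF L'(1) s(1)] s(2) by simp
    ultimately have "r = s" using neg_eta_pos[OF K'(1,2) r(1)] by simp
    then show ?thesis using s psi_eq_stieltjes[OF K'(1), of r] psi_eq_stieltjes[OF L'(1), of r] by simp
  qed
  \<comment> \<open>All of [t0, 0) lies in both domains, and \<open>psi K (- r)\<close> enters this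
    interval as r tends to 0.\<close>
  define t0 where "t0 = max (psi M (- 1)) (psi N (- 1))"
  have neg: "psi M (- 1) < 0" "psi N (- 1) < 0"
    using psi_in_S_domain[OF M M0, of 1] psi_in_S_domain[OF N N0, of 1] by (auto simp: S_domain_def)
  have D: "t \<in> ?D" if "t0 \<le> t" "t < 0" for t
    using that psi_in_S_domain[OF M M0, of 1] psi_in_S_domain[OF N N0, of 1]
    by (auto simp: t0_def intro: S_domain_mono)
  have "t0 < 0" using neg by (simp add: t0_def)
  then have "eventually (\<lambda>r. 1 + t0 < stieltjes K r) (at_right 0)"
    using order_tendstoD(1)[OF stieltjes_tendsto_zero[OF K'(1)], of "1 + t0"] by simp
  then obtain d where d: "0 < d" "\<And>r. 0 < r \<Longrightarrow> r < d \<Longrightarrow> 1 + t0 < stieltjes K r"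
    unfolding eventually_at_right_field by auto
  show ?thesis
  proof (rule stieltjes_unique[OF K'(1) L'(1) d(1)])
    fix r assume r: "0 < r" "r < d"
    have "psi K (- r) \<in> ?D"
    proof (rule D)
      show "t0 \<le> psi K (- r)" using d(2)[OF r] psi_eq_stieltjes[OF K'(1), of r] r by simp
      show "psi K (- r) < 0" using psi_in_S_domain[OF K'(1,2) r(1)] by (simp add: S_domain_def)
    qed
    then show "stieltjes K r = stieltjes L r" by (rule eq[OF r(1)])
  qed
qed

text \<open>At a common value h of \<open>neg_eta\<close>, attained at a for \<open>M\<close> and at
  b for \<open>N\<close>, the product of the S-transforms is (a / h) * (b / h). It equals x / h
  precisely for x = a * b / h, so \<open>K\<close> has to take the value h there.\<close>

lemma free_mult_conv_eqI:
  assumes M: "M \<in> prob_nonneg" "M \<noteq> dirac 0" and N: "N \<in> prob_nonneg" "N \<noteq> dirac 0"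
    and K: "K \<in> prob_nonneg"
    and eq: "\<And>a b. 0 < a \<Longrightarrow> 0 < b \<Longrightarrow> neg_eta M a = neg_eta N b \<Longrightarrow>
               neg_eta K (a * b / neg_eta M a) = neg_eta M a"
  shows "M \<boxtimes> N = K"
proof -
  let ?D = "S_domain M \<inter> S_domain N"
  have key: "0 < neg_eta K x \<and> t \<in> S_domain K \<and> S_transform K t = S_transform M t * S_transform N t"
    if t: "t \<in> ?D" and a: "0 < a" "t = psi M (- a)" and b: "0 < b" "t = psi N (- b)"
      and x: "x = a * b / neg_eta M a" and K0: "K \<noteq> dirac 0" for t a b x
  proof -
    have ab: "neg_eta M a = neg_eta N b"
      using neg_eta_eq_psi[OF M(1) a(1)] neg_eta_eq_psi[OF N(1) b(1)] a(2) b(2) by simp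
    have h: "0 < neg_eta M a" by (rule neg_eta_pos[OF M a(1)])
    have x0: "0 < x" using a b h x by simp
    have Kx: "neg_eta K x = neg_eta M a" unfolding x by (rule eq[OF a(1) b(1) ab])
    have "stieltjes K x = stieltjes M a" unfolding stieltjes_eq_neg_eta Kx ..
    then have tK: "t = psi K (- x)"
      using psi_eq_stieltjes[OF K, of x] psi_eq_stieltjes[OF M(1), of a] a x0 by simp
    have "S_transform K t = x / neg_eta M a"
      unfolding tK S_transform_psi[OF K K0 x0] Kx ..
    also have "\<dots> = (a / neg_eta M a) * (b / neg_eta N b)" unfolding x ab by simp
    also have "\<dots> = S_transform M t * S_transform N t"
      using S_transform_psi[OF M a(1)] S_transform_psi[OF N b(1)] a(2) b(2) by simp
    finally show ?thesis using Kx h psi_in_S_domain[OF K K0 x0] tK by simp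
  qed
  have obt: "\<exists>a b. 0 < a \<and> t = psi M (- a) \<and> 0 < b \<and> t = psi N (- b)" if "t \<in> ?D" for t
    using that S_domain_eq[OF M] S_domain_eq[OF N] by blast
  \<comment> \<open>At \<open>t0\<close> both measures have preimages, so \<open>eq\<close> forces a
    positive value of \<open>neg_eta K\<close>, whereas it is identically 0 for
    \<open>dirac 0\<close>.\<close>
  have K0: "K \<noteq> dirac 0"
  proof
    assume K0: "K = dirac 0"
    define t0 where "t0 = max (psi M (- 1)) (psi N (- 1))"
    have mem: "psi M (- 1) \<in> S_domain M" "psi N (- 1) \<in> S_domain N"
      using psi_in_S_domain[OF M, of 1] psi_in_S_domain[OF N, of 1] by auto
    then have "psi M (- 1) < 0" "psi N (- 1) < 0" by (auto simp: S_domain_def)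
    then have "t0 \<in> ?D" using mem by (auto simp: t0_def intro: S_domain_mono)
    then obtain a b where ab: "0 < a" "t0 = psi M (- a)" "0 < b" "t0 = psi N (- b)" using obt by blast
    then have "neg_eta M a = neg_eta N b"
      using neg_eta_eq_psi[OF M(1)] neg_eta_eq_psi[OF N(1)] by simp
    then have "neg_eta K (a * b / neg_eta M a) = neg_eta M a" using eq ab by blast
    moreover have "neg_eta K (a * b / neg_eta M a) = 0"
      unfolding K0 neg_eta_def stieltjes_dirac by simp
    ultimately show False using neg_eta_pos[OF M ab(1)] by simp
  qed
  have "is_free_mult_conv M N K"
    unfolding is_free_mult_conv_def
  proof (intro conjI K)
    have "t \<in> S_domain K \<and> S_transform K t = S_transform M t * S_transform N t" if t: "t \<in> ?D" for t
      using obt[OF t] key[OF t] K0 by blast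
    then show "if M = dirac 0 \<or> N = dirac 0 then K = dirac 0
      else K \<noteq> dirac 0 \<and> ?D \<subseteq> S_domain K \<and> (\<forall>t\<in>?D. S_transform K t = S_transform M t * S_transform N t)"
      using M(2) N(2) K0 by auto
  qed
  then show ?thesis unfolding free_mult_conv_def
    using free_mult_conv_unique[OF M(1) N(1)] by (intro the_equality) auto
qed

lemma free_mult_conv_dirac_zero: "M \<boxtimes> dirac 0 = dirac 0"
  unfolding free_mult_conv_def
  by (rule the_equality) (auto simp: is_free_mult_conv_def dirac_prob_nonneg)

lemma neg_eta_dirac_one: "0 < r \<Longrightarrow> neg_eta (dirac 1) r = r"
  by (simp add: neg_eta_def stieltjes_dirac)

text \<open>At the common value h r the arguments are r^n * h r and r * h r; their product divided
  by h r is r^(n+1) * h r, the argument belonging to \<open>K (Suc n)\<close>.\<close>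

lemma free_mult_power_eq:
  assumes h: "cbf h" "\<And>x. 0 < x \<Longrightarrow> 0 < h x"
    and K: "\<And>n. K n \<in> prob_nonneg" "\<And>n r. 0 < r \<Longrightarrow> neg_eta (K n) (r ^ n * h r) = h r"
    and K0: "K 0 = dirac 1"
  shows "free_mult_power (K 1) n = K n"
proof (induction n)
  case (Suc n)
  have nz: "K n \<noteq> dirac 0" for n
  proof
    assume "K n = dirac 0"
    then have "neg_eta (K n) (1 ^ n * h 1) = 0" by (simp add: neg_eta_def stieltjes_dirac)
    then show False using K(2)[of 1 n] h(2)[of 1] by simp
  qed
  have "K n \<boxtimes> K 1 = K (Suc n)"
  proof (rule free_mult_conv_eqI[OF K(1) nz K(1) nz K(1)])
    fix a b assume a: "0 < a" and b: "0 < b" and ab: "neg_eta (K n) a = neg_eta (K 1) b"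
    obtain r where r: "0 < r" "r ^ 1 * h r = b"
      by (rule power_mult_cbf_surj[OF h zero_less_one b]) (assumption, rule that)
    have hr: "neg_eta (K n) a = h r" using K(2)[OF r(1), of 1] r(2) ab by simp
    have pos: "0 < r ^ n * h r" using r(1) h(2) by simp
    have "a = r ^ n * h r"
      using neg_eta_strict_mono[OF K(1) nz, of a "r ^ n * h r" n] neg_eta_strict_mono[OF K(1) nz, of "r ^ n * h r" a n]
        hr K(2)[OF r(1), of n] a pos by (cases a "r ^ n * h r" rule: linorder_cases) auto
    then have "a * b / neg_eta (K n) a = r ^ Suc n * h r"
      using r h(2)[OF r(1)] hr by simp
    then show "neg_eta (K (Suc n)) (a * b / neg_eta (K n) a) = neg_eta (K n) a"
      using K(2)[OF r(1), of "Suc n"] hr by simp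
  qed
  then show ?case using Suc by simp
qed (simp add: K0)

lemma free_mult_powers_exist:
  assumes M: "M \<in> prob_nonneg" "M \<noteq> dirac 0"
  obtains K where "\<And>n. K n \<in> prob_nonneg" "K 0 = dirac 1"
    "\<And>n r. 0 < r \<Longrightarrow> neg_eta (K n) (r ^ n * neg_eta M r) = neg_eta M r"
proof -
  let ?h = "neg_eta M"
  have h: "cbf ?h" "(?h \<longlongrightarrow> 0) (at_right 0)" using cbf_neg_eta[OF M(1)] by auto
  have pos: "0 < ?h x" if "0 < x" for x by (rule neg_eta_pos[OF M that])
  \<comment> \<open>For n = 0 the equation asks for the identity on the values of
    \<open>neg_eta M\<close>; \<open>dirac 1\<close> is selected explicitly to match the base case
    of \<open>free_mult_power\<close>.\<close>
  have ex: "\<exists>K. K \<in> prob_nonneg \<and> (\<forall>r>0. neg_eta K (r ^ n * ?h r) = ?h r) \<and> (n = 0 \<longrightarrow> K = dirac 1)" for n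
  proof (cases "n = 0")
    case True
    then show ?thesis using neg_eta_dirac_one pos dirac_prob_nonneg[of 1] by auto
  next
    case False
    then have n: "0 < n" by simp
    obtain H where H: "cbf H" "\<And>x. 0 < x \<Longrightarrow> 0 < H x" "(H \<longlongrightarrow> 0) (at_right 0)"
      "\<And>r. 0 < r \<Longrightarrow> H (r ^ n * ?h r) = ?h r"
      by (rule cbf_power_subordinate[OF h(1) pos h(2) n]) (assumption, rule that)
    obtain K where K: "K \<in> prob_nonneg" "\<And>r. 0 < r \<Longrightarrow> neg_eta K r = H r"
      by (rule prob_nonneg_of_neg_eta[OF H(1,3)]) (rule that)
    have "neg_eta K (r ^ n * ?h r) = ?h r" if "0 < r" for r
      using K(2)[of "r ^ n * ?h r"] H(4)[OF that] pos[OF that] that by simp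
    then show ?thesis using K(1) n by blast
  qed
  define K where "K n = (SOME K. K \<in> prob_nonneg \<and> (\<forall>r>0. neg_eta K (r ^ n * ?h r) = ?h r) \<and> (n = 0 \<longrightarrow> K = dirac 1))" for n
  have K: "K n \<in> prob_nonneg \<and> (\<forall>r>0. neg_eta (K n) (r ^ n * ?h r) = ?h r) \<and> (n = 0 \<longrightarrow> K n = dirac 1)" for n
    unfolding K_def by (rule someI_ex[OF ex])
  show ?thesis by (rule that[of K]) (use K in auto)
qed

section \<open>The Marchenko--Pastur law\<close>


definition mp_density :: "real \<Rightarrow> real" where
  "mp_density x = sqrt (x * (4 - x)) / (2 * pi * x)"

text \<open>The factor 1 + (c^2 - 1) / 4 * x is 1 for c = 1 and 1 + r x for c =
  \<open>sqrt (1 + 4 * r)\<close>. These two cases yield the primitives for the total mass and for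
  the Stieltjes integral.\<close>

lemma arctan_sqrt_ratio_deriv:
  assumes x: "0 < x" "x < 4"
  shows "((\<lambda>x. arctan (c * sqrt (x / (4 - x)))) has_real_derivative
            c / (2 * sqrt (x * (4 - x)) * (1 + (c\<^sup>2 - 1) / 4 * x))) (at x)"
proof -
  define p q where "p = sqrt x" and "q = sqrt (4 - x)"
  have p: "0 < p" "x = p\<^sup>2" and q: "0 < q" "4 - x = q\<^sup>2" using x by (auto simp: p_def q_def)
  have w: "sqrt (x / (4 - x)) = p / q" by (simp add: p_def q_def real_sqrt_divide)
  have s: "sqrt (x * (4 - x)) = p * q" by (simp add: p_def q_def real_sqrt_mult)
  have pos: "0 < x / (4 - x)" using x by simp
  have "((\<lambda>x. arctan (c * sqrt (x / (4 - x)))) has_real_derivative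
      inverse (1 + (c * sqrt (x / (4 - x)))\<^sup>2) * (c * (inverse (sqrt (x / (4 - x))) / 2 *
        ((1 * (4 - x) - x * (0 - 1)) / ((4 - x) * (4 - x)))))) (at x)"
  proof -
    have "((\<lambda>x. x / (4 - x)) has_real_derivative (1 * (4 - x) - x * (0 - 1)) / ((4 - x) * (4 - x))) (at x)"
      by (intro DERIV_divide DERIV_diff DERIV_ident DERIV_const) (use x in simp)
    then have "((\<lambda>x. sqrt (x / (4 - x))) has_real_derivative inverse (sqrt (x / (4 - x))) / 2 *
        ((1 * (4 - x) - x * (0 - 1)) / ((4 - x) * (4 - x)))) (at x)"
      by (rule DERIV_chain2[where f=sqrt and g="\<lambda>x. x / (4 - x)", OF DERIV_real_sqrt[OF pos]])
    then show ?thesis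
      by (intro DERIV_chain2[where f=arctan and g="\<lambda>x. c * sqrt (x / (4 - x))", OF DERIV_arctan] DERIV_cmult)
  qed
  moreover have "inverse (1 + (c * sqrt (x / (4 - x)))\<^sup>2) * (c * (inverse (sqrt (x / (4 - x))) / 2 *
        ((1 * (4 - x) - x * (0 - 1)) / ((4 - x) * (4 - x)))))
      = c / (2 * sqrt (x * (4 - x)) * (1 + (c\<^sup>2 - 1) / 4 * x))"
  proof -
    define d where "d = q\<^sup>2 + c\<^sup>2 * p\<^sup>2"
    have d: "0 < d" unfolding d_def using q by (intro add_pos_nonneg) auto
    have 1: "1 + (c * (p / q))\<^sup>2 = d / q\<^sup>2"
      using q by (simp add: d_def power_mult_distrib power_divide add_divide_distrib)
    have 2: "1 + (c\<^sup>2 - 1) / 4 * x = d / 4"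
      using p(2) q(2) by (simp add: d_def field_simps)
    have 3: "1 * (4 - x) - x * (0 - 1) = (4::real)" by simp
    show ?thesis unfolding w s unfolding 1 2 3 unfolding q(2)
      using p(1) q(1) d by (simp add: field_simps power2_eq_square)
  qed
  ultimately show ?thesis by simp
qed

lemma sqrt_ratio_at_zero: "((\<lambda>x::real. arctan (c * sqrt (x / (4 - x)))) \<longlongrightarrow> 0) (at_right 0)"
proof -
  have "((\<lambda>x::real. arctan (c * sqrt (x / (4 - x)))) \<longlongrightarrow> arctan (c * sqrt (0 / (4 - 0)))) (at_right 0)"
    by (intro tendsto_intros) auto
  then show ?thesis by simp
qed

lemma sqrt_ratio_at_four:
  assumes c: "0 < c" shows "((\<lambda>x::real. arctan (c * sqrt (x / (4 - x)))) \<longlongrightarrow> pi / 2) (at_left 4)"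
proof -
  have "filterlim (\<lambda>x::real. inverse (4 - x)) at_top (at_left 4)"
  proof (rule filterlim_inverse_at_top)
    have "((\<lambda>x::real. 4 - x) \<longlongrightarrow> 4 - 4) (at_left 4)" by (intro tendsto_intros)
    then show "((\<lambda>x::real. 4 - x) \<longlongrightarrow> 0) (at_left 4)" by simp
    show "eventually (\<lambda>x::real. 0 < 4 - x) (at_left 4)"
      unfolding eventually_at_left_field by (intro exI[of _ 0]) auto
  qed
  then have "filterlim (\<lambda>x::real. x * inverse (4 - x)) at_top (at_left 4)"
    by (rule filterlim_tendsto_pos_mult_at_top[OF tendsto_ident_at, of 4, simplified])
  then have "filterlim (\<lambda>x::real. sqrt (x / (4 - x))) at_top (at_left 4)"
    unfolding divide_inverse by (rule filterlim_compose[OF sqrt_at_top])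
  then have "filterlim (\<lambda>x::real. c * sqrt (x / (4 - x))) at_top (at_left 4)"
    by (rule filterlim_tendsto_pos_mult_at_top[OF tendsto_const c])
  then show ?thesis by (rule filterlim_compose[OF tendsto_arctan_at_top])
qed

lemma mp_density_eq:
  assumes x: "0 < x" "x < 4" shows "mp_density x = (4 - x) / (2 * pi * sqrt (x * (4 - x)))"
proof -
  have p: "0 < x * (4 - x)" using x by simp
  then have "sqrt (x * (4 - x)) * sqrt (x * (4 - x)) = x * (4 - x)" by simp
  then have "sqrt (x * (4 - x)) / x = (4 - x) / sqrt (x * (4 - x))"
    using x p by (simp add: frac_eq_eq mult.commute)
  then have "sqrt (x * (4 - x)) / x / (2 * pi) = (4 - x) / sqrt (x * (4 - x)) / (2 * pi)" by simp
  then show ?thesis unfolding mp_density_def divide_divide_eq_left by (simp only: mult_ac)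
qed

text \<open>Improper form of the fundamental theorem: the density is unbounded at 0 and the
  primitives are differentiated only inside (0, 4), so the endpoints enter through limits.\<close>

lemma mp_interval_integral:
  fixes F g :: "real \<Rightarrow> real"
  assumes D: "\<And>x. 0 < x \<Longrightarrow> x < 4 \<Longrightarrow> (F has_real_derivative g x) (at x)"
    and cont: "\<And>x. 0 < x \<Longrightarrow> x < 4 \<Longrightarrow> isCont g x"
    and nn: "\<And>x. 0 < x \<Longrightarrow> x < 4 \<Longrightarrow> 0 \<le> g x"
    and lim: "(F \<longlongrightarrow> A) (at_right 0)" "(F \<longlongrightarrow> B) (at_left 4)"
  shows "set_integrable lborel {0<..<4} g" "(LINT x:{0<..<4}|lborel. g x) = B - A"
proof -
  have le: "ereal 0 < ereal 4" by simp
  have iv: "einterval (ereal 0) (ereal 4) = {0<..<4}" by (rule einterval_eq_Icc)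
  have A: "((F \<circ> real_of_ereal) \<longlongrightarrow> A) (at_right (ereal 0))"
    using lim(1) by (simp only: ereal_tendsto_simps)
  have B: "((F \<circ> real_of_ereal) \<longlongrightarrow> B) (at_left (ereal 4))"
    using lim(2) by (simp only: ereal_tendsto_simps)
  have AE: "AE x in lborel. ereal 0 < ereal x \<longrightarrow> ereal x < ereal 4 \<longrightarrow> 0 \<le> g x"
    using nn by (intro AE_I2) auto
  have D': "(F has_real_derivative g x) (at x)" if "ereal 0 < ereal x" "ereal x < ereal 4" for x
    using that by (intro D) auto
  have c': "isCont g x" if "ereal 0 < ereal x" "ereal x < ereal 4" for x
    using that by (intro cont) auto
  show "set_integrable lborel {0<..<4} g"
    using interval_integral_FTC_nonneg(1)[OF le D' c' AE A B] unfolding iv .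
  have "(LBINT x=ereal 0..ereal 4. g x) = B - A"
    by (rule interval_integral_FTC_nonneg(2)[OF le D' c' AE A B])
  then show "(LINT x:{0<..<4}|lborel. g x) = B - A"
    by (simp only: interval_lebesgue_integral_def le less_imp_le if_True iv)
qed

lemma isCont_mp_density:
  assumes "0 < x" "x < 4" "0 \<le> r" shows "isCont (\<lambda>x. mp_density x / (1 + r * x)) x"
proof -
  have "1 + r * x \<noteq> 0" using assms by (metis add_pos_nonneg less_imp_le less_irrefl mult_nonneg_nonneg zero_less_one)
  then show ?thesis
    unfolding mp_density_def by (intro continuous_intros) (use assms in auto)
qed

lemma mp_density_nonneg: "0 < x \<Longrightarrow> x < 4 \<Longrightarrow> 0 \<le> mp_density x"
  by (simp add: mp_density_def)

lemma mp_density_integral: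
  shows "set_integrable lborel {0<..<4} mp_density" "(LINT x:{0<..<4}|lborel. mp_density x) = 1"
proof -
  define F where "F x = 2 / pi * arctan (1 * sqrt (x / (4 - x))) + sqrt (x * (4 - x)) / (2 * pi)" for x
  have D: "(F has_real_derivative mp_density x) (at x)" if x: "0 < x" "x < 4" for x
  proof -
    have pos: "0 < x * (4 - x)" using x by simp
    define s where "s = sqrt (x * (4 - x))"
    have s: "0 < s" using pos by (simp add: s_def)
    have "((\<lambda>x. sqrt (x * (4 - x))) has_real_derivative inverse s / 2 * (1 * (4 - x) + (0 - 1) * x)) (at x)"
      unfolding s_def
      by (intro DERIV_chain2[where f=sqrt and g="\<lambda>x. x * (4 - x)", OF DERIV_real_sqrt[OF pos]]
          DERIV_mult DERIV_ident DERIV_diff DERIV_const)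
    then have "(F has_real_derivative 2 / pi * (1 / (2 * s * (1 + (1\<^sup>2 - 1) / 4 * x)))
        + inverse s / 2 * (1 * (4 - x) + (0 - 1) * x) / (2 * pi)) (at x)"
      unfolding F_def s_def by (intro DERIV_add DERIV_cmult DERIV_cdivide arctan_sqrt_ratio_deriv x)
    moreover have "2 / pi * (1 / (2 * s * (1 + (1\<^sup>2 - 1) / 4 * x)))
        + inverse s / 2 * (1 * (4 - x) + (0 - 1) * x) / (2 * pi) = mp_density x"
      unfolding mp_density_eq[OF x] s_def[symmetric] using s by (simp add: field_simps)
    ultimately show ?thesis by simp
  qed
  have c: "isCont mp_density x" if "0 < x" "x < 4" for x
    using isCont_mp_density[OF that, of 0] by simp
  have lim0: "(F \<longlongrightarrow> 2 / pi * 0 + sqrt (0 * (4 - 0)) / (2 * pi)) (at_right 0)"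
    unfolding F_def by (intro tendsto_intros sqrt_ratio_at_zero) auto
  have lim4: "(F \<longlongrightarrow> 2 / pi * (pi / 2) + sqrt (4 * (4 - 4)) / (2 * pi)) (at_left 4)"
    unfolding F_def by (intro tendsto_intros sqrt_ratio_at_four) auto
  show "set_integrable lborel {0<..<4} mp_density" "(LINT x:{0<..<4}|lborel. mp_density x) = 1"
    using mp_interval_integral[OF D c mp_density_nonneg lim0 lim4] by simp_all
qed

lemma mp_stieltjes_integral:
  assumes r: "0 < r"
  shows "(LINT x:{0<..<4}|lborel. mp_density x / (1 + r * x)) = (sqrt (1 + 4 * r) - 1) / (2 * r)"
proof -
  \<comment> \<open>With this c, r * (4 - x) = c^2 - (1 + r x), which splits the integrand into the
    two derivatives of arctan terms combined in \<open>F\<close>.\<close>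
  define c where "c = sqrt (1 + 4 * r)"
  have c: "0 < c" "c\<^sup>2 = 1 + 4 * r" using r by (auto simp: c_def)
  define F where "F x = 1 / (pi * r) * (c * arctan (c * sqrt (x / (4 - x))) - arctan (1 * sqrt (x / (4 - x))))" for x
  have D: "(F has_real_derivative mp_density x / (1 + r * x)) (at x)" if x: "0 < x" "x < 4" for x
  proof -
    have pos: "0 < x * (4 - x)" using x by simp
    define s where "s = sqrt (x * (4 - x))"
    have s: "0 < s" using pos by (simp add: s_def)
    define d where "d = 1 + r * x"
    have d: "0 < d" using r x by (simp add: d_def add_pos_pos)
    have "(F has_real_derivative 1 / (pi * r) * (c * (c / (2 * s * (1 + (c\<^sup>2 - 1) / 4 * x)))
        - 1 / (2 * s * (1 + (1\<^sup>2 - 1) / 4 * x)))) (at x)"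
      unfolding F_def s_def by (intro DERIV_diff DERIV_cmult arctan_sqrt_ratio_deriv x)
    moreover have "1 / (pi * r) * (c * (c / (2 * s * (1 + (c\<^sup>2 - 1) / 4 * x)))
        - 1 / (2 * s * (1 + (1\<^sup>2 - 1) / 4 * x))) = mp_density x / (1 + r * x)"
    proof -
      have "1 + (c\<^sup>2 - 1) / 4 * x = d" using c(2) by (simp add: d_def)
      then have "1 / (pi * r) * (c * (c / (2 * s * (1 + (c\<^sup>2 - 1) / 4 * x))) - 1 / (2 * s * (1 + (1\<^sup>2 - 1) / 4 * x)))
          = 1 / (pi * r) * (c\<^sup>2 / (2 * s * d) - 1 / (2 * s))" by (simp add: power2_eq_square)
      also have "\<dots> = (c\<^sup>2 - d) / (2 * pi * r * s * d)" using s d r by (simp add: field_simps)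
      also have "c\<^sup>2 - d = r * (4 - x)" unfolding c(2) d_def by (simp add: algebra_simps)
      also have "r * (4 - x) / (2 * pi * r * s * d) = (4 - x) / (2 * pi * s) / d" using r by simp
      finally show ?thesis unfolding mp_density_eq[OF x] s_def[symmetric] d_def .
    qed
    ultimately show ?thesis by simp
  qed
  have cont: "isCont (\<lambda>x. mp_density x / (1 + r * x)) x" if "0 < x" "x < 4" for x
    using isCont_mp_density[OF that, of r] r by simp
  have nn: "0 \<le> mp_density x / (1 + r * x)" if "0 < x" "x < 4" for x
    using mp_density_nonneg[OF that] that r by simp
  have lim0: "(F \<longlongrightarrow> 1 / (pi * r) * (c * 0 - 0)) (at_right 0)"
    unfolding F_def by (intro tendsto_intros sqrt_ratio_at_zero)
  have lim4: "(F \<longlongrightarrow> 1 / (pi * r) * (c * (pi / 2) - pi / 2)) (at_left 4)"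
    unfolding F_def by (intro tendsto_intros sqrt_ratio_at_four c) simp
  have "(LINT x:{0<..<4}|lborel. mp_density x / (1 + r * x))
      = 1 / (pi * r) * (c * (pi / 2) - pi / 2) - 1 / (pi * r) * (c * 0 - 0)"
    by (rule mp_interval_integral(2)[OF D cont nn lim0 lim4])
  also have "\<dots> = (c - 1) / (2 * r)" using r by (simp add: field_simps)
  finally show ?thesis by (simp add: c_def)
qed

lemma marchenko_pastur_density:
  "marchenko_pastur = density lborel (\<lambda>x. ennreal (mp_density x * indicator {0<..<4} x))"
  by (simp add: marchenko_pastur_def mp_density_def)

lemma mp_density_measurable: "mp_density \<in> borel_measurable borel"
  unfolding mp_density_def[abs_def] by measurable

lemma mp_density_indicator_nonneg: "0 \<le> mp_density x * indicator {0<..<4} x"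
  using mp_density_nonneg[of x] by (simp add: indicator_def)

lemma marchenko_pastur_AE: "AE x in marchenko_pastur. 0 < x"
  unfolding marchenko_pastur_density
  by (subst AE_density) (use mp_density_measurable in \<open>auto simp: indicator_def\<close>)

lemma marchenko_pastur_prob_nonneg: "marchenko_pastur \<in> prob_nonneg"
  unfolding prob_nonneg_def
proof (intro CollectI conjI)
  show "prob_space marchenko_pastur"
  proof (rule prob_spaceI)
    have "emeasure marchenko_pastur (space marchenko_pastur)
        = (\<integral>\<^sup>+ x. ennreal (mp_density x * indicator {0<..<4} x) \<partial>lborel)"
      unfolding marchenko_pastur_density using mp_density_measurable
      by (subst emeasure_density) (auto intro!: nn_integral_cong)
    also have "\<dots> = ennreal (LINT x|lborel. mp_density x * indicator {0<..<4} x)"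
      using mp_density_integral(1) mp_density_indicator_nonneg
      by (intro nn_integral_eq_integral) (auto simp: set_integrable_def mult.commute)
    also have "\<dots> = 1"
      using mp_density_integral(2) by (simp add: set_lebesgue_integral_def mult.commute)
    finally show "emeasure marchenko_pastur (space marchenko_pastur) = 1" .
  qed
  show "sets marchenko_pastur = sets borel" by (simp add: marchenko_pastur_density)
  show "AE x in marchenko_pastur. 0 \<le> x"
    using marchenko_pastur_AE by eventually_elim simp
qed

lemma stieltjes_marchenko_pastur:
  assumes r: "0 < r" shows "stieltjes marchenko_pastur r = (sqrt (1 + 4 * r) - 1) / (2 * r)"
proof -
  have "stieltjes marchenko_pastur r = (LINT x|lborel. (mp_density x * indicator {0<..<4} x) * (1 / (1 + r * x)))"
    unfolding stieltjes_def marchenko_pastur_density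
    using mp_density_measurable mp_density_indicator_nonneg by (subst integral_real_density) auto
  also have "\<dots> = (LINT x:{0<..<4}|lborel. mp_density x / (1 + r * x))"
    unfolding set_lebesgue_integral_def by (intro Bochner_Integration.integral_cong) (auto simp: indicator_def)
  finally show ?thesis using mp_stieltjes_integral[OF r] by simp
qed

section \<open>Transforms of the Marchenko-Pastur law and its inverse\<close>

text \<open>In other words r / h = 1 + h, which is the familiar S-transform 1 / (1 + t). The
  positive root is h = (c - 1) / 2 with c = \<open>sqrt (1 + 4 * r)\<close>.\<close>

lemma neg_eta_marchenko_pastur:
  assumes r: "0 < r"
  shows "r = neg_eta marchenko_pastur r * (1 + neg_eta marchenko_pastur r)" "0 < neg_eta marchenko_pastur r"
proof -
  define c where "c = sqrt (1 + 4 * r)"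
  have c2: "c * c = 1 + 4 * r" using r by (simp add: c_def)
  have c1: "1 < c" using r by (simp add: c_def)
  have "1 / stieltjes marchenko_pastur r = 2 * r / (c - 1)"
    unfolding stieltjes_marchenko_pastur[OF r] c_def by simp
  also have "\<dots> = (c + 1) / 2" using c1 c2 by (simp add: field_simps)
  finally have h: "neg_eta marchenko_pastur r = (c - 1) / 2" by (simp add: neg_eta_def field_simps)
  show "r = neg_eta marchenko_pastur r * (1 + neg_eta marchenko_pastur r)"
    unfolding h using c2 by (simp add: field_simps)
  show "0 < neg_eta marchenko_pastur r" unfolding h using c1 by simp
qed

lemma neg_eta_pos_imp_nonzero: "0 < neg_eta M r \<Longrightarrow> M \<noteq> dirac 0"
  by (auto simp: neg_eta_def stieltjes_dirac)

lemma push_powr_prob_nonneg: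
  assumes "M \<in> prob_nonneg" shows "push_powr M a \<in> prob_nonneg"
proof -
  have f: "(\<lambda>x. x powr a) \<in> borel_measurable M"
    using prob_nonnegD(2)[OF assms] by (simp cong: measurable_cong_sets)
  have "AE x in distr M borel (\<lambda>x. x powr a). 0 \<le> x"
    using f by (subst AE_distr_iff) auto
  then show ?thesis
    using prob_space.prob_space_distr[OF prob_nonnegD(1)[OF assms] f]
    unfolding prob_nonneg_def push_powr_def by simp
qed

text \<open>Because 1 / (1 + r / x) = 1 - 1 / (1 + x / r), inversion replaces the transform G at r
  by 1 - G at 1 / r. This turns 1 / (1 + h) into h / (1 + h), whose \<open>neg_eta\<close> is 1 /
  h.\<close>

lemma neg_eta_inverse_marchenko_pastur:
  assumes r: "0 < r"
  shows "neg_eta (push_powr marchenko_pastur (-1)) r = 1 / neg_eta marchenko_pastur (1 / r)"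
proof -
  let ?M = marchenko_pastur
  interpret prob_space ?M using prob_nonnegD[OF marchenko_pastur_prob_nonneg] by simp
  have s: "sets ?M = sets borel" using prob_nonnegD[OF marchenko_pastur_prob_nonneg] by simp
  have "stieltjes (push_powr ?M (-1)) r = (LINT x|?M. 1 / (1 + r * x powr -1))"
    unfolding stieltjes_def push_powr_def using s
    by (intro integral_distr) (simp_all cong: measurable_cong_sets)
  also have "\<dots> = (LINT x|?M. 1 - 1 / (1 + (1 / r) * x))"
  proof (rule integral_cong_AE)
    show "AE x in ?M. 1 / (1 + r * x powr -1) = 1 - 1 / (1 + (1 / r) * x)"
      using marchenko_pastur_AE
    proof eventually_elim
      case (elim x)
      have "x powr -1 = 1 / x" using elim by (simp add: powr_minus_divide)
      moreover have "0 < x + r" using elim r by simp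
      moreover have "1 + r * (1 / x) = (x + r) / x" "1 + (1 / r) * x = (x + r) / r"
        using elim r by (simp_all add: field_simps)
      ultimately show ?case using elim by (simp add: field_simps)
    qed
  qed (use s in \<open>simp_all cong: measurable_cong_sets\<close>)
  also have "\<dots> = 1 - stieltjes ?M (1 / r)"
    unfolding stieltjes_def using integrable_stieltjes[OF marchenko_pastur_prob_nonneg, of "1 / r"] r
    by (subst Bochner_Integration.integral_diff) (auto simp: prob_space)
  finally have 1: "stieltjes (push_powr ?M (-1)) r = 1 - stieltjes ?M (1 / r)" .
  define h where "h = neg_eta ?M (1 / r)"
  have h: "0 < h" unfolding h_def using neg_eta_marchenko_pastur(2) r by simp
  have "stieltjes ?M (1 / r) = 1 / (1 + h)" by (simp add: stieltjes_eq_neg_eta h_def)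
  then have "1 - stieltjes ?M (1 / r) = h / (1 + h)" using h by (simp add: field_simps)
  then have "neg_eta (push_powr ?M (-1)) r = (1 + h) / h - 1"
    unfolding neg_eta_def[of "push_powr ?M (-1)"] 1 by simp
  then show ?thesis unfolding h_def[symmetric] using h by (simp add: field_simps)
qed

text \<open>At the common value h the arguments are b = h * (1 + h) and a = h^2 / (1 + h), so a * b
  / h = h^2, and \<open>neg_eta B\<close> must send h^2 to h.\<close>

lemma inverse_mp_conv_mp:
  assumes B: "B \<in> prob_nonneg" "\<And>r. 0 < r \<Longrightarrow> neg_eta B r = sqrt r"
  shows "push_powr marchenko_pastur (-1) \<boxtimes> marchenko_pastur = B"
proof (rule free_mult_conv_eqI)
  show "marchenko_pastur \<noteq> dirac 0" "push_powr marchenko_pastur (-1) \<noteq> dirac 0"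
    using neg_eta_pos_imp_nonzero[of _ 1] neg_eta_marchenko_pastur(2)[of 1]
      neg_eta_inverse_marchenko_pastur[of 1] by auto
  fix a b :: real
  assume a: "0 < a" and b: "0 < b"
    and eq: "neg_eta (push_powr marchenko_pastur (-1)) a = neg_eta marchenko_pastur b"
  define h where "h = neg_eta marchenko_pastur b"
  have h: "0 < h" "b = h * (1 + h)" using neg_eta_marchenko_pastur[OF b] by (auto simp: h_def)
  have "h = 1 / neg_eta marchenko_pastur (1 / a)"
    using eq neg_eta_inverse_marchenko_pastur[OF a] by (simp add: h_def)
  then have "neg_eta marchenko_pastur (1 / a) = 1 / h" by simp
  then have "1 / a = 1 / h * (1 + 1 / h)"
    using neg_eta_marchenko_pastur(1)[of "1 / a"] a by simp
  also have "\<dots> = (1 + h) / h\<^sup>2" using h(1) by (simp add: field_simps power2_eq_square)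
  finally have "a = h\<^sup>2 / (1 + h)" by (metis divide_divide_eq_left div_by_1 inverse_divide inverse_eq_divide)
  then have ab: "a * b / h = h\<^sup>2" using h by simp
  have nh: "neg_eta (push_powr marchenko_pastur (-1)) a = h" using eq by (simp add: h_def)
  show "neg_eta B (a * b / neg_eta (push_powr marchenko_pastur (-1)) a)
      = neg_eta (push_powr marchenko_pastur (-1)) a"
    unfolding nh ab using B(2)[of "h\<^sup>2"] h(1) by simp
qed (use marchenko_pastur_prob_nonneg push_powr_prob_nonneg B in auto)

lemma sqrt_prob_nonneg:
  obtains B where "B \<in> prob_nonneg" "\<And>r. 0 < r \<Longrightarrow> neg_eta B r = sqrt r"
proof (rule prob_nonneg_of_neg_eta)
  show "cbf sqrt"
    using cbf_sqrt_mult[OF cbf_ident _ cbf_const[of 1]] by simp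
  show "(sqrt \<longlongrightarrow> 0) (at_right 0)"
    using tendsto_real_sqrt[OF tendsto_ident_at, of 0] by simp
qed (rule that)

text \<open>The first convolution attains h at a = h^2; if \<open>M\<close> attains it at b, then a
  * b / h = b * h.\<close>

lemma mp_conv_eq:
  assumes M: "M \<in> prob_nonneg" "M \<noteq> dirac 0" and K: "K \<in> prob_nonneg"
    and eq: "\<And>r. 0 < r \<Longrightarrow> neg_eta K (r * neg_eta M r) = neg_eta M r"
  shows "push_powr marchenko_pastur (-1) \<boxtimes> marchenko_pastur \<boxtimes> M = K"
proof -
  obtain B where B: "B \<in> prob_nonneg" "\<And>r. 0 < r \<Longrightarrow> neg_eta B r = sqrt r"
    by (rule sqrt_prob_nonneg) (rule that)
  have "B \<boxtimes> M = K"
  proof (rule free_mult_conv_eqI[OF B(1) _ M K])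
    show "B \<noteq> dirac 0" using neg_eta_pos_imp_nonzero[of B 1] B(2)[of 1] by simp
    fix a b assume a: "0 < a" and b: "0 < b" and ab: "neg_eta B a = neg_eta M b"
    have "a = neg_eta M b * neg_eta M b" using B(2)[OF a] a ab[symmetric] by simp
    then have "a * b / neg_eta B a = b * neg_eta M b"
      using neg_eta_pos[OF M b] ab by simp
    then show "neg_eta K (a * b / neg_eta B a) = neg_eta B a" using eq[OF b] ab by simp
  qed
  then show ?thesis using inverse_mp_conv_mp[OF B] by simp
qed

section \<open>The limit theorem\<close>


lemma prob_nonneg_measure_neg:
  assumes M: "M \<in> prob_nonneg" and A: "A \<in> sets borel" "A \<subseteq> {..<0}" shows "measure M A = 0"
proof -
  interpret real_distribution M using prob_nonnegD[OF M] by simp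
  have "AE x in M. x \<notin> A" using prob_nonnegD(4)[OF M] by eventually_elim (use A in auto)
  then show ?thesis using A by (subst (asm) AE_iff_measurable[of A]) (auto simp: measure_def)
qed

lemma cdf_neg: "M \<in> prob_nonneg \<Longrightarrow> x < 0 \<Longrightarrow> cdf M x = 0"
  unfolding cdf_def by (rule prob_nonneg_measure_neg) auto

lemma cdf_eq_measure_Icc:
  assumes M: "M \<in> prob_nonneg" and x: "0 \<le> x" shows "cdf M x = measure M {0..x}"
proof -
  interpret real_distribution M using prob_nonnegD[OF M] by simp
  have "{..x} = {..<0} \<union> {0..x}" using x by auto
  then have "measure M {..x} = measure M {..<0} + measure M {0..x}"
    by (simp only:) (rule finite_measure_Union, auto)
  then show ?thesis using prob_nonneg_measure_neg[OF M, of "{..<0}"] by (simp add: cdf_def)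
qed

lemma prob_nonneg_of_cdf:
  assumes L: "real_distribution L" and neg: "\<And>x. x < 0 \<Longrightarrow> cdf L x = 0" shows "L \<in> prob_nonneg"
proof -
  interpret real_distribution L by fact
  have "((\<lambda>x::real. 0::real) \<longlongrightarrow> measure L {..<0}) (at_left 0)"
  proof (rule Lim_transform_eventually[OF cdf_at_left])
    show "eventually (\<lambda>x. cdf L x = 0) (at_left 0)"
      unfolding eventually_at_left_field using neg by (intro exI[of _ "-1"]) auto
  qed
  then have "measure L {..<0} = 0"
    by (rule tendsto_unique[OF trivial_limit_at_left_real tendsto_const, symmetric])
  then have "{..<0} \<in> null_sets L" by (simp add: null_sets_def emeasure_eq_measure)
  then have "AE x in L. x \<notin> {..<0}" by (rule AE_not_in)
  then have "AE x in L. 0 \<le> x" by eventually_elim simp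
  then show ?thesis using prob_space_axioms M_is_borel by (simp add: prob_nonneg_def)
qed

lemma stieltjes_antimono:
  assumes M: "M \<in> prob_nonneg" and rs: "0 \<le> r" "r \<le> s" shows "stieltjes M s \<le> stieltjes M r"
proof (cases "M = dirac 0 \<or> r = s")
  case True then show ?thesis by (auto simp: stieltjes_dirac)
next
  case False then show ?thesis using stieltjes_strict_antimono[OF M, of r s] rs by simp
qed

lemma filterlim_recip_at_top: "filterlim (\<lambda>x::real. 1 / x) at_top (at_right 0)"
  using filterlim_inverse_at_top_right by (simp add: inverse_eq_divide)

lemma filterlim_recip_at_right: "filterlim (\<lambda>x::real. 1 / x) (at_right 0) at_top"
  using filterlim_inverse_at_right_top by (simp add: inverse_eq_divide)

lemma stieltjes_recip_cdf_exists:
  assumes M: "M \<in> prob_nonneg"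
  obtains L where "L \<in> prob_nonneg" "\<And>x. 0 < x \<Longrightarrow> cdf L x = stieltjes M (1 / x)"
proof -
  \<comment> \<open>At 0 the value is the right limit, the atom of \<open>M\<close>. The formula
    \<open>stieltjes M (1 / x)\<close> would give 1 there, since 1 / 0 = 0.\<close>
  define F where "F x = (if x < 0 then 0 else if x = 0 then measure M {0} else stieltjes M (1 / x))" for x
  have F_pos: "F x = stieltjes M (1 / x)" if "0 < x" for x using that by (simp add: F_def)
  have top_le: "measure M {0} \<le> stieltjes M r" if "0 \<le> r" for r
  proof (rule tendsto_upperbound[OF stieltjes_tendsto_top[OF M]])
    show "eventually (\<lambda>s. stieltjes M s \<le> stieltjes M r) at_top"
      using eventually_ge_at_top[of r] by eventually_elim (rule stieltjes_antimono[OF M that])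
  qed simp
  have mono: "F x \<le> F y" if xy: "x \<le> y" for x y
  proof -
    consider "x < 0" | "x = 0" | "0 < x" by linarith
    then show ?thesis
    proof cases
      case 1
      then show ?thesis using stieltjes_pos[OF M, of "1 / y"] by (auto simp: F_def less_imp_le)
    next
      case 2
      then show ?thesis using xy top_le[of "1 / y"] by (auto simp: F_def)
    next
      case 3
      have "1 / y \<le> 1 / x" using 3 xy by (simp add: frac_le)
      then show ?thesis using 3 xy stieltjes_antimono[OF M, of "1 / y" "1 / x"] by (simp add: F_def)
    qed
  qed
  have lim0: "((\<lambda>x. stieltjes M (1 / x)) \<longlongrightarrow> measure M {0}) (at_right 0)"
    by (rule filterlim_compose[OF stieltjes_tendsto_top[OF M] filterlim_recip_at_top])
  have right: "continuous (at_right a) F" for a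
  proof -
    consider "a < 0" | "a = 0" | "0 < a" by linarith
    then show ?thesis
    proof cases
      case 1
      have "((\<lambda>x. 0) \<longlongrightarrow> F a) (at_right a)" using 1 by (simp add: F_def)
      moreover have "eventually (\<lambda>x. 0 = F x) (at_right a)"
        unfolding eventually_at_right_field using 1 by (intro exI[of _ 0]) (auto simp: F_def)
      ultimately show ?thesis unfolding continuous_within by (rule Lim_transform_eventually)
    next
      case 2
      have "eventually (\<lambda>x. stieltjes M (1 / x) = F x) (at_right 0)"
        by (rule eventually_mono[OF eventually_at_right_less]) (simp add: F_def)
      then show ?thesis unfolding continuous_within 2
        using Lim_transform_eventually[OF lim0] by (simp add: F_def)
    next
      case 3
      have "((\<lambda>x. 1 / x) \<longlongrightarrow> 1 / a) (at_right a)" using 3 by (intro tendsto_intros) auto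
      then have "((\<lambda>x. stieltjes M (1 / x)) \<longlongrightarrow> stieltjes M (1 / a)) (at_right a)"
        using 3 by (intro isCont_tendsto_compose[OF isCont_stieltjes[OF M]]) auto
      moreover have "eventually (\<lambda>x. stieltjes M (1 / x) = F x) (at_right a)"
        by (rule eventually_mono[OF eventually_at_right_less]) (use 3 in \<open>simp add: F_def\<close>)
      ultimately have "(F \<longlongrightarrow> stieltjes M (1 / a)) (at_right a)" by (rule Lim_transform_eventually)
      then show ?thesis unfolding continuous_within using 3 by (simp add: F_pos)
    qed
  qed
  have bot: "(F \<longlongrightarrow> 0) at_bot"
  proof (rule Lim_transform_eventually[OF tendsto_const])
    show "eventually (\<lambda>x. 0 = F x) at_bot"
      using eventually_gt_at_bot[of 0] unfolding eventually_at_bot_dense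
      by (intro exI[of _ 0]) (auto simp: F_def)
  qed
  have top: "(F \<longlongrightarrow> 1) at_top"
  proof (rule Lim_transform_eventually)
    show "((\<lambda>x. stieltjes M (1 / x)) \<longlongrightarrow> 1) at_top"
      by (rule filterlim_compose[OF stieltjes_tendsto_zero[OF M] filterlim_recip_at_right])
    show "eventually (\<lambda>x. stieltjes M (1 / x) = F x) at_top"
      using eventually_gt_at_top[of 0] by eventually_elim (simp add: F_pos)
  qed
  define L where "L = interval_measure F"
  have L: "real_distribution L"
    unfolding L_def by (rule real_distribution_interval_measure[OF mono right bot top])
  have cdf: "cdf L = F"
    unfolding L_def by (rule cdf_interval_measure[OF mono right bot])
  show ?thesis
  proof (rule that)
    show "L \<in> prob_nonneg" by (rule prob_nonneg_of_cdf[OF L]) (simp add: cdf F_def)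
    show "cdf L x = stieltjes M (1 / x)" if "0 < x" for x using that by (simp add: cdf F_pos)
  qed
qed

lemma cdf_at_zero:
  assumes M: "M \<in> prob_nonneg" and L: "L \<in> prob_nonneg"
    and cdf: "\<And>x. 0 < x \<Longrightarrow> cdf L x = stieltjes M (1 / x)"
  shows "cdf L 0 = measure M {0}"
proof -
  interpret real_distribution L using prob_nonnegD[OF L] by simp
  have "((\<lambda>x. stieltjes M (1 / x)) \<longlongrightarrow> measure M {0}) (at_right 0)"
    by (rule filterlim_compose[OF stieltjes_tendsto_top[OF M] filterlim_recip_at_top])
  moreover have "eventually (\<lambda>x. stieltjes M (1 / x) = cdf L x) (at_right 0)"
    by (rule eventually_mono[OF eventually_at_right_less]) (simp add: cdf)
  ultimately have "(cdf L \<longlongrightarrow> measure M {0}) (at_right 0)" by (rule Lim_transform_eventually)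
  moreover have "(cdf L \<longlongrightarrow> cdf L 0) (at_right 0)"
    using cdf_is_right_cont[of 0] by (simp add: continuous_within)
  ultimately show ?thesis using tendsto_unique[OF trivial_limit_at_right_real] by blast
qed

section \<open>Weak convergence of the normalised free powers\<close>

lemma weak_limit_unique:
  assumes "\<And>n. real_distribution (\<mu> n)" "real_distribution L" "real_distribution L'"
    and "weak_conv_m \<mu> L" "weak_conv_m \<mu> L'"
  shows "L = L'"
proof (rule Levy_uniqueness[OF assms(2,3)])
  show "char L = char L'"
    using LIMSEQ_unique[OF levy_continuity1[OF assms(1,2,4)] levy_continuity1[OF assms(1,3,5)]]
    by (rule ext)
qed

lemma free_lln_limit_eqI:
  assumes K: "\<And>n. free_mult_power M n \<in> prob_nonneg" and L: "L \<in> prob_nonneg"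
    and w: "weak_conv_m (\<lambda>n. push_powr (free_mult_power M n) (1 / real n)) L"
  shows "free_lln_limit M = L"
  unfolding free_lln_limit_def
proof (rule the_equality)
  fix L' assume L': "L' \<in> prob_nonneg \<and> weak_conv_m (\<lambda>n. push_powr (free_mult_power M n) (1 / real n)) L'"
  show "L' = L"
  proof (rule weak_limit_unique)
    show "real_distribution (push_powr (free_mult_power M n) (1 / real n))" for n
      using prob_nonnegD(5)[OF push_powr_prob_nonneg[OF K]] .
  qed (use L L' w prob_nonnegD(5) in auto)
qed (use L w in blast)

lemma cdf_push_powr_root:
  assumes K: "K \<in> prob_nonneg" and n: "0 < n" and x: "0 < x"
  shows "cdf (push_powr K (1 / real n)) x = measure K {..x ^ n}"
proof -
  interpret real_distribution K using prob_nonnegD[OF K] by simp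
  have "cdf (push_powr K (1 / real n)) x = measure K {y. y powr (1 / real n) \<le> x}"
    unfolding cdf_def push_powr_def by (subst measure_distr) (auto simp: vimage_def)
  also have "\<dots> = measure K {..x ^ n}"
  proof (rule finite_measure_eq_AE)
    show "AE y in K. (y \<in> {y. y powr (1 / real n) \<le> x}) = (y \<in> {..x ^ n})"
      using prob_nonnegD(4)[OF K]
    proof eventually_elim
      case (elim y)
      have "y powr (1 / real n) = root n y" using elim n by (simp add: root_powr_inverse)
      moreover have "root n y \<le> x \<longleftrightarrow> root n y \<le> root n (x ^ n)"
        using x n by (simp add: real_root_power_cancel)
      ultimately show ?case using n by simp
    qed
  qed auto
  finally show ?thesis .
qed

text \<open>The integrand 1 / (1 + R y) is at least 1 / (1 + R z) on [0, z], and it is at most 1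
  there and 1 / (1 + R z) beyond. The bounds are sharp when R z is near 0 and when it is large,
  respectively.\<close>

lemma stieltjes_tail_bounds:
  assumes K: "K \<in> prob_nonneg" and R: "0 \<le> R" and z: "0 \<le> z"
  shows "measure K {..z} \<le> stieltjes K R * (1 + R * z)"
    and "stieltjes K R \<le> measure K {..z} + 1 / (1 + R * z)"
proof -
  interpret real_distribution K using prob_nonnegD[OF K] by simp
  have Rz: "0 < 1 + R * z" using R z by (intro add_pos_nonneg) auto
  have "measure K {..z} * (1 / (1 + R * z)) = (LINT y|K. indicator {..z} y * (1 / (1 + R * z)))"
    by simp
  also have "\<dots> \<le> stieltjes K R"
    unfolding stieltjes_def
  proof (rule integral_mono_AE)
    show "AE y in K. indicator {..z} y * (1 / (1 + R * z)) \<le> 1 / (1 + R * y)"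
      using prob_nonnegD(4)[OF K]
    proof eventually_elim
      case (elim y)
      show ?case
      proof (cases "y \<le> z")
        case True
        then have "R * y \<le> R * z" "0 \<le> R * y" using R elim by (auto intro: mult_left_mono)
        then show ?thesis using True by (simp add: frac_le)
      next
        case False then show ?thesis using stieltjes_integrand[OF R elim] by simp
      qed
    qed
  qed (use integrable_stieltjes[OF K R] in \<open>auto simp: emeasure_eq_measure\<close>)
  finally show "measure K {..z} \<le> stieltjes K R * (1 + R * z)"
    using Rz by (simp add: divide_le_eq)
  have "stieltjes K R \<le> (LINT y|K. indicator {..z} y + 1 / (1 + R * z))"
    unfolding stieltjes_def
  proof (rule integral_mono_AE)
    show "AE y in K. 1 / (1 + R * y) \<le> indicator {..z} y + 1 / (1 + R * z)"
      using prob_nonnegD(4)[OF K]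
    proof eventually_elim
      case (elim y)
      show ?case
      proof (cases "y \<le> z")
        case True
        have "1 / (1 + R * y) \<le> 1" "0 \<le> 1 / (1 + R * z)" using stieltjes_integrand[OF R elim] Rz by auto
        then have "1 / (1 + R * y) \<le> 1 + 1 / (1 + R * z)" by linarith
        then show ?thesis using True by simp
      next
        case False
        then have "R * z \<le> R * y" using R by (auto intro: mult_left_mono)
        then show ?thesis using False Rz by (simp add: frac_le)
      qed
    qed
  qed (use integrable_stieltjes[OF K R] in \<open>auto simp: emeasure_eq_measure\<close>)
  also have "\<dots> = measure K {..z} + 1 / (1 + R * z)"
    by (subst Bochner_Integration.integral_add) (auto simp: emeasure_eq_measure prob_space[simplified])
  finally show "stieltjes K R \<le> measure K {..z} + 1 / (1 + R * z)" .
qed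

text \<open>With R = r^n * h r and z = x^n the transform of \<open>K n\<close> at R is
  \<open>stieltjes M r\<close> for every n, while R z = h r * (r x)^n. Points r just above 1 / x
  make R z diverge and give the lower bound; points just below make it vanish and give the upper
  bound. Continuity at 1 / x closes the gap.\<close>

lemma free_powers_cdf_limit:
  assumes M: "M \<in> prob_nonneg" "M \<noteq> dirac 0" and x: "0 < x"
    and K: "\<And>n. K n \<in> prob_nonneg" "\<And>n r. 0 < r \<Longrightarrow> neg_eta (K n) (r ^ n * neg_eta M r) = neg_eta M r"
  shows "(\<lambda>n. cdf (push_powr (K n) (1 / real n)) x) \<longlonglongrightarrow> stieltjes M (1 / x)"
proof -
  let ?c = "\<lambda>n. cdf (push_powr (K n) (1 / real n)) x" and ?h = "neg_eta M"
  have eq: "stieltjes (K n) (r ^ n * ?h r) = stieltjes M r" if "0 < r" for n r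
    unfolding stieltjes_eq_neg_eta K(2)[OF that] ..
  have h: "0 < ?h r" if "0 < r" for r by (rule neg_eta_pos[OF M that])
  have R: "r ^ n * ?h r * x ^ n = ?h r * (r * x) ^ n" for r n by (simp add: power_mult_distrib)
  have upper: "?c n \<le> stieltjes M r * (1 + ?h r * (r * x) ^ n)"
    and lower: "stieltjes M r \<le> ?c n + 1 / (1 + ?h r * (r * x) ^ n)" if n: "0 < n" and r: "0 < r" for n r
    using stieltjes_tail_bounds[OF K(1), of "r ^ n * ?h r" "x ^ n" n] r x h[OF r]
    unfolding cdf_push_powr_root[OF K(1) n x] R eq[OF r] by auto
  have cont: "isCont (stieltjes M) (1 / x)" using x by (intro isCont_stieltjes[OF M(1)]) simp
  have lim_r: "(stieltjes M \<longlongrightarrow> stieltjes M (1 / x)) (at_right (1 / x))"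
    and lim_l: "(stieltjes M \<longlongrightarrow> stieltjes M (1 / x)) (at_left (1 / x))"
    using cont unfolding isCont_def by (simp_all add: filterlim_at_split)
  show ?thesis
  proof (rule order_tendstoI)
    fix a assume "a < stieltjes M (1 / x)"
    then have "eventually (\<lambda>r. a < stieltjes M r) (at_right (1 / x))" by (rule order_tendstoD(1)[OF lim_r])
    then have "eventually (\<lambda>r. a < stieltjes M r \<and> 1 / x < r) (at_right (1 / x))"
      using eventually_at_right_less by (rule eventually_conj)
    then obtain r where r: "a < stieltjes M r" "1 / x < r"
      using eventually_happens'[OF trivial_limit_at_right_real] by blast
    have r0: "0 < r" using r(2) x by (meson less_trans zero_less_divide_1_iff)
    have rx: "1 < r * x" using r(2) x by (simp add: field_simps)
    have "filterlim (\<lambda>n. (r * x) ^ n) at_top sequentially"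
      by (rule filterlim_at_infinity_imp_filterlim_at_top[OF filterlim_realpow_sequentially_gt1]) (use rx in auto)
    then have "filterlim (\<lambda>n. 1 + ?h r * (r * x) ^ n) at_top sequentially"
      by (intro filterlim_tendsto_add_at_top[OF tendsto_const] filterlim_tendsto_pos_mult_at_top[OF tendsto_const h[OF r0]])
    then have "(\<lambda>n. 1 / (1 + ?h r * (r * x) ^ n)) \<longlonglongrightarrow> 0"
      by (intro tendsto_divide_0[OF tendsto_const] filterlim_at_top_imp_at_infinity)
    then have "eventually (\<lambda>n. 1 / (1 + ?h r * (r * x) ^ n) < stieltjes M r - a) sequentially"
      by (rule order_tendstoD(2)) (use r(1) in simp)
    then show "eventually (\<lambda>n. a < ?c n) sequentially"
      using eventually_gt_at_top[of 0]
    proof eventually_elim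
      case (elim n) then show ?case using lower[OF elim(2) r0] by linarith
    qed
  next
    fix a assume "stieltjes M (1 / x) < a"
    then have "eventually (\<lambda>r. stieltjes M r < a) (at_left (1 / x))" by (rule order_tendstoD(2)[OF lim_l])
    moreover have "eventually (\<lambda>r. 0 < r \<and> r < 1 / x) (at_left (1 / x))"
      unfolding eventually_at_left_field using x by (intro exI[of _ 0]) auto
    ultimately have "eventually (\<lambda>r. stieltjes M r < a \<and> 0 < r \<and> r < 1 / x) (at_left (1 / x))"
      by (rule eventually_conj)
    then obtain r where r: "stieltjes M r < a" "0 < r" "r < 1 / x"
      using eventually_happens'[OF trivial_limit_at_left_real] by blast
    have rx: "0 < r * x" "r * x < 1" using r x by (auto simp: field_simps)
    have "(\<lambda>n. stieltjes M r * (1 + ?h r * (r * x) ^ n)) \<longlonglongrightarrow> stieltjes M r * (1 + ?h r * 0)"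
      by (intro tendsto_intros LIMSEQ_realpow_zero) (use rx in auto)
    then have "eventually (\<lambda>n. stieltjes M r * (1 + ?h r * (r * x) ^ n) < a) sequentially"
      by (rule order_tendstoD(2)) (use r(1) in simp)
    then show "eventually (\<lambda>n. ?c n < a) sequentially"
      using eventually_gt_at_top[of 0]
    proof eventually_elim
      case (elim n) then show ?case using upper[OF elim(2) r(2)] by linarith
    qed
  qed
qed

lemma free_powers_weak_conv:
  assumes M: "M \<in> prob_nonneg" "M \<noteq> dirac 0"
    and K: "\<And>n. K n \<in> prob_nonneg" "\<And>n r. 0 < r \<Longrightarrow> neg_eta (K n) (r ^ n * neg_eta M r) = neg_eta M r"
    and L: "L \<in> prob_nonneg" "\<And>x. 0 < x \<Longrightarrow> cdf L x = stieltjes M (1 / x)"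
  shows "weak_conv_m (\<lambda>n. push_powr (K n) (1 / real n)) L"
  unfolding weak_conv_m_def weak_conv_def
proof (intro allI impI)
  fix x assume cont: "isCont (cdf L) x"
  let ?c = "\<lambda>n. cdf (push_powr (K n) (1 / real n))"
  have PK: "push_powr (K n) (1 / real n) \<in> prob_nonneg" for n by (rule push_powr_prob_nonneg[OF K(1)])
  consider "x < 0" | "x = 0" | "0 < x" by linarith
  then show "(\<lambda>n. ?c n x) \<longlonglongrightarrow> cdf L x"
  proof cases
    case 1
    then show ?thesis using cdf_neg[OF PK] cdf_neg[OF L(1)] by simp
  next
    case 3
    then show ?thesis unfolding L(2)[OF 3] by (rule free_powers_cdf_limit[OF M _ K])
  next
    \<comment> \<open>Continuity at 0 means that \<open>L\<close> has no atom there; the values at 0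
      are squeezed between 0 and those at a small y > 0.\<close>
    case 2
    interpret L: real_distribution L using prob_nonnegD[OF L(1)] by simp
    have "(cdf L \<longlongrightarrow> cdf L 0) (at_left 0)"
      using cont 2 by (simp add: isCont_def filterlim_at_split)
    moreover have "eventually (\<lambda>x. cdf L x = 0) (at_left 0)"
      unfolding eventually_at_left_field using cdf_neg[OF L(1)] by (intro exI[of _ "-1"]) auto
    ultimately have "((\<lambda>x::real. 0) \<longlongrightarrow> cdf L 0) (at_left 0)" by (rule Lim_transform_eventually)
    then have L0: "cdf L 0 = 0"
      by (rule tendsto_unique[OF trivial_limit_at_left_real tendsto_const, symmetric])
    have "(\<lambda>n. ?c n 0) \<longlonglongrightarrow> 0"
    proof (rule order_tendstoI)
      fix a :: real assume "a < 0"
      moreover have "0 \<le> ?c n 0" for n by (simp add: cdf_def)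
      ultimately show "eventually (\<lambda>n. a < ?c n 0) sequentially"
        by (intro always_eventually allI) (rule less_le_trans)
    next
      fix a :: real assume a: "0 < a"
      have "(cdf L \<longlongrightarrow> 0) (at_right 0)"
        using L.cdf_is_right_cont[of 0] L0 by (simp add: continuous_within)
      then have "eventually (\<lambda>y. cdf L y < a) (at_right 0)" using a by (rule order_tendstoD(2))
      then have "eventually (\<lambda>y. cdf L y < a \<and> 0 < y) (at_right 0)"
        using eventually_at_right_less by (rule eventually_conj)
      then obtain y where y: "cdf L y < a" "0 < y"
        using eventually_happens'[OF trivial_limit_at_right_real] by blast
      have "(\<lambda>n. ?c n y) \<longlonglongrightarrow> cdf L y"
        unfolding L(2)[OF y(2)] by (rule free_powers_cdf_limit[OF M y(2) K])
      then have "eventually (\<lambda>n. ?c n y < a) sequentially" using y(1) by (rule order_tendstoD(2))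
      then show "eventually (\<lambda>n. ?c n 0 < a) sequentially"
      proof eventually_elim
        case (elim n)
        interpret P: real_distribution "push_powr (K n) (1 / real n)" using prob_nonnegD[OF PK] by simp
        show ?case using P.cdf_nondecreasing[of 0 y] y(2) elim by simp
      qed
    qed
    then show ?thesis using 2 L0 by simp
  qed
qed

lemma push_powr_dirac_zero: "push_powr (dirac 0) a = dirac 0"
  unfolding push_powr_def by (subst distr_return) auto

lemma free_mult_power_dirac_zero: "0 < n \<Longrightarrow> free_mult_power (dirac 0) n = dirac 0"
  by (cases n) (simp_all add: free_mult_conv_dirac_zero)

lemma Xi_spec:
  assumes M: "M \<in> prob_nonneg"
  shows "Xi M \<in> prob_nonneg" "\<And>x. 0 < x \<Longrightarrow> cdf (Xi M) x = stieltjes M (1 / x)"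
proof -
  obtain L where L: "L \<in> prob_nonneg" "\<And>x. 0 < x \<Longrightarrow> cdf L x = stieltjes M (1 / x)"
    by (rule stieltjes_recip_cdf_exists[OF M]) (rule that)
  have "Xi M = L"
  proof (cases "M = dirac 0")
    case True
    have "L = dirac 0"
    proof (rule cdf_unique)
      show "real_distribution L" "real_distribution (dirac 0)"
        using prob_nonnegD(5) L(1) dirac_prob_nonneg[of 0] by auto
      have "cdf L x = cdf (dirac 0) x" for x
      proof -
        consider "x < 0" | "x = 0" | "0 < x" by linarith
        then show ?thesis
        proof cases
          case 1 then show ?thesis using cdf_neg[OF L(1)] cdf_neg[OF dirac_prob_nonneg[of 0]] by simp
        next
          case 2
          then show ?thesis using cdf_at_zero[OF M L] True by (simp add: cdf_def measure_return)
        next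
          case 3 then show ?thesis using L(2) True by (simp add: cdf_def measure_return stieltjes_dirac)
        qed
      qed
      then show "cdf L = cdf (dirac 0)" by (rule ext)
    qed
    moreover have "Xi M = dirac 0"
      unfolding Xi_def True free_mult_conv_dirac_zero
    proof (rule free_lln_limit_eqI)
      show "free_mult_power (dirac 0) n \<in> prob_nonneg" for n
        using free_mult_power_dirac_zero[of n] dirac_prob_nonneg[of 0] dirac_prob_nonneg[of 1]
        by (cases "n = 0") auto
      \<comment> \<open>The power with exponent 0 is \<open>dirac 1\<close>, so the sequence is
        constant only from n = 1 on.\<close>
      have "(\<lambda>n. cdf (push_powr (free_mult_power (dirac 0) n) (1 / real n)) x) \<longlonglongrightarrow> cdf (dirac 0) x" for x
        by (rule Lim_transform_eventually[OF tendsto_const])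
           (rule eventually_mono[OF eventually_gt_at_top[of 0]], simp add: free_mult_power_dirac_zero push_powr_dirac_zero)
      then show "weak_conv_m (\<lambda>n. push_powr (free_mult_power (dirac 0) n) (1 / real n)) (dirac 0)"
        by (simp add: weak_conv_m_def weak_conv_def)
    qed (simp add: dirac_prob_nonneg)
    ultimately show ?thesis by simp
  next
    case False
    obtain K where K: "\<And>n. K n \<in> prob_nonneg" "K 0 = dirac 1"
      "\<And>n r. 0 < r \<Longrightarrow> neg_eta (K n) (r ^ n * neg_eta M r) = neg_eta M r"
      by (rule free_mult_powers_exist[OF M False]) (rule that)
    have conv: "push_powr marchenko_pastur (-1) \<boxtimes> marchenko_pastur \<boxtimes> M = K 1"
      using K(3)[of _ 1] by (intro mp_conv_eq[OF M False K(1)]) simp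
    have pow: "free_mult_power (K 1) n = K n" for n
      using cbf_neg_eta(1)[OF M] neg_eta_pos[OF M False] K(1,3,2) by (rule free_mult_power_eq)
    show ?thesis unfolding Xi_def conv
    proof (rule free_lln_limit_eqI)
      show "free_mult_power (K 1) n \<in> prob_nonneg" for n unfolding pow by (rule K(1))
      show "weak_conv_m (\<lambda>n. push_powr (free_mult_power (K 1) n) (1 / real n)) L"
        unfolding pow by (rule free_powers_weak_conv[OF M False K(1,3) L])
    qed (rule L(1))
  qed
  then show "Xi M \<in> prob_nonneg" "\<And>x. 0 < x \<Longrightarrow> cdf (Xi M) x = stieltjes M (1 / x)" using L by auto
qed

section \<open>Boolean convolutions and the homomorphism property\<close>

lemma boolean_add_conv_spec:
  assumes M: "M \<in> prob_nonneg" and N: "N \<in> prob_nonneg"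
  shows "M \<uplus> N \<in> prob_nonneg" "\<And>r. 0 < r \<Longrightarrow> neg_eta (M \<uplus> N) r = neg_eta M r + neg_eta N r"
proof -
  have "((\<lambda>r. neg_eta M r + neg_eta N r) \<longlongrightarrow> 0 + 0) (at_right 0)"
    by (intro tendsto_add cbf_neg_eta M N)
  then have lim: "((\<lambda>r. neg_eta M r + neg_eta N r) \<longlongrightarrow> 0) (at_right 0)" by simp
  obtain K where K: "K \<in> prob_nonneg" "\<And>r. 0 < r \<Longrightarrow> neg_eta K r = neg_eta M r + neg_eta N r"
    by (rule prob_nonneg_of_neg_eta[OF cbf_add[OF cbf_neg_eta(1)[OF M] cbf_neg_eta(1)[OF N]] lim]) (rule that)
  have eta: "eta P t = - neg_eta P (- t)" if "P \<in> prob_nonneg" "t < 0" for P t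
    using eta_eq_neg_eta[OF that(1), of "- t"] that(2) by simp
  have "M \<uplus> N = K"
    unfolding boolean_add_conv_def
  proof (rule the_equality)
    show "K \<in> prob_nonneg \<and> (\<forall>t<0. eta K t = eta M t + eta N t)"
      using K eta M N by simp
    fix K' assume K': "K' \<in> prob_nonneg \<and> (\<forall>t<0. eta K' t = eta M t + eta N t)"
    show "K' = K"
    proof (rule neg_eta_unique[OF _ K(1) zero_less_one])
      show "K' \<in> prob_nonneg" using K' by simp
      fix r :: real assume r: "0 < r"
      have "eta K' (- r) = eta M (- r) + eta N (- r)" using K' r by simp
      then show "neg_eta K' r = neg_eta K r"
        using eta[of K' "- r"] eta[OF M, of "- r"] eta[OF N, of "- r"] K' K(2)[OF r] r by simp
    qed
  qed
  then show "M \<uplus> N \<in> prob_nonneg" "\<And>r. 0 < r \<Longrightarrow> neg_eta (M \<uplus> N) r = neg_eta M r + neg_eta N r"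
    using K by auto
qed

lemma boolean_max_conv_eqI:
  assumes K: "K \<in> prob_nonneg"
    and eq: "\<And>t. 0 \<le> t \<Longrightarrow> if measure M {0..t} = 0 \<or> measure N {0..t} = 0 then measure K {0..t} = 0
      else 1 / measure K {0..t} = 1 / measure M {0..t} + 1 / measure N {0..t} - 1"
  shows "M \<or>\<^sub>b N = K"
  unfolding boolean_max_conv_def
proof (rule the_equality)
  fix K' assume K': "K' \<in> prob_nonneg \<and> (\<forall>t\<ge>0. if measure M {0..t} = 0 \<or> measure N {0..t} = 0
      then measure K' {0..t} = 0
      else 1 / measure K' {0..t} = 1 / measure M {0..t} + 1 / measure N {0..t} - 1)"
  have "cdf K' t = cdf K t" for t
  proof (cases "t < 0")
    case True then show ?thesis using cdf_neg K K' by simp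
  next
    case False
    then have t: "0 \<le> t" by simp
    have "measure K' {0..t} = measure K {0..t}"
    proof (cases "measure M {0..t} = 0 \<or> measure N {0..t} = 0")
      case True then show ?thesis using eq[OF t] K' t by simp
    next
      case False
      then have "1 / measure K' {0..t} = 1 / measure K {0..t}" using eq[OF t] K' t by simp
      then show ?thesis by simp
    qed
    then show ?thesis using cdf_eq_measure_Icc[OF _ t] K K' by simp
  qed
  then show "K' = K" using K K' by (intro cdf_unique prob_nonnegD(5) ext) auto
qed (use K eq in blast)

text \<open>Limit at infinity of the relation between reciprocal transforms. Atoms may vanish, so
  the relation is first cleared of denominators; a vanishing atom of \<open>M\<close> or
  \<open>N\<close> is handled by the comparison of \<open>stieltjes K\<close> with the other two
  transforms.\<close>

lemma boolean_add_conv_atom: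
  assumes M: "M \<in> prob_nonneg" and N: "N \<in> prob_nonneg" and K: "K \<in> prob_nonneg"
    and eq: "\<And>r. 0 < r \<Longrightarrow> neg_eta K r = neg_eta M r + neg_eta N r"
  shows "if measure M {0} = 0 \<or> measure N {0} = 0 then measure K {0} = 0
    else 1 / measure K {0} = 1 / measure M {0} + 1 / measure N {0} - 1"
proof -
  let ?m = "measure M {0}" and ?n = "measure N {0}" and ?k = "measure K {0}"
  have inv: "1 / stieltjes K r = 1 / stieltjes M r + 1 / stieltjes N r - 1" if "0 < r" for r
    using eq[OF that] by (simp add: neg_eta_def)
  have le: "stieltjes K r \<le> stieltjes M r" "stieltjes K r \<le> stieltjes N r" if r: "0 < r" for r
    unfolding stieltjes_eq_neg_eta eq[OF r]
    using neg_eta_nonneg[OF M, of r] neg_eta_nonneg[OF N, of r] r by (auto intro!: divide_left_mono mult_pos_pos)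
  have "?k \<le> ?m" "?k \<le> ?n"
    by (rule tendsto_le[OF trivial_limit_at_top_linorder stieltjes_tendsto_top stieltjes_tendsto_top];
        use M N K le in \<open>auto intro: eventually_mono[OF eventually_gt_at_top[of 0]]\<close>)+
  then have zero: "?k = 0" if "?m = 0 \<or> ?n = 0"
    using that measure_nonneg[of K "{0}"] by (metis order_antisym)
  have prod: "?k * (?m + ?n - ?m * ?n) = ?m * ?n"
  proof (rule tendsto_unique[OF trivial_limit_at_top_linorder])
    show "((\<lambda>r. stieltjes K r * (stieltjes M r + stieltjes N r - stieltjes M r * stieltjes N r))
        \<longlongrightarrow> ?k * (?m + ?n - ?m * ?n)) at_top"
      by (intro tendsto_intros stieltjes_tendsto_top M N K)
    show "((\<lambda>r. stieltjes K r * (stieltjes M r + stieltjes N r - stieltjes M r * stieltjes N r))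
        \<longlongrightarrow> ?m * ?n) at_top"
    proof (rule Lim_transform_eventually)
      show "((\<lambda>r. stieltjes M r * stieltjes N r) \<longlongrightarrow> ?m * ?n) at_top"
        by (intro tendsto_intros stieltjes_tendsto_top M N)
      show "eventually (\<lambda>r. stieltjes M r * stieltjes N r
          = stieltjes K r * (stieltjes M r + stieltjes N r - stieltjes M r * stieltjes N r)) at_top"
        using eventually_gt_at_top[of 0]
      proof eventually_elim
        case (elim r)
        have "0 < stieltjes M r" "0 < stieltjes N r" "0 < stieltjes K r"
          using elim by (auto intro: stieltjes_pos M N K)
        then show ?case using inv[OF elim] by (simp add: field_simps)
      qed
    qed
  qed
  have "1 / ?k = 1 / ?m + 1 / ?n - 1" if "?m \<noteq> 0" "?n \<noteq> 0"
  proof -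
    have "?k \<noteq> 0" using prod that by auto
    then show ?thesis using prod that by (simp add: field_simps)
  qed
  then show ?thesis using zero by simp
qed

theorem theorem3p8:
  shows "Xi \<in> prob_nonneg \<rightarrow> prob_nonneg \<and>
         (\<forall>\<mu> \<in> prob_nonneg. \<forall>\<nu> \<in> prob_nonneg. Xi (\<mu> \<uplus> \<nu>) = Xi \<mu> \<or>\<^sub>b Xi \<nu>)"
proof (intro conjI ballI funcsetI)
  show "Xi \<mu> \<in> prob_nonneg" if "\<mu> \<in> prob_nonneg" for \<mu> using Xi_spec(1)[OF that] .
  fix \<mu> \<nu> assume M: "\<mu> \<in> prob_nonneg" and N: "\<nu> \<in> prob_nonneg"
  note K = boolean_add_conv_spec[OF M N]
  have Icc: "measure (Xi P) {0..t} = stieltjes P (1 / t)" if "P \<in> prob_nonneg" "0 < t" for P t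
    using cdf_eq_measure_Icc[OF Xi_spec(1)[OF that(1)], of t] Xi_spec(2)[OF that] that(2) by simp
  \<comment> \<open>The point t = 0 is separate from the formula with 1 / t: there the distribution
    function of \<open>Xi P\<close> is the atom of \<open>P\<close>, by right-continuity.\<close>
  have zero: "measure (Xi P) {0..0} = measure P {0}" if "P \<in> prob_nonneg" for P
    using cdf_eq_measure_Icc[OF Xi_spec(1)[OF that], of 0] cdf_at_zero[OF that Xi_spec[OF that]] by simp
  have "Xi \<mu> \<or>\<^sub>b Xi \<nu> = Xi (\<mu> \<uplus> \<nu>)"
  proof (rule boolean_max_conv_eqI[OF Xi_spec(1)[OF K(1)]])
    fix t :: real assume "0 \<le> t"
    then consider "t = 0" | "0 < t" by linarith
    then show "if measure (Xi \<mu>) {0..t} = 0 \<or> measure (Xi \<nu>) {0..t} = 0 then measure (Xi (\<mu> \<uplus> \<nu>)) {0..t} = 0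
      else 1 / measure (Xi (\<mu> \<uplus> \<nu>)) {0..t} = 1 / measure (Xi \<mu>) {0..t} + 1 / measure (Xi \<nu>) {0..t} - 1"
    proof cases
      case 1
      show ?thesis
        unfolding 1 zero[OF M] zero[OF N] zero[OF K(1)] by (rule boolean_add_conv_atom[OF M N K])
    next
      case 2
      then have "0 < stieltjes \<mu> (1 / t)" "0 < stieltjes \<nu> (1 / t)" by (auto intro: stieltjes_pos M N)
      moreover have "1 / stieltjes (\<mu> \<uplus> \<nu>) (1 / t) = 1 / stieltjes \<mu> (1 / t) + 1 / stieltjes \<nu> (1 / t) - 1"
        using K(2)[of "1 / t"] 2 by (simp add: neg_eta_def)
      ultimately show ?thesis
        unfolding Icc[OF M 2] Icc[OF N 2] Icc[OF K(1) 2] by simp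
    qed
  qed
  then show "Xi (\<mu> \<uplus> \<nu>) = Xi \<mu> \<or>\<^sub>b Xi \<nu>" ..
qed

end
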